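(* Let $\mathcal{C}$ be a triangulated category with suspension functor $\Sigma$, and let $T\in\mathcal{C}$ be a rigid object which is contravariantly finite. Let $\mathcal{W}$ be the class of morphisms $f:X\to Y$ such that, for any triangle $Z\xrightarrow{g}X\xrightarrow{f}Y\xrightarrow{h}\Sigma Z$, both $g$ and $h$ belong to the ideal $(T^\perp)$. Let $J=\{0\to\Sigma T\}$ and let $I=\bigcup\mathcal{C}(R,A)$, where the union is taken over a set of representatives for the isomorphism classes of objects $R\in\operatorname{add}T$ and $A\in T\ast\Sigma T$. Put $\mathcal{F}ib:=J^\square$, $w\mathcal{F}ib:=I^\square$ and $\mathcal{C}of:={}^\square(w\mathcal{F}ib)$. Then $(\mathcal{W},\mathcal{F}ib,\mathcal{C}of)$ (as weak equivalences, fibrations and cofibrations) is a left-weak model category structure on $\mathcal{C}$. Moreover: (i) All objects are fibrant. (ii) An object is cofibrant if and only if it belongs to $T\ast\Sigma T$. (iii) Two morphisms $f,g:X\to Y$, where $X$ and $Y$ are fibrant and cofibrant, are homotopic if and only if $f-g$ factors through $\operatorname{add}\Sigma T$.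
   Context: **Triangulated notions.** $T$ is rigid if $\mathcal{C}(T,\Sigma T)=0$. $\operatorname{add}T$ is the full subcategory of direct summands of finite direct sums of copies of $T$. $T$ is contravariantly finite if for every $X\in\mathcal{C}$ there is a morphism $D\to X$ with $D\in\operatorname{add}T$ through which every morphism $D'\to X$ with $D'\in\operatorname{add}T$ factors. $T\ast\Sigma T$ is the full subcategory of $\mathcal{C}$ whose objects are cones of morphisms in $\operatorname{add}T$. $T^\perp$ is the full subcategory of objects $X$ with $\mathcal{C}(T,X)=0$, and $(T^\perp)$ is the ideal of morphisms factoring through an object of $T^\perp$. **Homotopical notions.** Let $\mathcal{C}$ be a category with three classes of morphisms: $\mathcal{W}$ (weak equivalences), $\mathcal{C}of$ (cofibrations), $\mathcal{F}ib$ (fibrations). A trivial (or weak) cofibration, resp. fibration, is a cofibration, resp. fibration, which is in $\mathcal{W}$. Write $f\,\square\,g$, for $f:A\to B$ and $g:X\to Y$, if for all $u:A\to X$, $v:B\to Y$ with $gu=vf$ there is $\alpha:B\to X$ with $\alpha f=u$ and $g\alpha=v$. For a class $\mathcal{A}$ of morphisms, ${}^\square\mathcal{A}$ (resp. $\mathcal{A}^\square$) is the class of morphisms $f$ with $f\,\square\,a$ (resp. $a\,\square\,f$) for all $a\in\mathcal{A}$. A cylinder object for $X$ is a factorisation $X\coprod X\to X'\xrightarrow{\sim}X$ of the codiagonal $\nabla$ whose second morphism is in $\mathcal{W}$. A left homotopy from $f$ to $g$ ($f,g:X\to Y$) is a morphism $H:X'\to Y$ from a cylinder object such that $X\coprod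 X\to X'\xrightarrow{H}Y$ is $[f\ g]$; if one exists write $f\sim^l g$. A path object for $Y$ is a factorisation $Y\xrightarrow{\sim}Y'\to Y\times Y$ of the diagonal whose first morphism is in $\mathcal{W}$. A right homotopy from $f$ to $g$ is a morphism $K:X\to Y'$ to a path object such that $X\xrightarrow{K}Y'\to Y\times Y$ is $(f,g)$; if one exists write $f\sim^r g$. $f$ and $g$ are homotopic, $f\sim g$, if $f\sim^l g$ and $f\sim^r g$. With $\emptyset$ initial and $\ast$ final, $X$ is fibrant if $X\to\ast$ is a fibration, and $B$ is cofibrant if $\emptyset\to B$ is a cofibration. For $f:A\to B$, $g:X\to Y$, write $f\,\square^r\,g$ (resp. $f\,\square^l\,g$) if for all $u:A\to X$, $v:B\to Y$ with $gu=vf$ there is $\alpha:B\to X$ with $g\alpha=v$ and $\alpha f\sim^r u$ (resp. $g\alpha\sim^l v$ and $\alpha f=u$). A morphism $j$ is a homotopy cofibration if $j\,\square^r\,p$ and $j\,\square^l\,p$ for every $p\in\mathcal{W}\cap\mathcal{F}ib$. $\mathcal{C}$ with $(\mathcal{W},\mathcal{C}of,\mathcal{F}ib)$ is a left-weak model category if: (0) $\mathcal{C}$ has finite products and coproducts (including an initial object $\emptyset$ and a final object $\ast$). Pull-backs of trivial fibrations along epimorphisms exist and are trivial fibrations. (0.5) If $A$ is cofibrant and $A\to B$ is a homotopy cofibration, then $B$ is cofibrant. If $B$ is cofibrant, then for every $A$ the canonical inclusions $A\to A\coprod B$ and $A\to B\coprod A$ are cofibrations. (1) If $f,g$ are composable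 and any two of $f,g,gf$ are in $\mathcal{W}$, then so is the third. (2) $\mathcal{W},\mathcal{C}of,\mathcal{F}ib$ contain all identities and are stable under composition and retracts (in the category of morphisms). (3) $\mathcal{W}\cap\mathcal{C}of\subseteq{}^\square\mathcal{F}ib$ and $\mathcal{C}of\subseteq{}^\square(\mathcal{F}ib\cap\mathcal{W})$. (4) Every morphism factors as a trivial cofibration followed by a fibration. Every morphism with cofibrant domain factors as a homotopy cofibration followed by a trivial fibration. *)

theory Defs
  imports "HOL-Algebra.Group"
begin

section \<open>Categories\<close>

record ('o, 'm) category =
  Obj :: "'o set"
  Arr :: "'m set"
  Dom :: "'m \<Rightarrow> 'o"
  Cod :: "'m \<Rightarrow> 'o"
  Ident :: "'o \<Rightarrow> 'm"
  Cmp :: "'m \<Rightarrow> 'm \<Rightarrow> 'm"  (infixl "\<cdot>\<index>" 70)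

definition Hom :: "('o, 'm, 'x) category_scheme \<Rightarrow> 'o \<Rightarrow> 'o \<Rightarrow> 'm set" where
  "Hom C X Y = {f \<in> Arr C. Dom C f = X \<and> Cod C f = Y}"

text \<open>Composition is written in applicative order: \<open>g \<cdot> f\<close> is \<open>f\<close> followed by \<open>g\<close>.\<close>

locale category =
  fixes C :: "('o, 'm, 'x) category_scheme" (structure)
  assumes Dom_Obj: "f \<in> Arr C \<Longrightarrow> Dom C f \<in> Obj C"
    and Cod_Obj: "f \<in> Arr C \<Longrightarrow> Cod C f \<in> Obj C"
    and Ident_Hom: "X \<in> Obj C \<Longrightarrow> Ident C X \<in> Hom C X X"
    and Cmp_Hom: "\<lbrakk>f \<in> Hom C X Y; g \<in> Hom C Y Z\<rbrakk> \<Longrightarrow> g \<cdot> f \<in> Hom C X Z"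
    and Ident_left: "f \<in> Hom C X Y \<Longrightarrow> Ident C Y \<cdot> f = f"
    and Ident_right: "f \<in> Hom C X Y \<Longrightarrow> f \<cdot> Ident C X = f"
    and Cmp_assoc: "\<lbrakk>f \<in> Hom C X Y; g \<in> Hom C Y Z; h \<in> Hom C Z V\<rbrakk> \<Longrightarrow> h \<cdot> g \<cdot> f = h \<cdot> (g \<cdot> f)"

definition initial_object :: "('o, 'm, 'x) category_scheme \<Rightarrow> 'o \<Rightarrow> bool" where
  "initial_object C E \<longleftrightarrow> E \<in> Obj C \<and> (\<forall>X \<in> Obj C. \<exists>!f. f \<in> Hom C E X)"

definition final_object :: "('o, 'm, 'x) category_scheme \<Rightarrow> 'o \<Rightarrow> bool" where
  "final_object C E \<longleftrightarrow> E \<in> Obj C \<and> (\<forall>X \<in> Obj C. \<exists>!f. f \<in> Hom C X E)"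

definition zero_object :: "('o, 'm, 'x) category_scheme \<Rightarrow> 'o \<Rightarrow> bool" where
  "zero_object C E \<longleftrightarrow> initial_object C E \<and> final_object C E"

definition inverse_arrows :: "('o, 'm, 'x) category_scheme \<Rightarrow> 'm \<Rightarrow> 'm \<Rightarrow> bool" where
  "inverse_arrows C f g \<longleftrightarrow>
     f \<in> Hom C (Cod C g) (Dom C g) \<and> g \<in> Hom C (Cod C f) (Dom C f) \<and>
     g \<cdot>\<^bsub>C\<^esub> f = Ident C (Dom C f) \<and> f \<cdot>\<^bsub>C\<^esub> g = Ident C (Cod C f)"

definition iso_arrow :: "('o, 'm, 'x) category_scheme \<Rightarrow> 'm \<Rightarrow> bool" where
  "iso_arrow C f \<longleftrightarrow> (\<exists>g. inverse_arrows C f g)"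

definition isomorphic :: "('o, 'm, 'x) category_scheme \<Rightarrow> 'o \<Rightarrow> 'o \<Rightarrow> bool" where
  "isomorphic C X Y \<longleftrightarrow> (\<exists>f \<in> Hom C X Y. iso_arrow C f)"

definition epi :: "('o, 'm, 'x) category_scheme \<Rightarrow> 'm \<Rightarrow> bool" where
  "epi C e \<longleftrightarrow> e \<in> Arr C \<and>
     (\<forall>Q. \<forall>u \<in> Hom C (Cod C e) Q. \<forall>v \<in> Hom C (Cod C e) Q.
        u \<cdot>\<^bsub>C\<^esub> e = v \<cdot>\<^bsub>C\<^esub> e \<longrightarrow> u = v)"

definition is_product ::
    "('o, 'm, 'x) category_scheme \<Rightarrow> 'o \<Rightarrow> 'o \<Rightarrow> 'o \<Rightarrow> 'm \<Rightarrow> 'm \<Rightarrow> bool" where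
  "is_product C A B P p q \<longleftrightarrow>
     P \<in> Obj C \<and> p \<in> Hom C P A \<and> q \<in> Hom C P B \<and>
     (\<forall>Q. \<forall>f \<in> Hom C Q A. \<forall>g \<in> Hom C Q B.
        \<exists>!u. u \<in> Hom C Q P \<and> p \<cdot>\<^bsub>C\<^esub> u = f \<and> q \<cdot>\<^bsub>C\<^esub> u = g)"

definition is_coproduct ::
    "('o, 'm, 'x) category_scheme \<Rightarrow> 'o \<Rightarrow> 'o \<Rightarrow> 'o \<Rightarrow> 'm \<Rightarrow> 'm \<Rightarrow> bool" where
  "is_coproduct C A B P i j \<longleftrightarrow>
     P \<in> Obj C \<and> i \<in> Hom C A P \<and> j \<in> Hom C B P \<and>
     (\<forall>Q. \<forall>f \<in> Hom C A Q. \<forall>g \<in> Hom C B Q.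
        \<exists>!u. u \<in> Hom C P Q \<and> u \<cdot>\<^bsub>C\<^esub> i = f \<and> u \<cdot>\<^bsub>C\<^esub> j = g)"

text \<open>The case \<open>n = 0\<close> of the next two definitions asks for a final, resp. initial, object.\<close>

definition has_finite_products :: "('o, 'm, 'x) category_scheme \<Rightarrow> bool" where
  "has_finite_products C \<longleftrightarrow>
     (\<forall>(n::nat) A. (\<forall>k<n. A k \<in> Obj C) \<longrightarrow>
        (\<exists>P \<in> Obj C. \<exists>p. (\<forall>k<n. p k \<in> Hom C P (A k)) \<and>
           (\<forall>Q \<in> Obj C. \<forall>f. (\<forall>k<n. f k \<in> Hom C Q (A k)) \<longrightarrow>
              (\<exists>!u. u \<in> Hom C Q P \<and> (\<forall>k<n. p k \<cdot>\<^bsub>C\<^esub> u = f k)))))"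

definition has_finite_coproducts :: "('o, 'm, 'x) category_scheme \<Rightarrow> bool" where
  "has_finite_coproducts C \<longleftrightarrow>
     (\<forall>(n::nat) A. (\<forall>k<n. A k \<in> Obj C) \<longrightarrow>
        (\<exists>P \<in> Obj C. \<exists>i. (\<forall>k<n. i k \<in> Hom C (A k) P) \<and>
           (\<forall>Q \<in> Obj C. \<forall>f. (\<forall>k<n. f k \<in> Hom C (A k) Q) \<longrightarrow>
              (\<exists>!u. u \<in> Hom C P Q \<and> (\<forall>k<n. u \<cdot>\<^bsub>C\<^esub> i k = f k)))))"

text \<open>\<open>is_pullback C p e P p' e'\<close>: the square with \<open>p : X \<rightarrow> Y\<close>, \<open>e : Z \<rightarrow> Y\<close>, \<open>p' : P \<rightarrow> Z\<close>,
  \<open>e' : P \<rightarrow> X\<close> is cartesian, so that \<open>p'\<close> is the pull-back of \<open>p\<close> along \<open>e\<close>.\<close>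

definition is_pullback ::
    "('o, 'm, 'x) category_scheme \<Rightarrow> 'm \<Rightarrow> 'm \<Rightarrow> 'o \<Rightarrow> 'm \<Rightarrow> 'm \<Rightarrow> bool" where
  "is_pullback C p e P p' e' \<longleftrightarrow>
     P \<in> Obj C \<and> p \<in> Arr C \<and> e \<in> Arr C \<and> Cod C p = Cod C e \<and>
     p' \<in> Hom C P (Dom C e) \<and> e' \<in> Hom C P (Dom C p) \<and> p \<cdot>\<^bsub>C\<^esub> e' = e \<cdot>\<^bsub>C\<^esub> p' \<and>
     (\<forall>Q. \<forall>a \<in> Hom C Q (Dom C p). \<forall>b \<in> Hom C Q (Dom C e). p \<cdot>\<^bsub>C\<^esub> a = e \<cdot>\<^bsub>C\<^esub> b \<longrightarrow>
        (\<exists>!u. u \<in> Hom C Q P \<and> e' \<cdot>\<^bsub>C\<^esub> u = a \<and> p' \<cdot>\<^bsub>C\<^esub> u = b))"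

definition retract_of :: "('o, 'm, 'x) category_scheme \<Rightarrow> 'm \<Rightarrow> 'm \<Rightarrow> bool" where
  "retract_of C f g \<longleftrightarrow> f \<in> Arr C \<and> g \<in> Arr C \<and>
     (\<exists>i \<in> Hom C (Dom C f) (Dom C g). \<exists>r \<in> Hom C (Dom C g) (Dom C f).
      \<exists>j \<in> Hom C (Cod C f) (Cod C g). \<exists>s \<in> Hom C (Cod C g) (Cod C f).
        r \<cdot>\<^bsub>C\<^esub> i = Ident C (Dom C f) \<and> s \<cdot>\<^bsub>C\<^esub> j = Ident C (Cod C f) \<and>
        g \<cdot>\<^bsub>C\<^esub> i = j \<cdot>\<^bsub>C\<^esub> f \<and> f \<cdot>\<^bsub>C\<^esub> r = s \<cdot>\<^bsub>C\<^esub> g)"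

definition factors_through ::
    "('o, 'm, 'x) category_scheme \<Rightarrow> 'm \<Rightarrow> 'o set \<Rightarrow> bool" where
  "factors_through C f K \<longleftrightarrow> f \<in> Arr C \<and>
     (\<exists>P \<in> K. \<exists>a \<in> Hom C (Dom C f) P. \<exists>b \<in> Hom C P (Cod C f). f = b \<cdot>\<^bsub>C\<^esub> a)"

definition representatives :: "('o, 'm, 'x) category_scheme \<Rightarrow> 'o set \<Rightarrow> 'o set \<Rightarrow> bool" where
  "representatives C R K \<longleftrightarrow> R \<subseteq> K \<and> (\<forall>X \<in> K. \<exists>!Y. Y \<in> R \<and> isomorphic C X Y)"


section \<open>Additive categories\<close>

record ('o, 'm) preadditive_category = "('o, 'm) category" +
  MAdd :: "'m \<Rightarrow> 'm \<Rightarrow> 'm"  (infixl "\<boxplus>\<index>" 65)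
  MZero :: "'o \<Rightarrow> 'o \<Rightarrow> 'm"

text \<open>The abelian group of morphisms from \<open>X\<close> to \<open>Y\<close>; the library's groups are multiplicative,
  so its product is the sum of morphisms and its unit the zero morphism.\<close>

definition hom_group :: "('o, 'm, 'x) preadditive_category_scheme \<Rightarrow> 'o \<Rightarrow> 'o \<Rightarrow> 'm monoid" where
  "hom_group C X Y = \<lparr>carrier = Hom C X Y, mult = MAdd C, one = MZero C X Y\<rparr>"

definition MNeg :: "('o, 'm, 'x) preadditive_category_scheme \<Rightarrow> 'm \<Rightarrow> 'm" where
  "MNeg C f = inv\<^bsub>hom_group C (Dom C f) (Cod C f)\<^esub> f"

definition MDiff :: "('o, 'm, 'x) preadditive_category_scheme \<Rightarrow> 'm \<Rightarrow> 'm \<Rightarrow> 'm" where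
  "MDiff C f g = f \<boxplus>\<^bsub>C\<^esub> MNeg C g"

locale preadditive_category = category C
  for C :: "('o, 'm, 'x) preadditive_category_scheme" (structure) +
  assumes hom_comm_group: "\<lbrakk>X \<in> Obj C; Y \<in> Obj C\<rbrakk> \<Longrightarrow> comm_group (hom_group C X Y)"
    and Cmp_add_left: "\<lbrakk>f \<in> Hom C X Y; g \<in> Hom C Y Z; g' \<in> Hom C Y Z\<rbrakk>
          \<Longrightarrow> (g \<boxplus> g') \<cdot> f = (g \<cdot> f) \<boxplus> (g' \<cdot> f)"
    and Cmp_add_right: "\<lbrakk>f \<in> Hom C X Y; f' \<in> Hom C X Y; g \<in> Hom C Y Z\<rbrakk>
          \<Longrightarrow> g \<cdot> (f \<boxplus> f') = (g \<cdot> f) \<boxplus> (g \<cdot> f')"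

text \<open>\<open>S\<close> is a direct sum (biproduct) of \<open>X\<close> and \<open>Y\<close>. No direct sums are chosen, so this is
  automatically invariant under isomorphism of \<open>S\<close>.\<close>

definition direct_sum :: "('o, 'm, 'x) preadditive_category_scheme \<Rightarrow> 'o \<Rightarrow> 'o \<Rightarrow> 'o \<Rightarrow> bool" where
  "direct_sum C X Y S \<longleftrightarrow> X \<in> Obj C \<and> Y \<in> Obj C \<and> S \<in> Obj C \<and>
     (\<exists>i \<in> Hom C X S. \<exists>j \<in> Hom C Y S. \<exists>p \<in> Hom C S X. \<exists>q \<in> Hom C S Y.
        p \<cdot>\<^bsub>C\<^esub> i = Ident C X \<and> q \<cdot>\<^bsub>C\<^esub> j = Ident C Y \<and>
        p \<cdot>\<^bsub>C\<^esub> j = MZero C Y X \<and> q \<cdot>\<^bsub>C\<^esub> i = MZero C X Y \<and>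
        (i \<cdot>\<^bsub>C\<^esub> p) \<boxplus>\<^bsub>C\<^esub> (j \<cdot>\<^bsub>C\<^esub> q) = Ident C S)"

locale additive_category = preadditive_category C
  for C :: "('o, 'm, 'x) preadditive_category_scheme" (structure) +
  assumes ex_zero_object: "\<exists>E. zero_object C E"
    and ex_direct_sum: "\<lbrakk>X \<in> Obj C; Y \<in> Obj C\<rbrakk> \<Longrightarrow> \<exists>S. direct_sum C X Y S"

inductive finite_power :: "('o, 'm, 'x) preadditive_category_scheme \<Rightarrow> 'o \<Rightarrow> 'o \<Rightarrow> bool"
  for C :: "('o, 'm, 'x) preadditive_category_scheme" and T :: 'o where
  zero: "zero_object C S \<Longrightarrow> finite_power C T S"
| step: "finite_power C T S \<Longrightarrow> direct_sum C S T S' \<Longrightarrow> finite_power C T S'"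

definition add_objects :: "('o, 'm, 'x) preadditive_category_scheme \<Rightarrow> 'o \<Rightarrow> 'o set" where
  "add_objects C T = {X \<in> Obj C. \<exists>Y S. finite_power C T S \<and> direct_sum C X Y S}"

definition contravariantly_finite ::
    "('o, 'm, 'x) preadditive_category_scheme \<Rightarrow> 'o \<Rightarrow> bool" where
  "contravariantly_finite C T \<longleftrightarrow>
     (\<forall>X \<in> Obj C. \<exists>D \<in> add_objects C T. \<exists>p \<in> Hom C D X.
        \<forall>D' \<in> add_objects C T. \<forall>q \<in> Hom C D' X. \<exists>r \<in> Hom C D' D. q = p \<cdot>\<^bsub>C\<^esub> r)"

definition perp :: "('o, 'm, 'x) preadditive_category_scheme \<Rightarrow> 'o \<Rightarrow> 'o set" where
  "perp C T = {X \<in> Obj C. Hom C T X = {MZero C T X}}"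


section \<open>Triangulated categories\<close>

text \<open>\<open>SObj\<close> and \<open>SArr\<close> are the suspension functor on objects and on morphisms, and \<open>Tri\<close> is the
  class of distinguished triangles: \<open>(f, g, h) \<in> Tri C\<close> stands for the triangle
  \<open>X \<rightarrow>f Y \<rightarrow>g Z \<rightarrow>h SObj C X\<close>, whose objects are determined by its morphisms.\<close>

record ('o, 'm) triangulated_category = "('o, 'm) preadditive_category" +
  SObj :: "'o \<Rightarrow> 'o"
  SArr :: "'m \<Rightarrow> 'm"
  Tri :: "('m \<times> 'm \<times> 'm) set"

definition candidate_triangle ::
    "('o, 'm, 'x) triangulated_category_scheme \<Rightarrow> 'm \<Rightarrow> 'm \<Rightarrow> 'm \<Rightarrow> bool" where
  "candidate_triangle C f g h \<longleftrightarrow>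
     f \<in> Arr C \<and> g \<in> Hom C (Cod C f) (Dom C h) \<and> h \<in> Hom C (Cod C g) (SObj C (Dom C f))"

text \<open>The suspension is only required to be an additive auto-equivalence, not an automorphism;
  this is why the rotation axiom is an equivalence. The last axiom is the octahedral axiom.\<close>

locale triangulated_category = additive_category C
  for C :: "('o, 'm, 'x) triangulated_category_scheme" (structure) +
  assumes SObj_Obj: "X \<in> Obj C \<Longrightarrow> SObj C X \<in> Obj C"
    and SArr_Hom: "f \<in> Hom C X Y \<Longrightarrow> SArr C f \<in> Hom C (SObj C X) (SObj C Y)"
    and SArr_Ident: "X \<in> Obj C \<Longrightarrow> SArr C (Ident C X) = Ident C (SObj C X)"
    and SArr_Cmp: "\<lbrakk>f \<in> Hom C X Y; g \<in> Hom C Y Z\<rbrakk> \<Longrightarrow> SArr C (g \<cdot> f) = SArr C g \<cdot> SArr C f"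
    and SArr_add: "\<lbrakk>f \<in> Hom C X Y; g \<in> Hom C X Y\<rbrakk> \<Longrightarrow> SArr C (f \<boxplus> g) = SArr C f \<boxplus> SArr C g"
    and SArr_bij: "\<lbrakk>X \<in> Obj C; Y \<in> Obj C\<rbrakk>
          \<Longrightarrow> bij_betw (SArr C) (Hom C X Y) (Hom C (SObj C X) (SObj C Y))"
    and SObj_ess_surj: "Y \<in> Obj C \<Longrightarrow> \<exists>X \<in> Obj C. isomorphic C (SObj C X) Y"
    and Tri_candidate: "(f, g, h) \<in> Tri C \<Longrightarrow> candidate_triangle C f g h"
    and Tri_iso: "\<lbrakk>(f, g, h) \<in> Tri C; candidate_triangle C f' g' h';
          a \<in> Hom C (Dom C f) (Dom C f'); b \<in> Hom C (Cod C f) (Cod C f');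
          c \<in> Hom C (Cod C g) (Cod C g'); iso_arrow C a; iso_arrow C b; iso_arrow C c;
          b \<cdot> f = f' \<cdot> a; c \<cdot> g = g' \<cdot> b; SArr C a \<cdot> h = h' \<cdot> c\<rbrakk> \<Longrightarrow> (f', g', h') \<in> Tri C"
    and Tri_Ident: "\<lbrakk>X \<in> Obj C; zero_object C E\<rbrakk>
          \<Longrightarrow> (Ident C X, MZero C X E, MZero C E (SObj C X)) \<in> Tri C"
    and Tri_ex: "f \<in> Arr C \<Longrightarrow> \<exists>g h. (f, g, h) \<in> Tri C"
    and Tri_rotate: "candidate_triangle C f g h
          \<Longrightarrow> (f, g, h) \<in> Tri C \<longleftrightarrow> (g, h, MNeg C (SArr C f)) \<in> Tri C"
    and Tri_morphism: "\<lbrakk>(f, g, h) \<in> Tri C; (f', g', h') \<in> Tri C;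
          a \<in> Hom C (Dom C f) (Dom C f'); b \<in> Hom C (Cod C f) (Cod C f'); b \<cdot> f = f' \<cdot> a\<rbrakk>
          \<Longrightarrow> \<exists>c \<in> Hom C (Cod C g) (Cod C g'). c \<cdot> g = g' \<cdot> b \<and> SArr C a \<cdot> h = h' \<cdot> c"
    and Tri_octahedral: "\<lbrakk>f \<in> Hom C X Y; g \<in> Hom C Y Z;
          (f, a, a') \<in> Tri C; (g, b, b') \<in> Tri C; (g \<cdot> f, c, c') \<in> Tri C\<rbrakk>
          \<Longrightarrow> \<exists>u \<in> Hom C (Cod C a) (Cod C c). \<exists>v \<in> Hom C (Cod C c) (Cod C b).
                (u, v, SArr C a \<cdot> b') \<in> Tri C \<and>
                u \<cdot> a = c \<cdot> g \<and> c' \<cdot> u = a' \<and> v \<cdot> c = b \<and> b' \<cdot> v = SArr C f \<cdot> c'"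

definition rigid :: "('o, 'm, 'x) triangulated_category_scheme \<Rightarrow> 'o \<Rightarrow> bool" where
  "rigid C T \<longleftrightarrow> Hom C T (SObj C T) = {MZero C T (SObj C T)}"

text \<open>The objects of \<open>T \<ast> \<Sigma>T\<close>.\<close>

definition cones_add :: "('o, 'm, 'x) triangulated_category_scheme \<Rightarrow> 'o \<Rightarrow> 'o set" where
  "cones_add C T = {A \<in> Obj C. \<exists>R \<in> add_objects C T. \<exists>S \<in> add_objects C T. \<exists>f \<in> Hom C R S. \<exists>g h.
     (f, g, h) \<in> Tri C \<and> Cod C g = A}"


section \<open>Left-weak model categories\<close>

definition lifts :: "('o, 'm, 'x) category_scheme \<Rightarrow> 'm \<Rightarrow> 'm \<Rightarrow> bool" where
  "lifts C f g \<longleftrightarrow>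
     (\<forall>u \<in> Hom C (Dom C f) (Dom C g). \<forall>v \<in> Hom C (Cod C f) (Cod C g). g \<cdot>\<^bsub>C\<^esub> u = v \<cdot>\<^bsub>C\<^esub> f \<longrightarrow>
        (\<exists>a \<in> Hom C (Cod C f) (Dom C g). a \<cdot>\<^bsub>C\<^esub> f = u \<and> g \<cdot>\<^bsub>C\<^esub> a = v))"

definition llp :: "('o, 'm, 'x) category_scheme \<Rightarrow> 'm set \<Rightarrow> 'm set" where
  "llp C \<A> = {f \<in> Arr C. \<forall>a \<in> \<A>. lifts C f a}"

definition rlp :: "('o, 'm, 'x) category_scheme \<Rightarrow> 'm set \<Rightarrow> 'm set" where
  "rlp C \<A> = {f \<in> Arr C. \<forall>a \<in> \<A>. lifts C a f}"

text \<open>\<open>i : P \<rightarrow> X'\<close> followed by \<open>w : X' \<rightarrow> X\<close> is a cylinder object for \<open>X\<close>, where \<open>P\<close> is a coproduct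
  of \<open>X\<close> with itself. A morphism out of \<open>P\<close> is the codiagonal, resp. \<open>[f g]\<close>, iff its composites
  with the inclusions \<open>s\<close> and \<open>t\<close> are both the identity, resp. are \<open>f\<close> and \<open>g\<close>. Dually for path
  objects.\<close>

definition cylinder_object ::
    "('o, 'm, 'x) category_scheme \<Rightarrow> 'm set \<Rightarrow> 'o \<Rightarrow> 'o \<Rightarrow> 'm \<Rightarrow> 'm \<Rightarrow> 'm \<Rightarrow> 'm \<Rightarrow> bool" where
  "cylinder_object C W X P s t i w \<longleftrightarrow>
     is_coproduct C X X P s t \<and> i \<in> Hom C P (Dom C w) \<and> w \<in> Hom C (Cod C i) X \<and> w \<in> W \<and>
     w \<cdot>\<^bsub>C\<^esub> i \<cdot>\<^bsub>C\<^esub> s = Ident C X \<and> w \<cdot>\<^bsub>C\<^esub> i \<cdot>\<^bsub>C\<^esub> t = Ident C X"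

definition path_object ::
    "('o, 'm, 'x) category_scheme \<Rightarrow> 'm set \<Rightarrow> 'o \<Rightarrow> 'o \<Rightarrow> 'm \<Rightarrow> 'm \<Rightarrow> 'm \<Rightarrow> 'm \<Rightarrow> bool" where
  "path_object C W Y P s t w p \<longleftrightarrow>
     is_product C Y Y P s t \<and> w \<in> Hom C Y (Dom C p) \<and> p \<in> Hom C (Cod C w) P \<and> w \<in> W \<and>
     s \<cdot>\<^bsub>C\<^esub> (p \<cdot>\<^bsub>C\<^esub> w) = Ident C Y \<and> t \<cdot>\<^bsub>C\<^esub> (p \<cdot>\<^bsub>C\<^esub> w) = Ident C Y"

definition left_homotopic ::
    "('o, 'm, 'x) category_scheme \<Rightarrow> 'm set \<Rightarrow> 'm \<Rightarrow> 'm \<Rightarrow> bool" where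
  "left_homotopic C W f g \<longleftrightarrow> f \<in> Arr C \<and> g \<in> Hom C (Dom C f) (Cod C f) \<and>
     (\<exists>P s t i w. cylinder_object C W (Dom C f) P s t i w \<and>
        (\<exists>H \<in> Hom C (Cod C i) (Cod C f). H \<cdot>\<^bsub>C\<^esub> i \<cdot>\<^bsub>C\<^esub> s = f \<and> H \<cdot>\<^bsub>C\<^esub> i \<cdot>\<^bsub>C\<^esub> t = g))"

definition right_homotopic ::
    "('o, 'm, 'x) category_scheme \<Rightarrow> 'm set \<Rightarrow> 'm \<Rightarrow> 'm \<Rightarrow> bool" where
  "right_homotopic C W f g \<longleftrightarrow> f \<in> Arr C \<and> g \<in> Hom C (Dom C f) (Cod C f) \<and>
     (\<exists>P s t w p. path_object C W (Cod C f) P s t w p \<and>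
        (\<exists>K \<in> Hom C (Dom C f) (Dom C p). s \<cdot>\<^bsub>C\<^esub> (p \<cdot>\<^bsub>C\<^esub> K) = f \<and> t \<cdot>\<^bsub>C\<^esub> (p \<cdot>\<^bsub>C\<^esub> K) = g))"

definition homotopic :: "('o, 'm, 'x) category_scheme \<Rightarrow> 'm set \<Rightarrow> 'm \<Rightarrow> 'm \<Rightarrow> bool" where
  "homotopic C W f g \<longleftrightarrow> left_homotopic C W f g \<and> right_homotopic C W f g"

text \<open>Initial and final objects are not chosen. The choice is immaterial as soon as the classes
  of morphisms contain the identities and are stable under retracts.\<close>

definition fibrant :: "('o, 'm, 'x) category_scheme \<Rightarrow> 'm set \<Rightarrow> 'o \<Rightarrow> bool" where
  "fibrant C Fib X \<longleftrightarrow> X \<in> Obj C \<and> (\<exists>E. final_object C E \<and> (\<exists>f \<in> Hom C X E. f \<in> Fib))"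

definition cofibrant :: "('o, 'm, 'x) category_scheme \<Rightarrow> 'm set \<Rightarrow> 'o \<Rightarrow> bool" where
  "cofibrant C Cof X \<longleftrightarrow> X \<in> Obj C \<and> (\<exists>E. initial_object C E \<and> (\<exists>f \<in> Hom C E X. f \<in> Cof))"

definition lifts_right ::
    "('o, 'm, 'x) category_scheme \<Rightarrow> 'm set \<Rightarrow> 'm \<Rightarrow> 'm \<Rightarrow> bool" where
  "lifts_right C W f g \<longleftrightarrow>
     (\<forall>u \<in> Hom C (Dom C f) (Dom C g). \<forall>v \<in> Hom C (Cod C f) (Cod C g). g \<cdot>\<^bsub>C\<^esub> u = v \<cdot>\<^bsub>C\<^esub> f \<longrightarrow>
        (\<exists>a \<in> Hom C (Cod C f) (Dom C g).
           g \<cdot>\<^bsub>C\<^esub> a = v \<and> right_homotopic C W (a \<cdot>\<^bsub>C\<^esub> f) u))"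

definition lifts_left ::
    "('o, 'm, 'x) category_scheme \<Rightarrow> 'm set \<Rightarrow> 'm \<Rightarrow> 'm \<Rightarrow> bool" where
  "lifts_left C W f g \<longleftrightarrow>
     (\<forall>u \<in> Hom C (Dom C f) (Dom C g). \<forall>v \<in> Hom C (Cod C f) (Cod C g). g \<cdot>\<^bsub>C\<^esub> u = v \<cdot>\<^bsub>C\<^esub> f \<longrightarrow>
        (\<exists>a \<in> Hom C (Cod C f) (Dom C g).
           left_homotopic C W (g \<cdot>\<^bsub>C\<^esub> a) v \<and> a \<cdot>\<^bsub>C\<^esub> f = u))"

definition homotopy_cofibrations ::
    "('o, 'm, 'x) category_scheme \<Rightarrow> 'm set \<Rightarrow> 'm set \<Rightarrow> 'm set" where
  "homotopy_cofibrations C W Fib =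
     {j \<in> Arr C. \<forall>p \<in> W \<inter> Fib. lifts_right C W j p \<and> lifts_left C W j p}"

definition stable_class :: "('o, 'm, 'x) category_scheme \<Rightarrow> 'm set \<Rightarrow> bool" where
  "stable_class C \<A> \<longleftrightarrow>
     (\<forall>X \<in> Obj C. Ident C X \<in> \<A>) \<and>
     (\<forall>f \<in> \<A>. \<forall>g \<in> \<A>. Cod C f = Dom C g \<longrightarrow> g \<cdot>\<^bsub>C\<^esub> f \<in> \<A>) \<and>
     (\<forall>f g. g \<in> \<A> \<and> retract_of C f g \<longrightarrow> f \<in> \<A>)"

locale left_weak_model_category = category C
  for C :: "('o, 'm, 'x) category_scheme" (structure) +
  fixes W Cof Fib :: "'m set"
  assumes W_Arr: "W \<subseteq> Arr C" and Cof_Arr: "Cof \<subseteq> Arr C" and Fib_Arr: "Fib \<subseteq> Arr C"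
    and finite_products: "has_finite_products C"
    and finite_coproducts: "has_finite_coproducts C"
    and pullback_ex: "\<lbrakk>p \<in> W \<inter> Fib; epi C e; Cod C e = Cod C p\<rbrakk>
          \<Longrightarrow> \<exists>P p' e'. is_pullback C p e P p' e'"
    and pullback_trivial_fibration: "\<lbrakk>p \<in> W \<inter> Fib; epi C e; is_pullback C p e P p' e'\<rbrakk>
          \<Longrightarrow> p' \<in> W \<inter> Fib"
    and homotopy_cofibration_cofibrant:
          "\<lbrakk>cofibrant C Cof A; j \<in> Hom C A B; j \<in> homotopy_cofibrations C W Fib\<rbrakk>
          \<Longrightarrow> cofibrant C Cof B"
    and inclusion_left_cofibration: "\<lbrakk>cofibrant C Cof B; A \<in> Obj C; is_coproduct C A B P s t\<rbrakk>
          \<Longrightarrow> s \<in> Cof"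
    and inclusion_right_cofibration: "\<lbrakk>cofibrant C Cof B; A \<in> Obj C; is_coproduct C B A P s t\<rbrakk>
          \<Longrightarrow> t \<in> Cof"
    and two_of_three_cmp: "\<lbrakk>f \<in> Hom C X Y; g \<in> Hom C Y Z; f \<in> W; g \<in> W\<rbrakk> \<Longrightarrow> g \<cdot> f \<in> W"
    and two_of_three_left: "\<lbrakk>f \<in> Hom C X Y; g \<in> Hom C Y Z; f \<in> W; g \<cdot> f \<in> W\<rbrakk> \<Longrightarrow> g \<in> W"
    and two_of_three_right: "\<lbrakk>f \<in> Hom C X Y; g \<in> Hom C Y Z; g \<in> W; g \<cdot> f \<in> W\<rbrakk> \<Longrightarrow> f \<in> W"
    and W_stable: "stable_class C W"
    and Cof_stable: "stable_class C Cof"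
    and Fib_stable: "stable_class C Fib"
    and trivial_cofibration_lifts: "W \<inter> Cof \<subseteq> llp C Fib"
    and cofibration_lifts: "Cof \<subseteq> llp C (Fib \<inter> W)"
    and factor_trivial_cofibration: "f \<in> Arr C
          \<Longrightarrow> \<exists>i p. i \<in> W \<inter> Cof \<and> p \<in> Fib \<and> Cod C i = Dom C p \<and> f = p \<cdot> i"
    and factor_homotopy_cofibration: "\<lbrakk>f \<in> Arr C; cofibrant C Cof (Dom C f)\<rbrakk>
          \<Longrightarrow> \<exists>j p. j \<in> homotopy_cofibrations C W Fib \<and> p \<in> W \<inter> Fib \<and>
                Cod C j = Dom C p \<and> f = p \<cdot> j"


section \<open>The classes of morphisms attached to a rigid object\<close>

definition weqT :: "('o, 'm, 'x) triangulated_category_scheme \<Rightarrow> 'o \<Rightarrow> 'm set" where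
  "weqT C T = {f \<in> Arr C. \<forall>g h. (g, f, h) \<in> Tri C \<longrightarrow>
     factors_through C g (perp C T) \<and> factors_through C h (perp C T)}"

text \<open>The singleton \<open>{0 \<rightarrow> \<Sigma>T}\<close>, for a zero object \<open>E\<close>.\<close>

definition genJ :: "('o, 'm, 'x) triangulated_category_scheme \<Rightarrow> 'o \<Rightarrow> 'o \<Rightarrow> 'm set" where
  "genJ C E T = {MZero C E (SObj C T)}"

text \<open>The arguments \<open>\<R>\<close> and \<open>\<K>\<close> are meant to be sets of representatives of the isomorphism classes
  of objects of \<open>add T\<close> and of \<open>T \<ast> \<Sigma>T\<close>.\<close>

definition genI :: "('o, 'm, 'x) category_scheme \<Rightarrow> 'o set \<Rightarrow> 'o set \<Rightarrow> 'm set" where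
  "genI C \<R> \<K> = (\<Union>R \<in> \<R>. \<Union>A \<in> \<K>. Hom C R A)"

definition fibT :: "('o, 'm, 'x) triangulated_category_scheme \<Rightarrow> 'o \<Rightarrow> 'o \<Rightarrow> 'm set" where
  "fibT C E T = rlp C (genJ C E T)"

definition wfibT :: "('o, 'm, 'x) category_scheme \<Rightarrow> 'o set \<Rightarrow> 'o set \<Rightarrow> 'm set" where
  "wfibT C \<R> \<K> = rlp C (genI C \<R> \<K>)"

definition cofT :: "('o, 'm, 'x) category_scheme \<Rightarrow> 'o set \<Rightarrow> 'o set \<Rightarrow> 'm set" where
  "cofT C \<R> \<K> = llp C (wfibT C \<R> \<K>)"

end

theory Submission
  imports Defs
begin

text \<open>
  Write \<open>F = C(T,-)\<close>. Everything rests on translating the three classes of morphisms into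
  statements about \<open>F\<close> and \<open>C(\<Sigma>T,-)\<close>.

  \<^item> Because \<open>T\<close> is rigid, the cone of a right \<open>add T\<close>-approximation \<open>D \<rightarrow> X\<close> lies in \<open>T\<^sup>\<bottom>\<close>
    (\<open>approximation_triangle\<close>). A morphism out of \<open>X\<close> that is killed by \<open>F\<close> vanishes on \<open>D\<close>, so it
    extends to that cone: the ideal \<open>(T\<^sup>\<bottom>)\<close> is the kernel of \<open>F\<close>, and by exactness the weak
    equivalences are the morphisms that \<open>F\<close> makes bijective (\<open>weqT_eq\<close>).
  \<^item> Lifting against \<open>0 \<rightarrow> \<Sigma>T\<close> means that \<open>C(\<Sigma>T,f)\<close> is surjective (\<open>fibT_eq\<close>), and
    \<open>I\<^sup>\<box>\<close> is the class of trivial fibrations (\<open>wfibT_eq\<close>).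
  \<^item> Call \<open>A\<close> projective if \<open>C(A,p)\<close> is surjective for each trivial fibration \<open>p\<close>; these are the
    cofibrant objects. A cone \<open>R \<rightarrow> S \<rightarrow> A \<rightarrow> \<Sigma>R\<close> with \<open>R, S \<in> add T\<close> is projective: lift first on \<open>S\<close>,
    then correct the lift along \<open>A \<rightarrow> \<Sigma>R\<close> (\<open>cones_projective\<close>). Conversely each \<open>Y\<close> receives a
    trivial fibration from some \<open>B \<oplus> \<Sigma>D\<close> with \<open>B \<in> T \<ast> \<Sigma>T\<close> (\<open>cofibrant_replacement\<close>); for projective
    \<open>Y = A\<close> it splits, and this forces the cone of an approximation of \<open>A\<close> into \<open>add \<Sigma>T\<close>
    (\<open>projective_cones\<close>).
  \<^item> The inclusion \<open>X \<rightarrow> X \<oplus> M\<close> and the projection back are weak equivalences if \<open>M \<in> T\<^sup>\<bottom>\<close>, which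
    produces enough cylinder and path objects:
    parallel morphisms are left homotopic iff they are right homotopic iff \<open>F\<close> identifies them
    (\<open>left_homotopic_iff\<close>, \<open>right_homotopic_iff\<close>). On an object of \<open>T \<ast> \<Sigma>T\<close>, presented by
    \<open>R \<rightarrow> S\<close> as above, a morphism killed by \<open>F\<close> vanishes on \<open>S\<close>, hence factors through \<open>\<Sigma>R\<close> (\<open>homotopic_iff\<close>).

  The factorisations are explicit. A morphism \<open>f : X \<rightarrow> Y\<close> factors through \<open>X \<oplus> \<Sigma>D\<close>, where
  \<open>\<Sigma>D \<rightarrow> Y\<close> is a right \<open>add \<Sigma>T\<close>-approximation. If \<open>X\<close> is cofibrant, \<open>f\<close> lifts to a cofibrant
  replacement \<open>Q\<close> of \<open>Y\<close>, and \<open>X \<rightarrow> Q \<oplus> \<Sigma>R\<close> is a homotopy cofibration because any error of a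
  lift is killed by \<open>F\<close>, so it factors through \<open>X \<rightarrow> \<Sigma>R\<close> and can be absorbed by the second summand
  (\<open>factor_homotopy_cofibration\<close>).
\<close>

section \<open>Lifting properties\<close>

context category
begin

lemma in_Hom: "f \<in> Hom C X Y \<longleftrightarrow> f \<in> Arr C \<and> Dom C f = X \<and> Cod C f = Y"
  by (simp add: Hom_def)

lemma Arr_Hom: "f \<in> Arr C \<Longrightarrow> f \<in> Hom C (Dom C f) (Cod C f)"
  by (simp add: Hom_def)

lemma Hom_Obj: "f \<in> Hom C X Y \<Longrightarrow> X \<in> Obj C \<and> Y \<in> Obj C"
  using Dom_Obj Cod_Obj by (auto simp: in_Hom)

lemma Hom_Dom: "f \<in> Hom C X Y \<Longrightarrow> Dom C f = X"
  and Hom_Cod: "f \<in> Hom C X Y \<Longrightarrow> Cod C f = Y"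
  and Hom_Arr: "f \<in> Hom C X Y \<Longrightarrow> f \<in> Arr C"
  by (simp_all add: in_Hom)

lemma llpI:
  assumes "f \<in> Hom C A B"
    and "\<And>g X Y u v. \<lbrakk>g \<in> \<A>; g \<in> Hom C X Y; u \<in> Hom C A X; v \<in> Hom C B Y; g \<cdot> u = v \<cdot> f\<rbrakk>
      \<Longrightarrow> \<exists>a \<in> Hom C B X. a \<cdot> f = u \<and> g \<cdot> a = v"
    and "\<A> \<subseteq> Arr C"
  shows "f \<in> llp C \<A>"
  using assms by (auto simp: llp_def lifts_def in_Hom subset_eq)

lemma llpD:
  assumes "f \<in> llp C \<A>" "g \<in> \<A>" "f \<in> Hom C A B" "g \<in> Hom C X Y"
    "u \<in> Hom C A X" "v \<in> Hom C B Y" "g \<cdot> u = v \<cdot> f"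
  shows "\<exists>a \<in> Hom C B X. a \<cdot> f = u \<and> g \<cdot> a = v"
  using assms by (auto simp: llp_def lifts_def in_Hom)

lemma llp_Ident:
  assumes "X \<in> Obj C" "\<A> \<subseteq> Arr C"
  shows "Ident C X \<in> llp C \<A>"
proof (rule llpI[OF Ident_Hom[OF assms(1)] _ assms(2)])
  fix g A B u v
  assume "u \<in> Hom C X A" "v \<in> Hom C X B" "g \<cdot> u = v \<cdot> Ident C X"
  then show "\<exists>a \<in> Hom C X A. a \<cdot> Ident C X = u \<and> g \<cdot> a = v"
    by (auto simp: Ident_right)
qed

lemma llp_Cmp:
  assumes f: "f \<in> llp C \<A>" and g: "g \<in> llp C \<A>" and fg: "Cod C f = Dom C g" and \<A>: "\<A> \<subseteq> Arr C"
  shows "g \<cdot> f \<in> llp C \<A>"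
proof -
  obtain X Y Z where f': "f \<in> Hom C X Y" and g': "g \<in> Hom C Y Z"
    using f g fg by (auto simp: llp_def in_Hom)
  show ?thesis
  proof (rule llpI[OF Cmp_Hom[OF f' g'] _ \<A>])
    fix p P Q u v
    assume p: "p \<in> \<A>" "p \<in> Hom C P Q" and u: "u \<in> Hom C X P" and v: "v \<in> Hom C Z Q"
      and eq: "p \<cdot> u = v \<cdot> (g \<cdot> f)"
    obtain a where a: "a \<in> Hom C Y P" "a \<cdot> f = u" "p \<cdot> a = v \<cdot> g"
      using llpD[OF f p(1) f' p(2) u Cmp_Hom[OF g' v]] eq Cmp_assoc[OF f' g' v] by auto
    obtain b where b: "b \<in> Hom C Z P" "b \<cdot> g = a" "p \<cdot> b = v"
      using llpD[OF g p(1) g' p(2) a(1) v a(3)] by auto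
    then show "\<exists>a \<in> Hom C Z P. a \<cdot> (g \<cdot> f) = u \<and> p \<cdot> a = v"
      using a(2) Cmp_assoc[OF f' g' b(1)] by auto
  qed
qed

lemma retract_ofE:
  assumes "retract_of C f g"
  obtains X Y X' Y' i r j s where "f \<in> Hom C X Y" "g \<in> Hom C X' Y'" "i \<in> Hom C X X'" "r \<in> Hom C X' X"
    "j \<in> Hom C Y Y'" "s \<in> Hom C Y' Y" "r \<cdot> i = Ident C X" "s \<cdot> j = Ident C Y"
    "g \<cdot> i = j \<cdot> f" "f \<cdot> r = s \<cdot> g"
proof -
  have "f \<in> Hom C (Dom C f) (Cod C f)" "g \<in> Hom C (Dom C g) (Cod C g)"
    using assms Arr_Hom unfolding retract_of_def by blast+
  then show ?thesis using assms that unfolding retract_of_def by blast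
qed

lemma llp_retract:
  assumes g: "g \<in> llp C \<A>" and fg: "retract_of C f g" and \<A>: "\<A> \<subseteq> Arr C"
  shows "f \<in> llp C \<A>"
proof -
  obtain X Y X' Y' i r j s where f': "f \<in> Hom C X Y" and g': "g \<in> Hom C X' Y'"
    and i: "i \<in> Hom C X X'" and r: "r \<in> Hom C X' X" and j: "j \<in> Hom C Y Y'" and s: "s \<in> Hom C Y' Y"
    and ri: "r \<cdot> i = Ident C X" and sj: "s \<cdot> j = Ident C Y"
    and gi: "g \<cdot> i = j \<cdot> f" and fr: "f \<cdot> r = s \<cdot> g"
    using fg by (rule retract_ofE)
  show ?thesis
  proof (rule llpI[OF f' _ \<A>])
    fix p P Q u v
    assume p: "p \<in> \<A>" "p \<in> Hom C P Q" and u: "u \<in> Hom C X P" and v: "v \<in> Hom C Y Q"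
      and eq: "p \<cdot> u = v \<cdot> f"
    have "p \<cdot> (u \<cdot> r) = v \<cdot> s \<cdot> g"
      using eq fr Cmp_assoc[OF r u p(2)] Cmp_assoc[OF r f' v] Cmp_assoc[OF g' s v] by simp
    then obtain a where a: "a \<in> Hom C Y' P" "a \<cdot> g = u \<cdot> r" "p \<cdot> a = v \<cdot> s"
      using llpD[OF g p(1) g' p(2) Cmp_Hom[OF r u] Cmp_Hom[OF s v]] by auto
    have "a \<cdot> j \<cdot> f = u"
      using a(2) gi ri Cmp_assoc[OF f' j a(1)] Cmp_assoc[OF i g' a(1)] Cmp_assoc[OF i r u]
        Ident_right[OF u] by simp
    moreover have "p \<cdot> (a \<cdot> j) = v"
      using a(3) sj Cmp_assoc[OF j a(1) p(2)] Cmp_assoc[OF j s v] Ident_right[OF v] by simp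
    ultimately show "\<exists>a \<in> Hom C Y P. a \<cdot> f = u \<and> p \<cdot> a = v"
      using Cmp_Hom[OF j a(1)] by auto
  qed
qed

lemma llp_stable: "\<A> \<subseteq> Arr C \<Longrightarrow> stable_class C (llp C \<A>)"
  unfolding stable_class_def using llp_Ident llp_Cmp llp_retract by blast

lemma rlpI:
  assumes "f \<in> Hom C X Y"
    and "\<And>g A B u v. \<lbrakk>g \<in> \<A>; g \<in> Hom C A B; u \<in> Hom C A X; v \<in> Hom C B Y; f \<cdot> u = v \<cdot> g\<rbrakk>
      \<Longrightarrow> \<exists>a \<in> Hom C B X. a \<cdot> g = u \<and> f \<cdot> a = v"
    and "\<A> \<subseteq> Arr C"
  shows "f \<in> rlp C \<A>"
  using assms by (auto simp: rlp_def lifts_def in_Hom subset_eq)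

lemma rlpD:
  assumes "f \<in> rlp C \<A>" "g \<in> \<A>" "f \<in> Hom C X Y" "g \<in> Hom C A B"
    "u \<in> Hom C A X" "v \<in> Hom C B Y" "f \<cdot> u = v \<cdot> g"
  shows "\<exists>a \<in> Hom C B X. a \<cdot> g = u \<and> f \<cdot> a = v"
  using assms by (auto simp: rlp_def lifts_def in_Hom)

end

section \<open>Sums of morphisms, direct sums\<close>

context preadditive_category
begin

lemma add_Hom: "\<lbrakk>f \<in> Hom C X Y; g \<in> Hom C X Y\<rbrakk> \<Longrightarrow> f \<boxplus> g \<in> Hom C X Y"
  using comm_groupE(1)[OF hom_comm_group] Hom_Obj by (fastforce simp: hom_group_def)

lemma zero_Hom: "\<lbrakk>X \<in> Obj C; Y \<in> Obj C\<rbrakk> \<Longrightarrow> MZero C X Y \<in> Hom C X Y"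
  using comm_groupE(2)[OF hom_comm_group] by (fastforce simp: hom_group_def)

lemma add_assoc: "\<lbrakk>f \<in> Hom C X Y; g \<in> Hom C X Y; h \<in> Hom C X Y\<rbrakk> \<Longrightarrow> f \<boxplus> g \<boxplus> h = f \<boxplus> (g \<boxplus> h)"
  using comm_groupE(3)[OF hom_comm_group] Hom_Obj by (fastforce simp: hom_group_def)

lemma add_comm: "\<lbrakk>f \<in> Hom C X Y; g \<in> Hom C X Y\<rbrakk> \<Longrightarrow> f \<boxplus> g = g \<boxplus> f"
  using comm_groupE(4)[OF hom_comm_group] Hom_Obj by (fastforce simp: hom_group_def)

lemma zero_add: "f \<in> Hom C X Y \<Longrightarrow> MZero C X Y \<boxplus> f = f"
  using comm_groupE(5)[OF hom_comm_group] Hom_Obj by (fastforce simp: hom_group_def)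

lemma add_zero: "f \<in> Hom C X Y \<Longrightarrow> f \<boxplus> MZero C X Y = f"
  using add_comm[OF _ zero_Hom] zero_add Hom_Obj by simp

lemma
  assumes f: "f \<in> Hom C X Y"
  shows neg_Hom: "MNeg C f \<in> Hom C X Y"
    and neg_add: "MNeg C f \<boxplus> f = MZero C X Y"
    and add_neg: "f \<boxplus> MNeg C f = MZero C X Y"
proof -
  interpret comm_group "hom_group C X Y"
    using f Hom_Obj hom_comm_group by blast
  have [simp]: "Dom C f = X" "Cod C f = Y" "f \<in> carrier (hom_group C X Y)"
    "mult (hom_group C X Y) = MAdd C" "one (hom_group C X Y) = MZero C X Y"
    using f by (simp_all add: in_Hom hom_group_def)
  have "MNeg C f \<in> carrier (hom_group C X Y)"
    using inv_closed[of f] by (simp add: MNeg_def)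
  then show "MNeg C f \<in> Hom C X Y"
    by (simp add: hom_group_def)
  show "MNeg C f \<boxplus> f = MZero C X Y"
    using l_inv[of f] by (simp add: MNeg_def)
  show "f \<boxplus> MNeg C f = MZero C X Y"
    using r_inv[of f] by (simp add: MNeg_def)
qed

lemma diff_Hom: "\<lbrakk>f \<in> Hom C X Y; g \<in> Hom C X Y\<rbrakk> \<Longrightarrow> MDiff C f g \<in> Hom C X Y"
  by (simp add: MDiff_def add_Hom neg_Hom)

lemma add_diff:
  assumes "f \<in> Hom C X Y" "g \<in> Hom C X Y"
  shows "g \<boxplus> MDiff C f g = f" "MDiff C f g \<boxplus> g = f"
proof -
  show "MDiff C f g \<boxplus> g = f"
    unfolding MDiff_def
    by (simp add: add_assoc[OF assms(1) neg_Hom[OF assms(2)] assms(2)] neg_add[OF assms(2)]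
        add_zero[OF assms(1)])
  then show "g \<boxplus> MDiff C f g = f"
    by (simp add: add_comm[OF assms(2) diff_Hom[OF assms]])
qed

lemma diff_self: "f \<in> Hom C X Y \<Longrightarrow> MDiff C f f = MZero C X Y"
  by (simp add: MDiff_def add_neg)

lemma diff_zero_iff:
  assumes "f \<in> Hom C X Y" "g \<in> Hom C X Y"
  shows "MDiff C f g = MZero C X Y \<longleftrightarrow> f = g"
  using add_diff(1)[OF assms] diff_self[OF assms(1)] add_zero[OF assms(2)] by auto

lemma add_left_cancel:
  assumes "f \<in> Hom C X Y" "g \<in> Hom C X Y" "h \<in> Hom C X Y" "h \<boxplus> f = h \<boxplus> g"
  shows "f = g"
proof -
  have "k = MNeg C h \<boxplus> (h \<boxplus> k)" if "k \<in> Hom C X Y" for k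
    by (simp add: add_assoc[OF neg_Hom[OF assms(3)] assms(3) that, symmetric]
        neg_add[OF assms(3)] zero_add[OF that])
  from this[OF assms(1)] this[OF assms(2)] show ?thesis by (simp add: assms(4))
qed

lemma Cmp_zero:
  assumes f: "f \<in> Hom C X Y" and Z: "Z \<in> Obj C"
  shows "f \<cdot> MZero C Z X = MZero C Z Y"
proof -
  have X: "X \<in> Obj C" and Y: "Y \<in> Obj C" using Hom_Obj[OF f] by auto
  have z: "MZero C Z X \<in> Hom C Z X" and fz: "f \<cdot> MZero C Z X \<in> Hom C Z Y"
    using zero_Hom X Z Cmp_Hom f by blast+
  have "f \<cdot> MZero C Z X \<boxplus> f \<cdot> MZero C Z X = f \<cdot> MZero C Z X \<boxplus> MZero C Z Y"
    using Cmp_add_right[OF z z f] add_zero[OF z] add_zero[OF fz] by simp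
  then show ?thesis using add_left_cancel fz zero_Hom Z Y by blast
qed

lemma zero_Cmp:
  assumes f: "f \<in> Hom C X Y" and Z: "Z \<in> Obj C"
  shows "MZero C Y Z \<cdot> f = MZero C X Z"
proof -
  have X: "X \<in> Obj C" and Y: "Y \<in> Obj C" using Hom_Obj[OF f] by auto
  have z: "MZero C Y Z \<in> Hom C Y Z" and fz: "MZero C Y Z \<cdot> f \<in> Hom C X Z"
    using zero_Hom Y Z Cmp_Hom f by blast+
  have "MZero C Y Z \<cdot> f \<boxplus> MZero C Y Z \<cdot> f = MZero C Y Z \<cdot> f \<boxplus> MZero C X Z"
    using Cmp_add_left[OF f z z] add_zero[OF z] add_zero[OF fz] by simp
  then show ?thesis using add_left_cancel fz zero_Hom Z X by blast
qed

lemma Cmp_diff: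
  assumes "f \<in> Hom C X Y" "g \<in> Hom C X Y" "h \<in> Hom C Y Z"
  shows "h \<cdot> MDiff C f g = MDiff C (h \<cdot> f) (h \<cdot> g)"
proof -
  note d = diff_Hom[OF assms(1,2)] and hf = Cmp_Hom[OF assms(1,3)] and hg = Cmp_Hom[OF assms(2,3)]
  have "h \<cdot> g \<boxplus> h \<cdot> MDiff C f g = h \<cdot> g \<boxplus> MDiff C (h \<cdot> f) (h \<cdot> g)"
    by (simp add: Cmp_add_right[OF assms(2) d assms(3), symmetric] add_diff(1)[OF assms(1,2)]
        add_diff(1)[OF hf hg])
  then show ?thesis using add_left_cancel[OF Cmp_Hom[OF d assms(3)] diff_Hom[OF hf hg] hg] by simp
qed

lemma diff_Cmp:
  assumes "f \<in> Hom C X Y" "g \<in> Hom C X Y" "h \<in> Hom C W X"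
  shows "MDiff C f g \<cdot> h = MDiff C (f \<cdot> h) (g \<cdot> h)"
proof -
  note d = diff_Hom[OF assms(1,2)] and fh = Cmp_Hom[OF assms(3,1)] and gh = Cmp_Hom[OF assms(3,2)]
  have "g \<cdot> h \<boxplus> MDiff C f g \<cdot> h = g \<cdot> h \<boxplus> MDiff C (f \<cdot> h) (g \<cdot> h)"
    by (simp add: Cmp_add_left[OF assms(3) assms(2) d, symmetric] add_diff(1)[OF assms(1,2)]
        add_diff(1)[OF fh gh])
  then show ?thesis using add_left_cancel[OF Cmp_Hom[OF assms(3) d] diff_Hom[OF fh gh] gh] by simp
qed

lemma neg_unique: "\<lbrakk>f \<in> Hom C X Y; g \<in> Hom C X Y; f \<boxplus> g = MZero C X Y\<rbrakk> \<Longrightarrow> g = MNeg C f"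
  using add_left_cancel[OF _ neg_Hom, of g X Y f f] add_neg[of f X Y] by simp

lemma neg_neg: "f \<in> Hom C X Y \<Longrightarrow> MNeg C (MNeg C f) = f"
  using neg_unique[OF neg_Hom, of f X Y f] neg_add[of f X Y] by simp

lemma neg_inj:
  assumes "f \<in> Hom C X Y" "g \<in> Hom C X Y" "MNeg C f = MNeg C g"
  shows "f = g"
proof -
  have "MNeg C (MNeg C f) = MNeg C (MNeg C g)" using assms(3) by simp
  then show ?thesis unfolding neg_neg[OF assms(1)] neg_neg[OF assms(2)] .
qed

lemma neg_zero: "\<lbrakk>X \<in> Obj C; Y \<in> Obj C\<rbrakk> \<Longrightarrow> MNeg C (MZero C X Y) = MZero C X Y"
  using neg_unique[OF zero_Hom zero_Hom] zero_add[OF zero_Hom] by simp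

lemma Cmp_neg:
  assumes "f \<in> Hom C X Y" "h \<in> Hom C Y Z"
  shows "h \<cdot> MNeg C f = MNeg C (h \<cdot> f)"
  using neg_unique[OF Cmp_Hom[OF assms] Cmp_Hom[OF neg_Hom[OF assms(1)] assms(2)]]
    Cmp_add_right[OF assms(1) neg_Hom[OF assms(1)] assms(2)] add_neg[OF assms(1)]
    Cmp_zero[OF assms(2)] Hom_Obj[OF assms(1)] by simp

lemma neg_Cmp:
  assumes "f \<in> Hom C X Y" "h \<in> Hom C Y Z"
  shows "MNeg C h \<cdot> f = MNeg C (h \<cdot> f)"
  using neg_unique[OF Cmp_Hom[OF assms] Cmp_Hom[OF assms(1) neg_Hom[OF assms(2)]]]
    Cmp_add_left[OF assms(1) assms(2) neg_Hom[OF assms(2)]] add_neg[OF assms(2)]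
    zero_Cmp[OF assms(1)] Hom_Obj[OF assms(2)] by simp

lemma zero_objectD:
  assumes "zero_object C Z" "X \<in> Obj C"
  shows "Hom C Z X = {MZero C Z X}" "Hom C X Z = {MZero C X Z}" "Z \<in> Obj C"
  using assms zero_Hom unfolding zero_object_def initial_object_def final_object_def by blast+

lemma zero_objectI:
  assumes "X \<in> Obj C" "Ident C X = MZero C X X"
  shows "zero_object C X"
proof -
  have "f = MZero C X Y" if f: "f \<in> Hom C X Y" for f Y
    using Ident_right[OF f] Cmp_zero[OF f assms(1)] assms(2) by simp
  moreover have "f = MZero C Y X" if f: "f \<in> Hom C Y X" for f Y
    using Ident_left[OF f] zero_Cmp[OF f assms(1)] assms(2) by simp
  ultimately have "\<exists>!f. f \<in> Hom C X Y" "\<exists>!f. f \<in> Hom C Y X" if "Y \<in> Obj C" for Y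
    using zero_Hom[OF assms(1) that] zero_Hom[OF that assms(1)] by blast+
  then show ?thesis
    using assms unfolding zero_object_def initial_object_def final_object_def by blast
qed

end

definition biproduct ::
    "('o, 'm, 'x) preadditive_category_scheme \<Rightarrow> 'o \<Rightarrow> 'o \<Rightarrow> 'o \<Rightarrow> 'm \<Rightarrow> 'm \<Rightarrow> 'm \<Rightarrow> 'm \<Rightarrow> bool" where
  "biproduct C X Y S i j p q \<longleftrightarrow>
     i \<in> Hom C X S \<and> j \<in> Hom C Y S \<and> p \<in> Hom C S X \<and> q \<in> Hom C S Y \<and>
     p \<cdot>\<^bsub>C\<^esub> i = Ident C X \<and> q \<cdot>\<^bsub>C\<^esub> j = Ident C Y \<and>
     p \<cdot>\<^bsub>C\<^esub> j = MZero C Y X \<and> q \<cdot>\<^bsub>C\<^esub> i = MZero C X Y \<and>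
     (i \<cdot>\<^bsub>C\<^esub> p) \<boxplus>\<^bsub>C\<^esub> (j \<cdot>\<^bsub>C\<^esub> q) = Ident C S"

context preadditive_category
begin

lemma direct_sum_iff: "direct_sum C X Y S \<longleftrightarrow> (\<exists>i j p q. biproduct C X Y S i j p q)"
  unfolding direct_sum_def biproduct_def using Hom_Obj by blast

lemma biproductD:
  assumes "biproduct C X Y S i j p q"
  shows "i \<in> Hom C X S" "j \<in> Hom C Y S" "p \<in> Hom C S X" "q \<in> Hom C S Y"
    "p \<cdot> i = Ident C X" "q \<cdot> j = Ident C Y" "p \<cdot> j = MZero C Y X" "q \<cdot> i = MZero C X Y"
    "(i \<cdot> p) \<boxplus> (j \<cdot> q) = Ident C S" "X \<in> Obj C" "Y \<in> Obj C" "S \<in> Obj C"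
  using assms Hom_Obj unfolding biproduct_def by blast+

lemma biproduct_pair:
  assumes b: "biproduct C X Y S i j p q" and u: "u \<in> Hom C Q X" and v: "v \<in> Hom C Q Y"
  shows "\<exists>m \<in> Hom C Q S. p \<cdot> m = u \<and> q \<cdot> m = v"
proof
  note bD = biproductD[OF b]
  have iu: "i \<cdot> u \<in> Hom C Q S" and jv: "j \<cdot> v \<in> Hom C Q S" using Cmp_Hom bD u v by blast+
  have Q: "Q \<in> Obj C" using Hom_Obj u by blast
  have "p \<cdot> (i \<cdot> u) = u" "p \<cdot> (j \<cdot> v) = MZero C Q X"
       "q \<cdot> (i \<cdot> u) = MZero C Q Y" "q \<cdot> (j \<cdot> v) = v"
    using Cmp_assoc[OF u bD(1,3)] Cmp_assoc[OF v bD(2,3)] Cmp_assoc[OF u bD(1,4)]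
      Cmp_assoc[OF v bD(2,4)] bD(5-8) Ident_left[OF u] Ident_left[OF v]
      zero_Cmp[OF u bD(11)] zero_Cmp[OF v bD(10)] by simp_all
  then show "p \<cdot> (i \<cdot> u \<boxplus> j \<cdot> v) = u \<and> q \<cdot> (i \<cdot> u \<boxplus> j \<cdot> v) = v"
    using Cmp_add_right[OF iu jv bD(3)] Cmp_add_right[OF iu jv bD(4)] zero_add[OF v] add_zero[OF u]
    by simp
  show "i \<cdot> u \<boxplus> j \<cdot> v \<in> Hom C Q S" using add_Hom iu jv .
qed

lemma biproduct_pair_unique:
  assumes b: "biproduct C X Y S i j p q" and m: "m \<in> Hom C Q S" "m' \<in> Hom C Q S"
    and eq: "p \<cdot> m = p \<cdot> m'" "q \<cdot> m = q \<cdot> m'"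
  shows "m = m'"
proof -
  note bD = biproductD[OF b]
  have *: "n = i \<cdot> (p \<cdot> n) \<boxplus> j \<cdot> (q \<cdot> n)" if n: "n \<in> Hom C Q S" for n
    using Cmp_add_left[OF n Cmp_Hom[OF bD(3,1)] Cmp_Hom[OF bD(4,2)]]
      Cmp_assoc[OF n bD(3,1)] Cmp_assoc[OF n bD(4,2)] bD(9) Ident_left[OF n] by simp
  show ?thesis using *[OF m(1)] *[OF m(2)] eq by simp
qed

lemma biproduct_copair:
  assumes b: "biproduct C X Y S i j p q" and u: "u \<in> Hom C X Q" and v: "v \<in> Hom C Y Q"
  shows "\<exists>m \<in> Hom C S Q. m \<cdot> i = u \<and> m \<cdot> j = v"
proof
  note bD = biproductD[OF b]
  have up: "u \<cdot> p \<in> Hom C S Q" and vq: "v \<cdot> q \<in> Hom C S Q" using Cmp_Hom bD u v by blast+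
  have Q: "Q \<in> Obj C" using Hom_Obj u by blast
  have "u \<cdot> p \<cdot> i = u" "u \<cdot> p \<cdot> j = MZero C Y Q"
       "v \<cdot> q \<cdot> i = MZero C X Q" "v \<cdot> q \<cdot> j = v"
    using Cmp_assoc[OF bD(1,3) u] Cmp_assoc[OF bD(2,3) u] Cmp_assoc[OF bD(1,4) v]
      Cmp_assoc[OF bD(2,4) v] bD(5-8) Ident_right[OF u] Ident_right[OF v]
      Cmp_zero[OF u bD(11)] Cmp_zero[OF v bD(10)] by simp_all
  then show "(u \<cdot> p \<boxplus> v \<cdot> q) \<cdot> i = u \<and> (u \<cdot> p \<boxplus> v \<cdot> q) \<cdot> j = v"
    using Cmp_add_left[OF bD(1) up vq] Cmp_add_left[OF bD(2) up vq] zero_add[OF v] add_zero[OF u]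
    by simp
  show "u \<cdot> p \<boxplus> v \<cdot> q \<in> Hom C S Q" using add_Hom up vq .
qed

lemma biproduct_copair_unique:
  assumes b: "biproduct C X Y S i j p q" and m: "m \<in> Hom C S Q" "m' \<in> Hom C S Q"
    and eq: "m \<cdot> i = m' \<cdot> i" "m \<cdot> j = m' \<cdot> j"
  shows "m = m'"
proof -
  note bD = biproductD[OF b]
  have *: "n = n \<cdot> i \<cdot> p \<boxplus> n \<cdot> j \<cdot> q" if n: "n \<in> Hom C S Q" for n
    using Cmp_add_right[OF Cmp_Hom[OF bD(3,1)] Cmp_Hom[OF bD(4,2)] n]
      Cmp_assoc[OF bD(3,1) n] Cmp_assoc[OF bD(4,2) n] bD(9) Ident_right[OF n] by simp
  show ?thesis using *[OF m(1)] *[OF m(2)] eq by simp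
qed

lemma biproduct_is_product: "biproduct C X Y S i j p q \<Longrightarrow> is_product C X Y S p q"
  unfolding is_product_def by (auto dest: biproductD biproduct_pair intro: biproduct_pair_unique)

lemma biproduct_is_coproduct: "biproduct C X Y S i j p q \<Longrightarrow> is_coproduct C X Y S i j"
  unfolding is_coproduct_def
  by (auto dest: biproductD biproduct_copair intro: biproduct_copair_unique)

end

context additive_category
begin

lemma ex_biproduct:
  assumes "X \<in> Obj C" "Y \<in> Obj C"
  obtains S i j p q where "biproduct C X Y S i j p q"
  using ex_direct_sum[OF assms] direct_sum_iff by blast

lemma finite_products: "has_finite_products C"
  unfolding has_finite_products_def
proof (intro allI)
  fix n :: nat and A :: "nat \<Rightarrow> 'o"
  show "(\<forall>k<n. A k \<in> Obj C) \<longrightarrow>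
        (\<exists>P \<in> Obj C. \<exists>p. (\<forall>k<n. p k \<in> Hom C P (A k)) \<and>
           (\<forall>Q \<in> Obj C. \<forall>f. (\<forall>k<n. f k \<in> Hom C Q (A k)) \<longrightarrow>
              (\<exists>!u. u \<in> Hom C Q P \<and> (\<forall>k<n. p k \<cdot> u = f k))))"
  proof (induction n)
    case 0
    show ?case using ex_zero_object unfolding zero_object_def final_object_def by auto
  next
    case (Suc n)
    show ?case
    proof
      assume A: "\<forall>k<Suc n. A k \<in> Obj C"
      then have "\<forall>k<n. A k \<in> Obj C" by simp
      from mp[OF Suc this] obtain P p where P: "P \<in> Obj C" and p: "\<forall>k<n. p k \<in> Hom C P (A k)"
        and ex: "\<forall>Q \<in> Obj C. \<forall>f. (\<forall>k<n. f k \<in> Hom C Q (A k)) \<longrightarrow>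
          (\<exists>!u. u \<in> Hom C Q P \<and> (\<forall>k<n. p k \<cdot> u = f k))" by (elim bexE exE conjE) (rule that)
      obtain S i j a b where S: "biproduct C P (A n) S i j a b"
        using ex_biproduct[OF P] A by blast
      note SD = biproductD[OF S]
      let ?p = "\<lambda>k. if k = n then b else p k \<cdot> a"
      have p': "\<forall>k<Suc n. ?p k \<in> Hom C S (A k)"
        using SD(4) Cmp_Hom[OF SD(3)] p by (simp add: less_Suc_eq)
      have univ: "\<exists>!u. u \<in> Hom C Q S \<and> (\<forall>k<Suc n. ?p k \<cdot> u = f k)"
        if Q: "Q \<in> Obj C" and f: "\<forall>k<Suc n. f k \<in> Hom C Q (A k)" for Q f
      proof -
        have "\<forall>k<n. f k \<in> Hom C Q (A k)" using f by simp
        then have "\<exists>!u. u \<in> Hom C Q P \<and> (\<forall>k<n. p k \<cdot> u = f k)" using ex Q by blast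
        then obtain u where u: "u \<in> Hom C Q P" "\<forall>k<n. p k \<cdot> u = f k"
          and un: "\<And>u'. u' \<in> Hom C Q P \<Longrightarrow> \<forall>k<n. p k \<cdot> u' = f k \<Longrightarrow> u' = u"
          by blast
        obtain m where m: "m \<in> Hom C Q S" "a \<cdot> m = u" "b \<cdot> m = f n"
          using biproduct_pair[OF S u(1)] f by blast
        have pa: "p k \<cdot> a \<cdot> m' = p k \<cdot> (a \<cdot> m')" if "k < n" "m' \<in> Hom C Q S" for k m'
          using Cmp_assoc[OF that(2) SD(3), of "p k" "A k"] p that(1) by simp
        show ?thesis
        proof (rule ex1I[of _ m])
          show "m \<in> Hom C Q S \<and> (\<forall>k<Suc n. ?p k \<cdot> m = f k)"
            using m u pa by (auto simp: less_Suc_eq)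
          fix m' assume m': "m' \<in> Hom C Q S \<and> (\<forall>k<Suc n. ?p k \<cdot> m' = f k)"
          have "p k \<cdot> (a \<cdot> m') = f k" if k: "k < n" for k
          proof -
            have "?p k \<cdot> m' = f k" using m' k by (simp add: less_Suc_eq)
            then show ?thesis using k pa[OF k] m' by simp
          qed
          then have "a \<cdot> m' = u" using un[of "a \<cdot> m'"] Cmp_Hom[OF _ SD(3)] m' by blast
          moreover have "b \<cdot> m' = f n" using spec[OF conjunct2[OF m'], of n] by simp
          ultimately show "m' = m" using biproduct_pair_unique[OF S] m m' by auto
        qed
      qed
      show "\<exists>P \<in> Obj C. \<exists>p. (\<forall>k<Suc n. p k \<in> Hom C P (A k)) \<and>
           (\<forall>Q \<in> Obj C. \<forall>f. (\<forall>k<Suc n. f k \<in> Hom C Q (A k)) \<longrightarrow>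
              (\<exists>!u. u \<in> Hom C Q P \<and> (\<forall>k<Suc n. p k \<cdot> u = f k)))"
        by (rule bexI[OF _ SD(12)], rule exI[of _ ?p], rule conjI[OF p'],
            intro ballI allI impI, rule univ)
    qed
  qed
qed

lemma finite_coproducts: "has_finite_coproducts C"
  unfolding has_finite_coproducts_def
proof (intro allI)
  fix n :: nat and A :: "nat \<Rightarrow> 'o"
  show "(\<forall>k<n. A k \<in> Obj C) \<longrightarrow>
        (\<exists>P \<in> Obj C. \<exists>i. (\<forall>k<n. i k \<in> Hom C (A k) P) \<and>
           (\<forall>Q \<in> Obj C. \<forall>f. (\<forall>k<n. f k \<in> Hom C (A k) Q) \<longrightarrow>
              (\<exists>!u. u \<in> Hom C P Q \<and> (\<forall>k<n. u \<cdot> i k = f k))))"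
  proof (induction n)
    case 0
    show ?case using ex_zero_object unfolding zero_object_def initial_object_def by auto
  next
    case (Suc n)
    show ?case
    proof
      assume A: "\<forall>k<Suc n. A k \<in> Obj C"
      then have "\<forall>k<n. A k \<in> Obj C" by simp
      from mp[OF Suc this] obtain P s where P: "P \<in> Obj C" and s: "\<forall>k<n. s k \<in> Hom C (A k) P"
        and ex: "\<forall>Q \<in> Obj C. \<forall>f. (\<forall>k<n. f k \<in> Hom C (A k) Q) \<longrightarrow>
          (\<exists>!u. u \<in> Hom C P Q \<and> (\<forall>k<n. u \<cdot> s k = f k))" by (elim bexE exE conjE) (rule that)
      obtain S i j a b where S: "biproduct C P (A n) S i j a b"
        using ex_biproduct[OF P] A by blast
      note SD = biproductD[OF S]
      let ?s = "\<lambda>k. if k = n then j else i \<cdot> s k"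
      have s': "\<forall>k<Suc n. ?s k \<in> Hom C (A k) S"
        using SD(2) Cmp_Hom[OF _ SD(1)] s by (simp add: less_Suc_eq)
      have univ: "\<exists>!u. u \<in> Hom C S Q \<and> (\<forall>k<Suc n. u \<cdot> ?s k = f k)"
        if Q: "Q \<in> Obj C" and f: "\<forall>k<Suc n. f k \<in> Hom C (A k) Q" for Q f
      proof -
        have "\<forall>k<n. f k \<in> Hom C (A k) Q" using f by simp
        then have "\<exists>!u. u \<in> Hom C P Q \<and> (\<forall>k<n. u \<cdot> s k = f k)" using ex Q by blast
        then obtain u where u: "u \<in> Hom C P Q" "\<forall>k<n. u \<cdot> s k = f k"
          and un: "\<And>u'. u' \<in> Hom C P Q \<Longrightarrow> \<forall>k<n. u' \<cdot> s k = f k \<Longrightarrow> u' = u"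
          by blast
        obtain m where m: "m \<in> Hom C S Q" "m \<cdot> i = u" "m \<cdot> j = f n"
          using biproduct_copair[OF S u(1)] f by blast
        have pa: "m' \<cdot> (i \<cdot> s k) = m' \<cdot> i \<cdot> s k" if "k < n" "m' \<in> Hom C S Q" for k m'
          using Cmp_assoc[OF _ SD(1) that(2), of "s k" "A k"] s that(1) by simp
        show ?thesis
        proof (rule ex1I[of _ m])
          show "m \<in> Hom C S Q \<and> (\<forall>k<Suc n. m \<cdot> ?s k = f k)"
            using m u pa by (auto simp: less_Suc_eq)
          fix m' assume m': "m' \<in> Hom C S Q \<and> (\<forall>k<Suc n. m' \<cdot> ?s k = f k)"
          have "m' \<cdot> i \<cdot> s k = f k" if k: "k < n" for k
          proof -
            have "m' \<cdot> ?s k = f k" using m' k by (simp add: less_Suc_eq)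
            then show ?thesis using k pa[OF k] m' by simp
          qed
          then have "m' \<cdot> i = u" using un[of "m' \<cdot> i"] Cmp_Hom[OF SD(1)] m' by blast
          moreover have "m' \<cdot> j = f n" using spec[OF conjunct2[OF m'], of n] by simp
          ultimately show "m' = m" using biproduct_copair_unique[OF S] m m' by auto
        qed
      qed
      show "\<exists>P \<in> Obj C. \<exists>i. (\<forall>k<Suc n. i k \<in> Hom C (A k) P) \<and>
           (\<forall>Q \<in> Obj C. \<forall>f. (\<forall>k<Suc n. f k \<in> Hom C (A k) Q) \<longrightarrow>
              (\<exists>!u. u \<in> Hom C P Q \<and> (\<forall>k<Suc n. u \<cdot> i k = f k)))"
        by (rule bexI[OF _ SD(12)], rule exI[of _ ?s], rule conjI[OF s'],
            intro ballI allI impI, rule univ)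
    qed
  qed
qed

end

section \<open>Exactness\<close>

context category
begin

lemma iso_arrowI:
  assumes "f \<in> Hom C X Y" "g \<in> Hom C Y X" "g \<cdot> f = Ident C X" "f \<cdot> g = Ident C Y"
  shows "iso_arrow C f"
proof -
  have "inverse_arrows C f g" using assms unfolding inverse_arrows_def in_Hom by auto
  then show ?thesis unfolding iso_arrow_def by blast
qed

lemma isomorphicE:
  assumes "isomorphic C X Y"
  obtains f g where "f \<in> Hom C X Y" "g \<in> Hom C Y X" "g \<cdot> f = Ident C X" "f \<cdot> g = Ident C Y"
proof -
  obtain f g where f: "f \<in> Hom C X Y" and g: "inverse_arrows C f g"
    using assms unfolding isomorphic_def iso_arrow_def by blast
  note d = Hom_Dom[OF f] Hom_Cod[OF f]
  have "f \<in> Hom C (Cod C g) (Dom C g)" using g unfolding inverse_arrows_def by blast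
  then have "Cod C g = X" "Dom C g = Y" using d unfolding in_Hom by simp_all
  then show ?thesis using that[OF f, of g] g d unfolding inverse_arrows_def by simp
qed

end

context triangulated_category
begin

lemma SArr_zero:
  assumes "X \<in> Obj C" "Y \<in> Obj C"
  shows "SArr C (MZero C X Y) = MZero C (SObj C X) (SObj C Y)"
proof -
  note z = zero_Hom[OF assms]
  note sz = SArr_Hom[OF z]
  have "SArr C (MZero C X Y) \<boxplus> SArr C (MZero C X Y) =
      SArr C (MZero C X Y) \<boxplus> MZero C (SObj C X) (SObj C Y)"
    by (simp add: SArr_add[OF z z, symmetric] zero_add[OF z] add_zero[OF sz])
  then show ?thesis
    using add_left_cancel[OF sz zero_Hom sz] SObj_Obj assms by simp
qed

lemma SArr_ex:
  assumes "y \<in> Hom C (SObj C X) (SObj C Y)" "X \<in> Obj C" "Y \<in> Obj C"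
  shows "\<exists>x \<in> Hom C X Y. SArr C x = y"
proof -
  have "y \<in> SArr C ` Hom C X Y"
    using bij_betw_imp_surj_on[OF SArr_bij[OF assms(2,3)]] assms(1) by simp
  then show ?thesis by auto
qed

lemma SArr_inj:
  assumes "f \<in> Hom C X Y" "g \<in> Hom C X Y" "SArr C f = SArr C g"
  shows "f = g"
proof -
  have "X \<in> Obj C" "Y \<in> Obj C" using Hom_Obj[OF assms(1)] by auto
  then have "inj_on (SArr C) (Hom C X Y)" by (intro bij_betw_imp_inj_on[OF SArr_bij])
  then show ?thesis using assms unfolding inj_on_def by blast
qed

lemma SObj_zero: "zero_object C Z \<Longrightarrow> zero_object C (SObj C Z)"
proof -
  assume z: "zero_object C Z"
  then have Z: "Z \<in> Obj C" by (simp add: zero_object_def initial_object_def)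
  have *: "Ident C Z = MZero C Z Z" using zero_objectD(1)[OF z Z] Ident_Hom[OF Z] by blast
  show "zero_object C (SObj C Z)"
    by (rule zero_objectI[OF SObj_Obj[OF Z]])
      (simp only: SArr_Ident[OF Z, symmetric] SArr_zero[OF Z Z, symmetric] *)
qed

lemma candidate_triangleI:
  assumes f: "f \<in> Hom C X Y" and g: "g \<in> Hom C Y Z" and h: "h \<in> Hom C Z (SObj C X)"
  shows "candidate_triangle C f g h"
  unfolding candidate_triangle_def
  by (simp add: Hom_Arr[OF f] Hom_Dom[OF f] Hom_Cod[OF f] Hom_Dom[OF h] Hom_Cod[OF g] g h)

lemma TriE:
  assumes "(f, g, h) \<in> Tri C"
  obtains X Y Z where "f \<in> Hom C X Y" "g \<in> Hom C Y Z" "h \<in> Hom C Z (SObj C X)"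
proof -
  have f: "f \<in> Arr C" and g: "g \<in> Hom C (Cod C f) (Dom C h)"
    and h: "h \<in> Hom C (Cod C g) (SObj C (Dom C f))"
    using Tri_candidate[OF assms] unfolding candidate_triangle_def by blast+
  show ?thesis
    using that[OF Arr_Hom[OF f] _ h] g unfolding Hom_Dom[OF h] by blast
qed

lemma Tri_third_Hom:
  assumes "(f, g, h) \<in> Tri C" "f \<in> Hom C X Y" "g \<in> Hom C Y Z"
  shows "h \<in> Hom C Z (SObj C X)"
  using Tri_candidate[OF assms(1)] unfolding candidate_triangle_def
  by (simp add: Hom_Dom[OF assms(2)] Hom_Cod[OF assms(3)])

lemma Tri_rotateD: "(f, g, h) \<in> Tri C \<Longrightarrow> (g, h, MNeg C (SArr C f)) \<in> Tri C"
  using Tri_rotate Tri_candidate by blast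

text \<open>The axioms of a triangulated category are used through the long exact \<open>Hom\<close> sequences, in the form
  of the next lemmas. Up to rotation, each instance comes from a morphism between the given triangle and
  the trivial triangle on one object.\<close>
lemma Tri_comp_zero:
  assumes t: "(f, g, h) \<in> Tri C" and f: "f \<in> Hom C X Y" and g: "g \<in> Hom C Y Z"
  shows "g \<cdot> f = MZero C X Z"
proof -
  obtain O' where O': "zero_object C O'" using ex_zero_object by blast
  have X: "X \<in> Obj C" and Z: "Z \<in> Obj C" using Hom_Obj f g by blast+
  have z: "MZero C X O' \<in> Hom C X O'" using zero_Hom X zero_objectD(3)[OF O' X] by blast
  obtain c where c: "c \<in> Hom C O' Z" "c \<cdot> MZero C X O' = g \<cdot> f"
    using Tri_morphism[OF Tri_Ident[OF X O'] t, of "Ident C X" f] Ident_Hom[OF X] f g z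
    by (auto simp: in_Hom)
  then show ?thesis using Cmp_zero[OF c(1) X] by simp
qed

lemma Tri_comp_zero2:
  assumes t: "(f, g, h) \<in> Tri C" and g: "g \<in> Hom C Y Z" and h: "h \<in> Hom C Z V"
  shows "h \<cdot> g = MZero C Y V"
  using Tri_comp_zero[OF Tri_rotateD[OF t] g h] .

lemma Tri_zero_Ident:
  assumes V: "V \<in> Obj C" and O': "zero_object C O'"
  shows "(MZero C O' V, Ident C V, MZero C V (SObj C O')) \<in> Tri C"
proof -
  have OO: "O' \<in> Obj C" using zero_objectD(3)[OF O' V] .
  have c: "candidate_triangle C (MZero C O' V) (Ident C V) (MZero C V (SObj C O'))"
    using candidate_triangleI[OF zero_Hom[OF OO V] Ident_Hom[OF V] zero_Hom[OF V SObj_Obj[OF OO]]] .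
  show ?thesis
    using Tri_rotate[OF c] Tri_Ident[OF V SObj_zero[OF O']] SArr_zero[OF OO V]
      neg_zero[OF SObj_Obj[OF OO] SObj_Obj[OF V]] by simp
qed

lemma Tri_extend:
  assumes t: "(f, g, h) \<in> Tri C" and f: "f \<in> Hom C X Y" and g: "g \<in> Hom C Y Z"
    and y: "y \<in> Hom C Y V" and yf: "y \<cdot> f = MZero C X V"
  shows "\<exists>z \<in> Hom C Z V. z \<cdot> g = y"
proof -
  obtain O' where O': "zero_object C O'" using ex_zero_object by blast
  have X: "X \<in> Obj C" and V: "V \<in> Obj C" using Hom_Obj f y by blast+
  have OO: "O' \<in> Obj C" using zero_objectD(3)[OF O' V] .
  note z = zero_Hom[OF X OO] zero_Hom[OF OO V]
  \<comment> \<open>The morphism of triangles whose target is \<open>0 \<rightarrow> V \<rightarrow> V \<rightarrow> \<Sigma>0\<close>.\<close>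
  obtain c where c: "c \<in> Hom C Z V" "c \<cdot> g = Ident C V \<cdot> y"
    using Tri_morphism[OF t Tri_zero_Ident[OF V O'], of "MZero C X O'" y] z yf zero_Cmp[OF z(1) V]
      y f g Ident_Hom[OF V]
    by (auto simp: in_Hom)
  then show ?thesis using Ident_left[OF y] by auto
qed

lemma Tri_lift:
  assumes t: "(f, g, h) \<in> Tri C" and f: "f \<in> Hom C X Y" and g: "g \<in> Hom C Y Z"
    and y: "y \<in> Hom C V Y" and gy: "g \<cdot> y = MZero C V Z"
  shows "\<exists>x \<in> Hom C V X. f \<cdot> x = y"
proof -
  obtain O' where O': "zero_object C O'" using ex_zero_object by blast
  have X: "X \<in> Obj C" and Z: "Z \<in> Obj C" and V: "V \<in> Obj C" using Hom_Obj f g y by blast+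
  have OO: "O' \<in> Obj C" using zero_objectD(3)[OF O' V] .
  have h: "h \<in> Hom C Z (SObj C X)" using Tri_third_Hom t f g by blast
  note z = zero_Hom[OF V OO] zero_Hom[OF OO Z] zero_Hom[OF OO SObj_Obj[OF V]]
  \<comment> \<open>The suspension of the lift is the third component of a morphism from \<open>V \<rightarrow> 0 \<rightarrow> \<Sigma>V\<close> to the
    rotated triangle; full faithfulness of the suspension brings it back.\<close>
  have "MZero C O' Z \<cdot> MZero C V O' = g \<cdot> y"
    using zero_Cmp[OF z(1) Z] gy by simp
  then obtain c where c: "c \<in> Hom C (SObj C V) (SObj C X)"
    and eq: "SArr C y \<cdot> MNeg C (SArr C (Ident C V)) = MNeg C (SArr C f) \<cdot> c"
    using Tri_morphism[OF Tri_rotateD[OF Tri_Ident[OF V O']] Tri_rotateD[OF t],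
        of y "MZero C O' Z"] z y g h
    by (auto simp: in_Hom)
  obtain x where x: "x \<in> Hom C V X" "SArr C x = c" using SArr_ex[OF c V X] by blast
  note sf = SArr_Hom[OF f] and sy = SArr_Hom[OF y] and sV = SArr_Hom[OF Ident_Hom[OF V]]
  have "MNeg C (SArr C y) = MNeg C (SArr C f \<cdot> c)"
    using eq Cmp_neg[OF sV sy] neg_Cmp[OF c sf] SArr_Ident[OF V] Ident_right[OF sy] by simp
  then have "SArr C y = SArr C f \<cdot> c"
    using neg_inj[OF sy Cmp_Hom[OF c sf]] by simp
  then have "SArr C (f \<cdot> x) = SArr C y"
    using SArr_Cmp[OF x(1) f] x(2) by simp
  then have "f \<cdot> x = y" using SArr_inj[OF Cmp_Hom[OF x(1) f] y] by simp
  then show ?thesis using x by blast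
qed

lemma Tri_ex_first:
  assumes f: "f \<in> Hom C X Y"
  obtains Z g h where "g \<in> Hom C Y Z" "h \<in> Hom C Z (SObj C X)" "(f, g, h) \<in> Tri C"
proof -
  obtain g h where t: "(f, g, h) \<in> Tri C" using Tri_ex Hom_Arr[OF f] by blast
  obtain X' Y' Z where "f \<in> Hom C X' Y'" "g \<in> Hom C Y' Z" "h \<in> Hom C Z (SObj C X')"
    using TriE[OF t] .
  then show ?thesis using f t that[of g Z h] by (simp add: in_Hom)
qed

text \<open>The suspension is essentially surjective but need not be surjective on objects, so rotating
  backwards is only possible after a choice of \<open>\<Sigma>Z\<close> isomorphic to the third object.\<close>
lemma Tri_unrotate:
  assumes t: "(f, a, b) \<in> Tri C" and f: "f \<in> Hom C X Y" and a: "a \<in> Hom C Y W"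
    and c: "c \<in> Hom C W (SObj C Z)" and d: "d \<in> Hom C (SObj C Z) W"
    and dc: "d \<cdot> c = Ident C W" and cd: "c \<cdot> d = Ident C (SObj C Z)" and Z: "Z \<in> Obj C"
  shows "\<exists>g \<in> Hom C Z X. (g, f, c \<cdot> a) \<in> Tri C"
proof -
  have X: "X \<in> Obj C" and Y: "Y \<in> Obj C" using Hom_Obj f by blast+
  have b: "b \<in> Hom C W (SObj C X)" using Tri_third_Hom t f a by blast
  have bd: "b \<cdot> d \<in> Hom C (SObj C Z) (SObj C X)" using Cmp_Hom d b by blast
  obtain g where g: "g \<in> Hom C Z X" "SArr C g = MNeg C (b \<cdot> d)"
    using SArr_ex[OF neg_Hom[OF bd] Z X] by blast
  have ca: "c \<cdot> a \<in> Hom C Y (SObj C Z)" using Cmp_Hom a c by blast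
  have "b = b \<cdot> d \<cdot> c" using Cmp_assoc[OF c d b] dc Ident_right[OF b] by simp
  then have "(f, c \<cdot> a, b \<cdot> d) \<in> Tri C"
    using Tri_iso[OF t candidate_triangleI[OF f ca bd], of "Ident C X" "Ident C Y" c]
      Ident_Hom[OF X] Ident_Hom[OF Y] iso_arrowI[OF Ident_Hom[OF X] Ident_Hom[OF X]]
      iso_arrowI[OF Ident_Hom[OF Y] Ident_Hom[OF Y]] iso_arrowI[OF c d dc cd]
      Ident_left[OF Ident_Hom[OF X]] Ident_left[OF Ident_Hom[OF Y]]
      Ident_left[OF f] Ident_right[OF f] Ident_right[OF ca] SArr_Ident[OF X] Ident_left[OF b]
      f a ca c by (auto simp: in_Hom)
  then have "(f, c \<cdot> a, MNeg C (SArr C g)) \<in> Tri C" using g(2) neg_neg[OF bd] by simp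
  then have "(g, f, c \<cdot> a) \<in> Tri C" using Tri_rotate[OF candidate_triangleI[OF g(1) f ca]] by simp
  then show ?thesis using g(1) by blast
qed

lemma Tri_ex_second:
  assumes f: "f \<in> Hom C X Y"
  obtains Z g h where "g \<in> Hom C Z X" "h \<in> Hom C Y (SObj C Z)" "(g, f, h) \<in> Tri C"
proof -
  obtain W a b where t: "a \<in> Hom C Y W" "b \<in> Hom C W (SObj C X)" "(f, a, b) \<in> Tri C"
    using Tri_ex_first[OF f] .
  obtain Z where Z: "Z \<in> Obj C" "isomorphic C (SObj C Z) W" using SObj_ess_surj Hom_Obj[OF t(1)] by blast
  obtain d c where dc: "d \<in> Hom C (SObj C Z) W" "c \<in> Hom C W (SObj C Z)"
    "c \<cdot> d = Ident C (SObj C Z)" "d \<cdot> c = Ident C W" using isomorphicE[OF Z(2)] .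
  obtain g where "g \<in> Hom C Z X" "(g, f, c \<cdot> a) \<in> Tri C"
    using Tri_unrotate[OF t(3) f t(1) dc(2,1,4,3) Z(1)] by blast
  then show ?thesis using that Cmp_Hom[OF t(1) dc(2)] by blast
qed

lemma zero_cone_lift:
  assumes t: "(f, g, h) \<in> Tri C" and f: "f \<in> Hom C X Y" and g: "g \<in> Hom C Y Z"
    and gz: "g = MZero C Y Z"
  shows "\<exists>s \<in> Hom C Y X. f \<cdot> s = Ident C Y"
proof -
  have "Y \<in> Obj C" "Z \<in> Obj C" using Hom_Obj[OF g] by auto
  then show ?thesis using Tri_lift[OF t f g Ident_Hom] zero_Cmp[OF Ident_Hom] gz by simp
qed

text \<open>In the triangle \<open>X \<rightarrow> S \<rightarrow> V \<rightarrow> \<Sigma>X\<close> on a split monomorphism \<open>i\<close>, the last morphism is zero because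
  \<open>\<Sigma>i\<close> is again split. Hence \<open>S \<rightarrow> V\<close> is a split epimorphism and \<open>V\<close> is a complement. This is what
  makes \<open>add T\<close>, defined by direct summands, closed under retracts.\<close>
lemma retract_biproduct:
  assumes i: "i \<in> Hom C X S" and r: "r \<in> Hom C S X" and ri: "r \<cdot> i = Ident C X"
  shows "\<exists>Y j c. biproduct C X Y S i j r c"
proof -
  obtain V c h where c: "c \<in> Hom C S V" and h: "h \<in> Hom C V (SObj C X)" and t: "(i, c, h) \<in> Tri C"
    using Tri_ex_first[OF i] .
  have X: "X \<in> Obj C" and S: "S \<in> Obj C" and V: "V \<in> Obj C" using Hom_Obj i c by blast+
  note t1 = Tri_rotateD[OF t]
  note si = SArr_Hom[OF i] and sr = SArr_Hom[OF r]
  have "MNeg C (SArr C i) \<cdot> h = MZero C V (SObj C S)"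
    using Tri_comp_zero2[OF t1 h neg_Hom[OF si]] .
  then have "MNeg C (SArr C i \<cdot> h) = MZero C V (SObj C S)" using neg_Cmp[OF h si] by simp
  then have "SArr C i \<cdot> h = MZero C V (SObj C S)"
    using neg_inj[OF Cmp_Hom[OF h si] zero_Hom[OF V SObj_Obj[OF S]]] neg_zero[OF V SObj_Obj[OF S]]
    by simp
  then have "SArr C (r \<cdot> i) \<cdot> h = MZero C V (SObj C X)"
    using SArr_Cmp[OF i r] Cmp_assoc[OF h si sr] Cmp_zero[OF sr V] by simp
  then have "h = MZero C V (SObj C X)" using ri SArr_Ident[OF X] Ident_left[OF h] by simp
  then obtain s where s: "s \<in> Hom C V S" "c \<cdot> s = Ident C V" using zero_cone_lift[OF t1 c h] by blast
  note I = Ident_Hom[OF S] and ir = Cmp_Hom[OF r i]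
  let ?d = "MDiff C (Ident C S) (i \<cdot> r)"
  have d: "?d \<in> Hom C S S" using diff_Hom[OF I ir] .
  have "?d \<cdot> i = MZero C X S"
    using diff_Cmp[OF I ir i] Ident_left[OF i] Cmp_assoc[OF i r i] ri Ident_right[OF i] diff_self[OF i]
    by simp
  then obtain k where k: "k \<in> Hom C V S" "k \<cdot> c = ?d" using Tri_extend[OF t i c d] by blast
  \<comment> \<open>The complement is embedded by \<open>k\<close> rather than by an arbitrary section \<open>s\<close> of \<open>c\<close>, which need not
    be annihilated by \<open>r\<close>.\<close>
  have kds: "k = ?d \<cdot> s" using Cmp_assoc[OF s(1) c k(1)] k(2) s(2) Ident_right[OF k(1)] by simp
  have ci: "c \<cdot> i = MZero C X V" using Tri_comp_zero[OF t i c] .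
  have cd: "c \<cdot> ?d = c"
    using Cmp_diff[OF I ir c] Ident_right[OF c] Cmp_assoc[OF r i c] ci zero_Cmp[OF r V]
      add_diff(2)[OF c zero_Hom[OF S V]] add_zero[OF diff_Hom[OF c zero_Hom[OF S V]]] by simp
  have rd: "r \<cdot> ?d = MZero C S X"
    using Cmp_diff[OF I ir r] Ident_right[OF r] Cmp_assoc[OF r i r] ri Ident_left[OF r] diff_self[OF r]
    by simp
  have "c \<cdot> k = Ident C V" using Cmp_assoc[OF s(1) d c] cd s(2) kds by simp
  moreover have "r \<cdot> k = MZero C V X" using Cmp_assoc[OF s(1) d r] rd zero_Cmp[OF s(1) X] kds by simp
  moreover have "(i \<cdot> r) \<boxplus> (k \<cdot> c) = Ident C S" using k(2) add_diff(1)[OF I ir] by simp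
  ultimately have "biproduct C X V S i k r c"
    unfolding biproduct_def using i k(1) r c ri ci by simp
  then show ?thesis by blast
qed

text \<open>The morphism that follows an epimorphism in a triangle is zero, so the identity of the target lifts.
  Pull-backs along epimorphisms are therefore pull-backs along projections of direct sums.\<close>
lemma epi_split:
  assumes e: "epi C e" "e \<in> Hom C Z Y"
  shows "\<exists>s \<in> Hom C Y Z. e \<cdot> s = Ident C Y"
proof -
  obtain W g h where g: "g \<in> Hom C Y W" and "h \<in> Hom C W (SObj C Z)" and t: "(e, g, h) \<in> Tri C"
    using Tri_ex_first[OF e(2)] .
  have Y: "Y \<in> Obj C" and W: "W \<in> Obj C" using Hom_Obj[OF g] by auto
  have "g \<cdot> e = MZero C Y W \<cdot> e" using Tri_comp_zero[OF t e(2) g] zero_Cmp[OF e(2) W] by simp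
  then have "g = MZero C Y W"
    using e(1) g zero_Hom[OF Y W] Hom_Cod[OF e(2)] unfolding epi_def by blast
  then show ?thesis using zero_cone_lift[OF t e(2) g] by blast
qed

end

section \<open>The additive closure of an object\<close>

text \<open>The ideal of finite sums of morphisms through \<open>T\<close>. An object lies in \<open>add T\<close> iff its identity
  lies in this ideal (\<open>add_objects_iff\<close>). With this description, closure properties of \<open>add T\<close> and
  reductions from \<open>add T\<close> to \<open>T\<close> become inductions over sums, with no choice of direct sums or
  complements.\<close>
inductive sum_through ::
    "('o, 'm, 'x) preadditive_category_scheme \<Rightarrow> 'o \<Rightarrow> 'o \<Rightarrow> 'o \<Rightarrow> 'm \<Rightarrow> bool"
  for C :: "('o, 'm, 'x) preadditive_category_scheme" and T X Y :: 'o where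
  zero: "sum_through C T X Y (MZero C X Y)"
| step: "sum_through C T X Y f \<Longrightarrow> a \<in> Hom C X T \<Longrightarrow> b \<in> Hom C T Y
    \<Longrightarrow> sum_through C T X Y (f \<boxplus>\<^bsub>C\<^esub> (b \<cdot>\<^bsub>C\<^esub> a))"

context category
begin

text \<open>The next two notions say that the map \<open>C(V,f)\<close> induced by composition is surjective, resp. injective.\<close>
definition surj_from :: "'o \<Rightarrow> 'm \<Rightarrow> bool" where
  "surj_from V f \<longleftrightarrow> (\<forall>y \<in> Hom C V (Cod C f). \<exists>x \<in> Hom C V (Dom C f). f \<cdot> x = y)"

definition inj_from :: "'o \<Rightarrow> 'm \<Rightarrow> bool" where
  "inj_from V f \<longleftrightarrow>
     (\<forall>x \<in> Hom C V (Dom C f). \<forall>x' \<in> Hom C V (Dom C f). f \<cdot> x = f \<cdot> x' \<longrightarrow> x = x')"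

lemma surj_fromI:
  assumes "f \<in> Hom C X Y" "\<And>y. y \<in> Hom C V Y \<Longrightarrow> \<exists>x \<in> Hom C V X. f \<cdot> x = y"
  shows "surj_from V f"
  using assms(2) unfolding surj_from_def Hom_Dom[OF assms(1)] Hom_Cod[OF assms(1)] by blast

lemma surj_fromE:
  assumes "surj_from V f" "f \<in> Hom C X Y" "y \<in> Hom C V Y"
  obtains x where "x \<in> Hom C V X" "f \<cdot> x = y"
  using assms(1,3) that unfolding surj_from_def Hom_Dom[OF assms(2)] Hom_Cod[OF assms(2)] by blast

lemma inj_fromI:
  assumes "f \<in> Hom C X Y"
    "\<And>x x'. \<lbrakk>x \<in> Hom C V X; x' \<in> Hom C V X; f \<cdot> x = f \<cdot> x'\<rbrakk> \<Longrightarrow> x = x'"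
  shows "inj_from V f"
  using assms(2) unfolding inj_from_def Hom_Dom[OF assms(1)] Hom_Cod[OF assms(1)] by blast

lemma inj_fromD:
  assumes "inj_from V f" "f \<in> Hom C X Y" "x \<in> Hom C V X" "x' \<in> Hom C V X" "f \<cdot> x = f \<cdot> x'"
  shows "x = x'"
  using assms(1,3,4,5) unfolding inj_from_def Hom_Dom[OF assms(2)] by blast

lemma split_surj_from:
  assumes "f \<in> Hom C X Y" "s \<in> Hom C Y X" "f \<cdot> s = Ident C Y"
  shows "surj_from V f"
proof (rule surj_fromI[OF assms(1)])
  fix y assume y: "y \<in> Hom C V Y"
  show "\<exists>x \<in> Hom C V X. f \<cdot> x = y"
    using Cmp_Hom[OF y assms(2)] Cmp_assoc[OF y assms(2,1)] assms(3) Ident_left[OF y]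
    by (intro bexI[of _ "s \<cdot> y"]) simp_all
qed

end

context preadditive_category
begin

lemma inj_from_zeroI:
  assumes f: "f \<in> Hom C X Y" and V: "V \<in> Obj C"
    and z: "\<And>x. \<lbrakk>x \<in> Hom C V X; f \<cdot> x = MZero C V Y\<rbrakk> \<Longrightarrow> x = MZero C V X"
  shows "inj_from V f"
proof (rule inj_fromI[OF f])
  fix x x' assume x: "x \<in> Hom C V X" "x' \<in> Hom C V X" and eq: "f \<cdot> x = f \<cdot> x'"
  have "f \<cdot> MDiff C x x' = MZero C V Y"
    using Cmp_diff[OF x f] eq diff_self[OF Cmp_Hom[OF x(2) f]] by simp
  then have "MDiff C x x' = MZero C V X" using z diff_Hom[OF x] by blast
  then show "x = x'" using diff_zero_iff[OF x] by simp
qed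

lemma inj_from_zeroD:
  assumes "inj_from V f" "f \<in> Hom C X Y" "x \<in> Hom C V X" "f \<cdot> x = MZero C V Y"
  shows "x = MZero C V X"
proof -
  have V: "V \<in> Obj C" and X: "X \<in> Obj C" using Hom_Obj[OF assms(3)] by auto
  show ?thesis
    using inj_fromD[OF assms(1-3) zero_Hom[OF V X]] assms(4) Cmp_zero[OF assms(2) V] by simp
qed

lemma sum_through_Hom:
  assumes "sum_through C T X Y f" "X \<in> Obj C" "Y \<in> Obj C"
  shows "f \<in> Hom C X Y"
  using assms(1)
proof induction
  case zero
  show ?case using zero_Hom assms(2,3) .
next
  case (step f a b)
  show ?case using add_Hom[OF step.IH Cmp_Hom[OF step.hyps(2,3)]] .
qed

lemma sum_through_single:
  assumes a: "a \<in> Hom C X T" and b: "b \<in> Hom C T Y"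
  shows "sum_through C T X Y (b \<cdot> a)"
  using sum_through.step[OF sum_through.zero a b] zero_add[OF Cmp_Hom[OF a b]] by simp

lemma sum_through_add:
  assumes f: "sum_through C T X Y f" and g: "sum_through C T X Y g" and O: "X \<in> Obj C" "Y \<in> Obj C"
  shows "sum_through C T X Y (f \<boxplus> g)"
  using g
proof induction
  case zero
  show ?case using f add_zero[OF sum_through_Hom[OF f O]] by simp
next
  case (step g a b)
  show ?case
    using sum_through.step[OF step.IH step.hyps(2,3)]
      add_assoc[OF sum_through_Hom[OF f O] sum_through_Hom[OF step.hyps(1) O]
        Cmp_Hom[OF step.hyps(2,3)]] by simp
qed

lemma Cmp_sum_through:
  assumes f: "sum_through C T X Y f" and X: "X \<in> Obj C" and h: "h \<in> Hom C Y Z"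
  shows "sum_through C T X Z (h \<cdot> f)"
  using f
proof induction
  case zero
  show ?case using sum_through.zero[of C T X Z] Cmp_zero[OF h X] by simp
next
  case (step f a b)
  have Y: "Y \<in> Obj C" using Hom_Obj[OF h] by simp
  show ?case
    using sum_through.step[OF step.IH step.hyps(2) Cmp_Hom[OF step.hyps(3) h]]
      Cmp_add_right[OF sum_through_Hom[OF step.hyps(1) X Y] Cmp_Hom[OF step.hyps(2,3)] h]
      Cmp_assoc[OF step.hyps(2,3) h] by simp
qed

lemma sum_through_Cmp:
  assumes f: "sum_through C T X Y f" and Y: "Y \<in> Obj C" and h: "h \<in> Hom C W X"
  shows "sum_through C T W Y (f \<cdot> h)"
  using f
proof induction
  case zero
  show ?case using sum_through.zero[of C T W Y] zero_Cmp[OF h Y] by simp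
next
  case (step f a b)
  have X: "X \<in> Obj C" using Hom_Obj[OF h] by simp
  show ?case
    using sum_through.step[OF step.IH Cmp_Hom[OF h step.hyps(2)] step.hyps(3)]
      Cmp_add_left[OF h sum_through_Hom[OF step.hyps(1) X Y] Cmp_Hom[OF step.hyps(2,3)]]
      Cmp_assoc[OF h step.hyps(2,3)] by simp
qed

lemma sum_through_Ident_retract:
  assumes S: "sum_through C T S S (Ident C S)"
    and i: "i \<in> Hom C X S" and r: "r \<in> Hom C S X" and ri: "r \<cdot> i = Ident C X"
  shows "sum_through C T X X (Ident C X)"
proof -
  have SO: "S \<in> Obj C" and X: "X \<in> Obj C" using Hom_Obj[OF i] by auto
  show ?thesis
    using sum_through_Cmp[OF Cmp_sum_through[OF S SO r] X i] ri Ident_right[OF r] by simp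
qed

lemma sum_through_Ident_biproduct:
  assumes b: "biproduct C X Y S i j p q"
    and X: "sum_through C T X X (Ident C X)" and Y: "sum_through C T Y Y (Ident C Y)"
  shows "sum_through C T S S (Ident C S)"
proof -
  note bD = biproductD[OF b]
  have "sum_through C T S S (i \<cdot> p)"
    using sum_through_Cmp[OF Cmp_sum_through[OF X bD(10,1)] bD(12,3)] Ident_right[OF bD(1)] by simp
  moreover have "sum_through C T S S (j \<cdot> q)"
    using sum_through_Cmp[OF Cmp_sum_through[OF Y bD(11,2)] bD(12,4)] Ident_right[OF bD(2)] by simp
  ultimately show ?thesis using sum_through_add[OF _ _ bD(12,12)] bD(9) by fastforce
qed

lemma finite_power_sum_through:
  assumes "finite_power C T S"
  shows "S \<in> Obj C \<and> sum_through C T S S (Ident C S)"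
  using assms
proof induction
  case (zero S)
  have S: "S \<in> Obj C" using zero unfolding zero_object_def initial_object_def by blast
  have "Ident C S = MZero C S S" using zero_objectD(1)[OF zero S] Ident_Hom[OF S] by blast
  then show ?case using S sum_through.zero[of C T S S] by simp
next
  case (step S S')
  obtain i j p q where b: "biproduct C S T S' i j p q" using step.hyps(2) direct_sum_iff by blast
  note bD = biproductD[OF b]
  have "sum_through C T T T (Ident C T)"
    using sum_through_single[OF Ident_Hom[OF bD(11)] Ident_Hom[OF bD(11)]]
      Ident_left[OF Ident_Hom[OF bD(11)]] by simp
  then show ?case using sum_through_Ident_biproduct[OF b] step.IH bD(12) by blast
qed

end

context additive_category
begin

text \<open>Each summand \<open>b a\<close> adds one copy of \<open>T\<close> to the finite power through which the sum factors.\<close>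
lemma sum_through_finite_power:
  assumes f: "sum_through C T X Y f" and O: "X \<in> Obj C" "Y \<in> Obj C"
  shows "\<exists>S a b. finite_power C T S \<and> a \<in> Hom C X S \<and> b \<in> Hom C S Y \<and> f = b \<cdot> a"
  using f
proof induction
  case zero
  obtain Z where Z: "zero_object C Z" using ex_zero_object by blast
  note ZO = zero_objectD(3)[OF Z O(1)]
  show ?case
    using finite_power.zero[OF Z] zero_Hom[OF O(1) ZO] zero_Hom[OF ZO O(2)]
      zero_Cmp[OF zero_Hom[OF O(1) ZO] O(2)] by metis
next
  case (step f a b)
  obtain S a' b' where S: "finite_power C T S" and a': "a' \<in> Hom C X S" and b': "b' \<in> Hom C S Y"
    and f: "f = b' \<cdot> a'" using step.IH by blast
  have T: "T \<in> Obj C" "S \<in> Obj C" using Hom_Obj[OF step.hyps(3)] Hom_Obj[OF b'] by auto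
  obtain S' i j p q where bi: "biproduct C S T S' i j p q" using ex_biproduct[OF T(2,1)] .
  note bD = biproductD[OF bi]
  obtain n where n: "n \<in> Hom C S' Y" "n \<cdot> i = b'" "n \<cdot> j = b"
    using biproduct_copair[OF bi b' step.hyps(3)] by blast
  note ia = Cmp_Hom[OF a' bD(1)] and ja = Cmp_Hom[OF step.hyps(2) bD(2)]
  have "n \<cdot> (i \<cdot> a' \<boxplus> j \<cdot> a) = f \<boxplus> (b \<cdot> a)"
    using Cmp_add_right[OF ia ja n(1)] Cmp_assoc[OF a' bD(1) n(1)]
      Cmp_assoc[OF step.hyps(2) bD(2) n(1)] n f by simp
  moreover have "finite_power C T S'" using finite_power.step[OF S] direct_sum_iff bi by blast
  ultimately show ?case using add_Hom[OF ia ja] n(1) by metis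
qed

end

context triangulated_category
begin

lemma add_objects_iff: "X \<in> add_objects C T \<longleftrightarrow> X \<in> Obj C \<and> sum_through C T X X (Ident C X)"
proof
  assume "X \<in> add_objects C T"
  then obtain Y S where X: "X \<in> Obj C" and S: "finite_power C T S" "direct_sum C X Y S"
    unfolding add_objects_def by blast
  obtain i j p q where b: "biproduct C X Y S i j p q" using S(2) direct_sum_iff by blast
  show "X \<in> Obj C \<and> sum_through C T X X (Ident C X)"
    using X sum_through_Ident_retract[OF _ biproductD(1,3,5)[OF b]] finite_power_sum_through[OF S(1)]
    by blast
next
  assume X: "X \<in> Obj C \<and> sum_through C T X X (Ident C X)"
  obtain S a b where S: "finite_power C T S" and ab: "a \<in> Hom C X S" "b \<in> Hom C S X"
    "Ident C X = b \<cdot> a" using sum_through_finite_power[of T X X "Ident C X"] X by blast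
  obtain Y j c where "biproduct C X Y S a j b c" using retract_biproduct[OF ab(1,2)] ab(3) by metis
  then show "X \<in> add_objects C T" unfolding add_objects_def using X S direct_sum_iff by blast
qed

lemma add_objects_Obj: "X \<in> add_objects C T \<Longrightarrow> X \<in> Obj C"
  by (simp add: add_objects_iff)

lemma add_objects_self:
  assumes T: "T \<in> Obj C"
  shows "T \<in> add_objects C T"
  using T sum_through_single[OF Ident_Hom[OF T] Ident_Hom[OF T]] Ident_left[OF Ident_Hom[OF T]]
  by (simp add: add_objects_iff)

lemma add_objects_zero:
  assumes Z: "zero_object C Z"
  shows "Z \<in> add_objects C T"
  using finite_power_sum_through[OF finite_power.zero[OF Z]] by (simp add: add_objects_iff)

lemma add_objects_retract:
  assumes S: "S \<in> add_objects C T"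
    and i: "i \<in> Hom C X S" and r: "r \<in> Hom C S X" and ri: "r \<cdot> i = Ident C X"
  shows "X \<in> add_objects C T"
  using sum_through_Ident_retract[OF _ i r ri] S Hom_Obj[OF i] by (simp add: add_objects_iff)

lemma add_objects_SObj:
  assumes X: "X \<in> add_objects C T"
  shows "SObj C X \<in> add_objects C (SObj C T)"
proof -
  have XO: "X \<in> Obj C" and XT: "sum_through C T X X (Ident C X)" using X add_objects_iff by auto
  have "sum_through C (SObj C T) (SObj C X) (SObj C X) (SArr C k)" if "sum_through C T X X k" for k
    using that
  proof induction
    case zero
    show ?case using sum_through.zero SArr_zero[OF XO XO] by metis
  next
    case (step f a b)
    show ?case
      using sum_through.step[OF step.IH SArr_Hom[OF step.hyps(2)] SArr_Hom[OF step.hyps(3)]]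
        SArr_add[OF sum_through_Hom[OF step.hyps(1) XO XO] Cmp_Hom[OF step.hyps(2,3)]]
        SArr_Cmp[OF step.hyps(2,3)] by simp
  qed
  from this[OF XT] show ?thesis using SArr_Ident[OF XO] SObj_Obj[OF XO] by (simp add: add_objects_iff)
qed

text \<open>A sum of morphisms through \<open>\<Sigma>T\<close> that equals the identity of \<open>\<Sigma>U\<close> desuspends term by term.\<close>
lemma add_objects_SObj_reflect:
  assumes U: "SObj C U \<in> add_objects C (SObj C T)" and UO: "U \<in> Obj C" and T: "T \<in> Obj C"
  shows "U \<in> add_objects C T"
proof -
  have "\<exists>k'. sum_through C T U U k' \<and> SArr C k' = k"
    if "sum_through C (SObj C T) (SObj C U) (SObj C U) k" for k
    using that
  proof induction
    case zero
    show ?case using sum_through.zero SArr_zero[OF UO UO] by metis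
  next
    case (step f a b)
    obtain f' where f': "sum_through C T U U f'" "SArr C f' = f" using step.IH by blast
    obtain a' where a': "a' \<in> Hom C U T" "SArr C a' = a" using SArr_ex[OF step.hyps(2) UO T] by blast
    obtain b' where b': "b' \<in> Hom C T U" "SArr C b' = b" using SArr_ex[OF step.hyps(3) T UO] by blast
    have "SArr C (f' \<boxplus> (b' \<cdot> a')) = f \<boxplus> (b \<cdot> a)"
      using SArr_add[OF sum_through_Hom[OF f'(1) UO UO] Cmp_Hom[OF a'(1) b'(1)]]
        SArr_Cmp[OF a'(1) b'(1)] f'(2) a'(2) b'(2) by simp
    then show ?case using sum_through.step[OF f'(1) a'(1) b'(1)] by blast
  qed
  then obtain k where k: "sum_through C T U U k" "SArr C k = Ident C (SObj C U)"
    using U add_objects_iff by blast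
  have "k = Ident C U"
    using SArr_inj[OF sum_through_Hom[OF k(1) UO UO] Ident_Hom[OF UO]] k(2) SArr_Ident[OF UO] by simp
  then show ?thesis using k(1) UO add_objects_iff by blast
qed

lemma sum_through_via_add_objects:
  assumes D: "D \<in> add_objects C V" and a: "a \<in> Hom C X D" and b: "b \<in> Hom C D Y"
  shows "sum_through C V X Y (b \<cdot> a)"
proof -
  have DO: "D \<in> Obj C" and Y: "Y \<in> Obj C" using Hom_Obj[OF b] by auto
  show ?thesis
    using sum_through_Cmp[OF Cmp_sum_through[OF _ DO b] Y a, of V "Ident C D"] D Ident_right[OF b]
    by (simp add: add_objects_iff)
qed

lemma add_objects_epi:
  assumes D: "D \<in> add_objects C T" and f: "f \<in> Hom C D Y"
    and z: "\<And>b. b \<in> Hom C T D \<Longrightarrow> f \<cdot> b = MZero C T Y"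
  shows "f = MZero C D Y"
proof -
  have DO: "D \<in> Obj C" and DT: "sum_through C T D D (Ident C D)" and Y: "Y \<in> Obj C"
    using D add_objects_iff Hom_Obj[OF f] by auto
  have "f \<cdot> k = MZero C D Y" if "sum_through C T D D k" for k
    using that
  proof induction
    case zero
    show ?case using Cmp_zero[OF f DO] .
  next
    case (step k a b)
    show ?case
      using Cmp_add_right[OF sum_through_Hom[OF step.hyps(1) DO DO] Cmp_Hom[OF step.hyps(2,3)] f]
        Cmp_assoc[OF step.hyps(2,3) f] z[OF step.hyps(3)] step.IH zero_Cmp[OF step.hyps(2) Y]
        add_zero[OF zero_Hom[OF DO Y]] by simp
  qed
  from this[OF DT] show ?thesis using Ident_right[OF f] by simp
qed

lemma surj_from_add_objects:
  assumes D: "D \<in> add_objects C T" and f: "f \<in> Hom C X Y" and s: "surj_from T f"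
  shows "surj_from D f"
proof (rule surj_fromI[OF f])
  fix y assume y: "y \<in> Hom C D Y"
  have DO: "D \<in> Obj C" and DT: "sum_through C T D D (Ident C D)" and X: "X \<in> Obj C"
    using D add_objects_iff Hom_Obj[OF f] by auto
  have "\<exists>x \<in> Hom C D X. f \<cdot> x = y \<cdot> k" if "sum_through C T D D k" for k
    using that
  proof induction
    case zero
    show ?case using Cmp_zero[OF f DO] Cmp_zero[OF y DO] zero_Hom[OF DO X] by auto
  next
    case (step k a b)
    obtain x where x: "x \<in> Hom C D X" "f \<cdot> x = y \<cdot> k" using step.IH by blast
    obtain x' where x': "x' \<in> Hom C T X" "f \<cdot> x' = y \<cdot> b"
      using surj_fromE[OF s f Cmp_Hom[OF step.hyps(3) y]] .
    note xa = Cmp_Hom[OF step.hyps(2) x'(1)]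
    have "f \<cdot> (x \<boxplus> (x' \<cdot> a)) = y \<cdot> (k \<boxplus> (b \<cdot> a))"
      using Cmp_add_right[OF x(1) xa f] x(2) Cmp_assoc[OF step.hyps(2) x'(1) f] x'(2)
        Cmp_assoc[OF step.hyps(2,3) y]
        Cmp_add_right[OF sum_through_Hom[OF step.hyps(1) DO DO] Cmp_Hom[OF step.hyps(2,3)] y] by simp
    then show ?case using add_Hom[OF x(1) xa] by blast
  qed
  from this[OF DT] show "\<exists>x \<in> Hom C D X. f \<cdot> x = y" using Ident_right[OF y] by simp
qed

lemma inj_from_add_objects:
  assumes D: "D \<in> add_objects C T" and f: "f \<in> Hom C X Y" and i: "inj_from T f"
  shows "inj_from D f"
proof (rule inj_from_zeroI[OF f add_objects_Obj[OF D]])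
  fix x assume x: "x \<in> Hom C D X" and fx: "f \<cdot> x = MZero C D Y"
  show "x = MZero C D X"
  proof (rule add_objects_epi[OF D x])
    fix b assume b: "b \<in> Hom C T D"
    have Y: "Y \<in> Obj C" using Hom_Obj[OF f] by simp
    have "f \<cdot> (x \<cdot> b) = MZero C T Y"
      using Cmp_assoc[OF b x f] fx zero_Cmp[OF b Y] by simp
    then show "x \<cdot> b = MZero C T X" using inj_from_zeroD[OF i f Cmp_Hom[OF b x]] by simp
  qed
qed

lemma perp_iff:
  assumes T: "T \<in> Obj C"
  shows "Z \<in> perp C T \<longleftrightarrow> Z \<in> Obj C \<and> (\<forall>x \<in> Hom C T Z. x = MZero C T Z)"
  unfolding perp_def using zero_Hom[OF T] by blast

lemma add_objects_perp:
  assumes V: "V \<in> perp C T" and Z: "Z \<in> add_objects C V" and T: "T \<in> Obj C"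
  shows "Z \<in> perp C T"
proof -
  have ZO: "Z \<in> Obj C" and ZV: "sum_through C V Z Z (Ident C Z)" using Z add_objects_iff by auto
  have "x = MZero C T Z" if x: "x \<in> Hom C T Z" for x
  proof -
    have "k \<cdot> x = MZero C T Z" if "sum_through C V Z Z k" for k
      using that
    proof induction
      case zero
      show ?case using zero_Cmp[OF x ZO] .
    next
      case (step k a b)
      have "a \<cdot> x = MZero C T V" using V perp_iff[OF T] Cmp_Hom[OF x step.hyps(2)] by blast
      then show ?case
        using Cmp_add_left[OF x sum_through_Hom[OF step.hyps(1) ZO ZO] Cmp_Hom[OF step.hyps(2,3)]]
          Cmp_assoc[OF x step.hyps(2,3)] step.IH Cmp_zero[OF step.hyps(3) T]
          add_zero[OF zero_Hom[OF T ZO]] by simp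
    qed
    from this[OF ZV] show ?thesis using Ident_left[OF x] by simp
  qed
  then show ?thesis using perp_iff[OF T] ZO by blast
qed

lemma perp_from_add_objects:
  assumes D: "D \<in> add_objects C T" and Z: "Z \<in> perp C T" and T: "T \<in> Obj C" and x: "x \<in> Hom C D Z"
  shows "x = MZero C D Z"
  using add_objects_epi[OF D x] Z Cmp_Hom[OF _ x] unfolding perp_iff[OF T] by blast

end

section \<open>Weak equivalences, fibrations and the homotopy relations\<close>

context category
begin

lemma surj_from_Ident: "X \<in> Obj C \<Longrightarrow> surj_from V (Ident C X)"
  using split_surj_from[OF Ident_Hom Ident_Hom] Ident_left[OF Ident_Hom] by blast

lemma surj_from_Cmp:
  assumes f: "f \<in> Hom C X Y" and g: "g \<in> Hom C Y Z" and sf: "surj_from V f" and sg: "surj_from V g"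
  shows "surj_from V (g \<cdot> f)"
proof (rule surj_fromI[OF Cmp_Hom[OF f g]])
  fix z assume "z \<in> Hom C V Z"
  then obtain y where y: "y \<in> Hom C V Y" "g \<cdot> y = z" using surj_fromE[OF sg g] by blast
  obtain x where x: "x \<in> Hom C V X" "f \<cdot> x = y" using surj_fromE[OF sf f y(1)] .
  show "\<exists>x \<in> Hom C V X. g \<cdot> f \<cdot> x = z" using x y(2) Cmp_assoc[OF x(1) f g] by auto
qed

lemma surj_from_left:
  assumes f: "f \<in> Hom C X Y" and g: "g \<in> Hom C Y Z" and s: "surj_from V (g \<cdot> f)"
  shows "surj_from V g"
proof (rule surj_fromI[OF g])
  fix z assume "z \<in> Hom C V Z"
  then obtain x where x: "x \<in> Hom C V X" "g \<cdot> f \<cdot> x = z"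
    using surj_fromE[OF s Cmp_Hom[OF f g]] by blast
  then show "\<exists>y \<in> Hom C V Y. g \<cdot> y = z" using Cmp_assoc[OF x(1) f g] Cmp_Hom[OF x(1) f] by auto
qed

lemma surj_from_right:
  assumes f: "f \<in> Hom C X Y" and g: "g \<in> Hom C Y Z" and s: "surj_from V (g \<cdot> f)"
    and i: "inj_from V g"
  shows "surj_from V f"
proof (rule surj_fromI[OF f])
  fix y assume y: "y \<in> Hom C V Y"
  obtain x where x: "x \<in> Hom C V X" "g \<cdot> f \<cdot> x = g \<cdot> y"
    using surj_fromE[OF s Cmp_Hom[OF f g] Cmp_Hom[OF y g]] .
  then show "\<exists>x \<in> Hom C V X. f \<cdot> x = y"
    using Cmp_assoc[OF x(1) f g] inj_fromD[OF i g Cmp_Hom[OF x(1) f] y] by auto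
qed

lemma surj_from_retract:
  assumes g: "surj_from V g" and fg: "retract_of C f g"
  shows "surj_from V f"
proof -
  obtain X Y X' Y' i r j s where f': "f \<in> Hom C X Y" and g': "g \<in> Hom C X' Y'"
    and i: "i \<in> Hom C X X'" and r: "r \<in> Hom C X' X" and j: "j \<in> Hom C Y Y'" and s: "s \<in> Hom C Y' Y"
    and ri: "r \<cdot> i = Ident C X" and sj: "s \<cdot> j = Ident C Y"
    and gi: "g \<cdot> i = j \<cdot> f" and fr: "f \<cdot> r = s \<cdot> g"
    using fg by (rule retract_ofE)
  show ?thesis
  proof (rule surj_fromI[OF f'])
    fix y assume y: "y \<in> Hom C V Y"
    obtain x where x: "x \<in> Hom C V X'" "g \<cdot> x = j \<cdot> y" using surj_fromE[OF g g' Cmp_Hom[OF y j]] .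
    have "f \<cdot> (r \<cdot> x) = y"
      using Cmp_assoc[OF x(1) r f'] fr Cmp_assoc[OF x(1) g' s] x(2) Cmp_assoc[OF y j s] sj
        Ident_left[OF y] by simp
    then show "\<exists>x \<in> Hom C V X. f \<cdot> x = y" using Cmp_Hom[OF x(1) r] by blast
  qed
qed

lemma inj_from_Ident: "X \<in> Obj C \<Longrightarrow> inj_from V (Ident C X)"
  by (rule inj_fromI[OF Ident_Hom]) (simp_all add: Ident_left)

lemma inj_from_Cmp:
  assumes f: "f \<in> Hom C X Y" and g: "g \<in> Hom C Y Z" and "inj_from V f" and "inj_from V g"
  shows "inj_from V (g \<cdot> f)"
proof (rule inj_fromI[OF Cmp_Hom[OF f g]])
  fix x x' assume x: "x \<in> Hom C V X" "x' \<in> Hom C V X" and eq: "g \<cdot> f \<cdot> x = g \<cdot> f \<cdot> x'"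
  have "f \<cdot> x = f \<cdot> x'"
    using inj_fromD[OF assms(4) g Cmp_Hom[OF x(1) f] Cmp_Hom[OF x(2) f]]
      Cmp_assoc[OF x(1) f g] Cmp_assoc[OF x(2) f g] eq by simp
  then show "x = x'" using inj_fromD[OF assms(3) f x] by simp
qed

lemma inj_from_right:
  assumes f: "f \<in> Hom C X Y" and g: "g \<in> Hom C Y Z" and "inj_from V (g \<cdot> f)"
  shows "inj_from V f"
proof (rule inj_fromI[OF f])
  fix x x' assume x: "x \<in> Hom C V X" "x' \<in> Hom C V X" and eq: "f \<cdot> x = f \<cdot> x'"
  show "x = x'"
    using inj_fromD[OF assms(3) Cmp_Hom[OF f g] x] Cmp_assoc[OF x(1) f g] Cmp_assoc[OF x(2) f g] eq
    by simp
qed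

lemma inj_from_left:
  assumes f: "f \<in> Hom C X Y" and g: "g \<in> Hom C Y Z" and i: "inj_from V (g \<cdot> f)"
    and s: "surj_from V f"
  shows "inj_from V g"
proof (rule inj_fromI[OF g])
  fix y y' assume y: "y \<in> Hom C V Y" "y' \<in> Hom C V Y" and eq: "g \<cdot> y = g \<cdot> y'"
  obtain x where x: "x \<in> Hom C V X" "f \<cdot> x = y" using surj_fromE[OF s f y(1)] .
  obtain x' where x': "x' \<in> Hom C V X" "f \<cdot> x' = y'" using surj_fromE[OF s f y(2)] .
  have "x = x'"
    using inj_fromD[OF i Cmp_Hom[OF f g] x(1) x'(1)] Cmp_assoc[OF x(1) f g] Cmp_assoc[OF x'(1) f g]
      x(2) x'(2) eq by simp
  then show "y = y'" using x(2) x'(2) by simp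
qed

lemma inj_from_retract:
  assumes g: "inj_from V g" and fg: "retract_of C f g"
  shows "inj_from V f"
proof -
  obtain X Y X' Y' i r j s where f': "f \<in> Hom C X Y" and g': "g \<in> Hom C X' Y'"
    and i: "i \<in> Hom C X X'" and r: "r \<in> Hom C X' X" and j: "j \<in> Hom C Y Y'" and s: "s \<in> Hom C Y' Y"
    and ri: "r \<cdot> i = Ident C X" and sj: "s \<cdot> j = Ident C Y"
    and gi: "g \<cdot> i = j \<cdot> f" and fr: "f \<cdot> r = s \<cdot> g"
    using fg by (rule retract_ofE)
  have "inj_from V (Ident C X)" using inj_from_Ident Hom_Obj[OF i] by blast
  then have "inj_from V i" using inj_from_right[OF i r] ri by simp
  then have "inj_from V (j \<cdot> f)" using inj_from_Cmp[OF i g' _ g] gi by simp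
  then show ?thesis using inj_from_right[OF f' j] by simp
qed

lemma pullbackD:
  assumes pb: "is_pullback C p e P p' e'" and p: "p \<in> Hom C X Y"
  obtains Z where "e \<in> Hom C Z Y" "p' \<in> Hom C P Z" "e' \<in> Hom C P X" "p \<cdot> e' = e \<cdot> p'"
    "\<forall>Q. \<forall>a \<in> Hom C Q X. \<forall>b \<in> Hom C Q Z. p \<cdot> a = e \<cdot> b \<longrightarrow>
      (\<exists>!u. u \<in> Hom C Q P \<and> e' \<cdot> u = a \<and> p' \<cdot> u = b)"
proof (rule that[of "Dom C e"])
  show "e \<in> Hom C (Dom C e) Y" "p' \<in> Hom C P (Dom C e)" "e' \<in> Hom C P X" "p \<cdot> e' = e \<cdot> p'"
    using pb Hom_Dom[OF p] Hom_Cod[OF p] Arr_Hom[of e] unfolding is_pullback_def by auto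
  show "\<forall>Q. \<forall>a \<in> Hom C Q X. \<forall>b \<in> Hom C Q (Dom C e). p \<cdot> a = e \<cdot> b \<longrightarrow>
      (\<exists>!u. u \<in> Hom C Q P \<and> e' \<cdot> u = a \<and> p' \<cdot> u = b)"
    using pb unfolding is_pullback_def Hom_Dom[OF p] by blast
qed

lemma pullback_surj_from:
  assumes pb: "is_pullback C p e P p' e'" and p: "p \<in> Hom C X Y" and s: "surj_from V p"
  shows "surj_from V p'"
proof -
  obtain Z where e: "e \<in> Hom C Z Y" and p': "p' \<in> Hom C P Z" and e': "e' \<in> Hom C P X"
    and "p \<cdot> e' = e \<cdot> p'"
    and univ: "\<forall>Q. \<forall>a \<in> Hom C Q X. \<forall>b \<in> Hom C Q Z. p \<cdot> a = e \<cdot> b \<longrightarrow>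
      (\<exists>!u. u \<in> Hom C Q P \<and> e' \<cdot> u = a \<and> p' \<cdot> u = b)"
    using pullbackD[OF pb p] .
  show ?thesis
  proof (rule surj_fromI[OF p'])
    fix z assume z: "z \<in> Hom C V Z"
    obtain x where "x \<in> Hom C V X" "p \<cdot> x = e \<cdot> z" using surj_fromE[OF s p Cmp_Hom[OF z e]] .
    then show "\<exists>x \<in> Hom C V P. p' \<cdot> x = z" using univ z by blast
  qed
qed

lemma pullback_inj_from:
  assumes pb: "is_pullback C p e P p' e'" and p: "p \<in> Hom C X Y" and i: "inj_from V p"
  shows "inj_from V p'"
proof -
  obtain Z where e: "e \<in> Hom C Z Y" and p': "p' \<in> Hom C P Z" and e': "e' \<in> Hom C P X"
    and eq: "p \<cdot> e' = e \<cdot> p'"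
    and univ: "\<forall>Q. \<forall>a \<in> Hom C Q X. \<forall>b \<in> Hom C Q Z. p \<cdot> a = e \<cdot> b \<longrightarrow>
      (\<exists>!u. u \<in> Hom C Q P \<and> e' \<cdot> u = a \<and> p' \<cdot> u = b)"
    using pullbackD[OF pb p] .
  show ?thesis
  proof (rule inj_fromI[OF p'])
    fix u u' assume u: "u \<in> Hom C V P" "u' \<in> Hom C V P" "p' \<cdot> u = p' \<cdot> u'"
    have *: "p \<cdot> (e' \<cdot> w) = e \<cdot> (p' \<cdot> w)" if "w \<in> Hom C V P" for w
      using Cmp_assoc[OF that e' p] Cmp_assoc[OF that p' e] eq by simp
    have "e' \<cdot> u = e' \<cdot> u'"
      using inj_fromD[OF i p Cmp_Hom[OF u(1) e'] Cmp_Hom[OF u(2) e']] * u by simp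
    moreover have "\<exists>!w. w \<in> Hom C V P \<and> e' \<cdot> w = e' \<cdot> u \<and> p' \<cdot> w = p' \<cdot> u"
      using univ Cmp_Hom[OF u(1) e'] Cmp_Hom[OF u(1) p'] *[OF u(1)] by blast
    ultimately show "u = u'" using u by auto
  qed
qed

end

locale rigid_object = triangulated_category C
  for C :: "('o, 'm, 'x) triangulated_category_scheme" (structure) +
  fixes T :: 'o
  assumes T_Obj: "T \<in> Obj C" and T_rigid: "rigid C T" and T_cf: "contravariantly_finite C T"
begin

lemma shift_perp:
  assumes "S \<in> add_objects C T"
  shows "SObj C S \<in> perp C T"
proof -
  have "SObj C T \<in> perp C T"
    using T_rigid SObj_Obj[OF T_Obj] unfolding rigid_def perp_def by simp
  then show ?thesis using add_objects_perp[OF _ add_objects_SObj[OF assms] T_Obj] by blast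
qed

lemma perp_zero: "\<lbrakk>M \<in> perp C T; D \<in> add_objects C T; x \<in> Hom C D M\<rbrakk> \<Longrightarrow> x = MZero C D M"
  using perp_from_add_objects T_Obj by blast

lemmas T_add = add_objects_self[OF T_Obj]

lemma approximation:
  assumes X: "X \<in> Obj C"
  obtains D p where "D \<in> add_objects C T" "p \<in> Hom C D X" "surj_from T p"
proof -
  obtain D p where D: "D \<in> add_objects C T" "p \<in> Hom C D X"
    and *: "\<forall>D' \<in> add_objects C T. \<forall>q \<in> Hom C D' X. \<exists>r \<in> Hom C D' D. q = p \<cdot> r"
    using T_cf X unfolding contravariantly_finite_def by blast
  have "surj_from T p"
  proof (rule surj_fromI[OF D(2)])
    fix y assume "y \<in> Hom C T X"
    then obtain r where "r \<in> Hom C T D" "y = p \<cdot> r" using * T_add by blast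
    then show "\<exists>x \<in> Hom C T D. p \<cdot> x = y" by auto
  qed
  then show ?thesis using that D by blast
qed

text \<open>The place where rigidity enters: a morphism from \<open>T\<close> to the cone \<open>M\<close> of an approximation vanishes
  in \<open>\<Sigma>D\<close>, so it comes from \<open>X\<close>, hence from \<open>D\<close>, and is therefore zero.\<close>
lemma approximation_triangle:
  assumes X: "X \<in> Obj C"
  obtains D p M m h where "D \<in> add_objects C T" "p \<in> Hom C D X" "m \<in> Hom C X M"
    "h \<in> Hom C M (SObj C D)" "(p, m, h) \<in> Tri C" "M \<in> perp C T"
proof -
  obtain D p where D: "D \<in> add_objects C T" "p \<in> Hom C D X" "surj_from T p"
    using approximation[OF X] .
  obtain M m h where m: "m \<in> Hom C X M" and h: "h \<in> Hom C M (SObj C D)" and t: "(p, m, h) \<in> Tri C"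
    using Tri_ex_first[OF D(2)] .
  have M: "M \<in> Obj C" using Hom_Obj[OF m] by simp
  have "y = MZero C T M" if y: "y \<in> Hom C T M" for y
  proof -
    have "h \<cdot> y = MZero C T (SObj C D)" using perp_zero[OF shift_perp[OF D(1)] T_add Cmp_Hom[OF y h]] .
    then obtain x where x: "x \<in> Hom C T X" "m \<cdot> x = y" using Tri_lift[OF Tri_rotateD[OF t] m h y] by blast
    obtain z where z: "z \<in> Hom C T D" "p \<cdot> z = x" using surj_fromE[OF D(3,2) x(1)] .
    show ?thesis
      using x z Cmp_assoc[OF z(1) D(2) m] Tri_comp_zero[OF t D(2) m] zero_Cmp[OF z(1) M] by simp
  qed
  then have "M \<in> perp C T" using perp_iff[OF T_Obj] M by blast
  then show ?thesis using that D m h t by blast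
qed

text \<open>The ideal \<open>(T\<^sup>\<bottom>)\<close> is the kernel of \<open>C(T,-)\<close>: every morphism that it kills
  factors through the cone of an approximation of the source.\<close>
lemma factors_through_perp_iff:
  assumes f: "f \<in> Hom C X Y"
  shows "factors_through C f (perp C T) \<longleftrightarrow> (\<forall>x \<in> Hom C T X. f \<cdot> x = MZero C T Y)"
proof
  assume "factors_through C f (perp C T)"
  then obtain P a b where P: "P \<in> perp C T" "a \<in> Hom C X P" "b \<in> Hom C P Y" "f = b \<cdot> a"
    unfolding factors_through_def Hom_Dom[OF f] Hom_Cod[OF f] by blast
  show "\<forall>x \<in> Hom C T X. f \<cdot> x = MZero C T Y"
  proof
    fix x assume x: "x \<in> Hom C T X"
    show "f \<cdot> x = MZero C T Y"
      using perp_zero[OF P(1) T_add Cmp_Hom[OF x P(2)]] P(4) Cmp_assoc[OF x P(2,3)]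
        Cmp_zero[OF P(3) T_Obj] by simp
  qed
next
  assume z: "\<forall>x \<in> Hom C T X. f \<cdot> x = MZero C T Y"
  have X: "X \<in> Obj C" and Y: "Y \<in> Obj C" using Hom_Obj[OF f] by auto
  obtain D p M m h where D: "D \<in> add_objects C T" and p: "p \<in> Hom C D X" and m: "m \<in> Hom C X M"
    and t: "(p, m, h) \<in> Tri C" and M: "M \<in> perp C T" using approximation_triangle[OF X] .
  have "f \<cdot> p = MZero C D Y"
  proof (rule add_objects_epi[OF D Cmp_Hom[OF p f]])
    fix b assume b: "b \<in> Hom C T D"
    show "f \<cdot> p \<cdot> b = MZero C T Y" using z Cmp_Hom[OF b p] Cmp_assoc[OF b p f] by simp
  qed
  then obtain b where b: "b \<in> Hom C M Y" "b \<cdot> m = f" using Tri_extend[OF t p m f] by blast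
  show "factors_through C f (perp C T)"
    unfolding factors_through_def Hom_Dom[OF f] Hom_Cod[OF f] using b m M Hom_Arr[OF f] by blast
qed

text \<open>The morphisms that become bijective under \<open>C(T,-)\<close>. Two out of three and stability under retracts
  are immediate from this description, which agrees with the one by triangles by \<open>weqT_eq\<close>.\<close>
definition weq :: "'m set" where
  "weq = {f \<in> Arr C. surj_from T f \<and> inj_from T f}"

lemma weqI: "\<lbrakk>f \<in> Hom C X Y; surj_from T f; inj_from T f\<rbrakk> \<Longrightarrow> f \<in> weq"
  unfolding weq_def using Hom_Arr by blast

lemma weqD: "f \<in> weq \<Longrightarrow> surj_from T f" "f \<in> weq \<Longrightarrow> inj_from T f"
  unfolding weq_def by auto

lemma weq_cmp: "\<lbrakk>f \<in> Hom C X Y; g \<in> Hom C Y Z; f \<in> weq; g \<in> weq\<rbrakk> \<Longrightarrow> g \<cdot> f \<in> weq"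
  using weqI[OF Cmp_Hom surj_from_Cmp inj_from_Cmp] weqD by blast

lemma weq_left: "\<lbrakk>f \<in> Hom C X Y; g \<in> Hom C Y Z; f \<in> weq; g \<cdot> f \<in> weq\<rbrakk> \<Longrightarrow> g \<in> weq"
  using weqI[OF _ surj_from_left inj_from_left] weqD by blast

lemma weq_right: "\<lbrakk>f \<in> Hom C X Y; g \<in> Hom C Y Z; g \<in> weq; g \<cdot> f \<in> weq\<rbrakk> \<Longrightarrow> f \<in> weq"
  using weqI[OF _ surj_from_right inj_from_right] weqD by blast

lemma weq_stable: "stable_class C weq"
proof -
  have "Ident C X \<in> weq" if "X \<in> Obj C" for X
    using weqI[OF Ident_Hom surj_from_Ident inj_from_Ident] that by blast
  moreover have "g \<cdot> f \<in> weq" if "f \<in> weq" "g \<in> weq" "Cod C f = Dom C g" for f g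
    using weq_cmp[OF Arr_Hom] Arr_Hom[of g] that unfolding weq_def by simp
  moreover have "f \<in> weq" if "g \<in> weq" "retract_of C f g" for f g
    using surj_from_retract[OF _ that(2)] inj_from_retract[OF _ that(2)] that
    unfolding weq_def retract_of_def by blast
  ultimately show ?thesis unfolding stable_class_def by blast
qed

text \<open>By exactness, in a triangle \<open>(g, f, h)\<close> the morphism \<open>g\<close> is killed by \<open>C(T,-)\<close> iff \<open>C(T,f)\<close> is
  injective, and \<open>h\<close> is killed iff \<open>C(T,f)\<close> is surjective.\<close>
lemma weqT_eq: "weqT C T = weq"
proof (intro equalityI subsetI)
  fix f assume f: "f \<in> weqT C T"
  then have f': "f \<in> Hom C (Dom C f) (Cod C f)" using Arr_Hom unfolding weqT_def by blast
  define X Y where "X = Dom C f" and "Y = Cod C f"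
  have fH: "f \<in> Hom C X Y" using f' X_def Y_def by simp
  obtain Z g h where g: "g \<in> Hom C Z X" and h: "h \<in> Hom C Y (SObj C Z)" and t: "(g, f, h) \<in> Tri C"
    using Tri_ex_second[OF fH] .
  have g0: "\<forall>x \<in> Hom C T Z. g \<cdot> x = MZero C T X" and h0: "\<forall>x \<in> Hom C T Y. h \<cdot> x = MZero C T (SObj C Z)"
    using f t factors_through_perp_iff[OF g] factors_through_perp_iff[OF h] unfolding weqT_def by blast+
  have "surj_from T f"
    using surj_fromI[OF fH] Tri_lift[OF Tri_rotateD[OF t] fH h] h0 by blast
  moreover have "inj_from T f"
    using inj_from_zeroI[OF fH T_Obj] Tri_lift[OF t g fH] g0 by metis
  ultimately show "f \<in> weq" using weqI[OF fH] by blast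
next
  fix f assume f: "f \<in> weq"
  have "factors_through C g (perp C T) \<and> factors_through C h (perp C T)" if t: "(g, f, h) \<in> Tri C" for g h
  proof -
    obtain Z X Y where g: "g \<in> Hom C Z X" and fH: "f \<in> Hom C X Y" and h: "h \<in> Hom C Y (SObj C Z)"
      using TriE[OF t] .
    have O: "Y \<in> Obj C" "SObj C Z \<in> Obj C" using Hom_Obj[OF h] by auto
    have "g \<cdot> x = MZero C T X" if x: "x \<in> Hom C T Z" for x
      using inj_from_zeroD[OF weqD(2)[OF f] fH Cmp_Hom[OF x g]] Cmp_assoc[OF x g fH]
        Tri_comp_zero[OF t g fH] zero_Cmp[OF x O(1)] by simp
    moreover have "h \<cdot> y = MZero C T (SObj C Z)" if y: "y \<in> Hom C T Y" for y
    proof -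
      obtain x where x: "x \<in> Hom C T X" "f \<cdot> x = y" using surj_fromE[OF weqD(1)[OF f] fH y] .
      show ?thesis
        using x(2) Cmp_assoc[OF x(1) fH h] Tri_comp_zero2[OF t fH h] zero_Cmp[OF x(1) O(2)] by simp
    qed
    ultimately show ?thesis using factors_through_perp_iff[OF g] factors_through_perp_iff[OF h] by blast
  qed
  then show "f \<in> weqT C T" using f unfolding weqT_def weq_def by blast
qed

lemma biproduct_perp_weq:
  assumes b: "biproduct C X M S i j p q" and M: "M \<in> perp C T"
  shows "i \<in> weq" and "p \<in> weq"
proof -
  note bD = biproductD[OF b]
  have q: "q \<cdot> x = MZero C T M" if "x \<in> Hom C T S" for x
    using perp_zero[OF M T_add Cmp_Hom[OF that bD(4)]] .
  show p: "p \<in> weq"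
  proof (rule weqI[OF bD(3) split_surj_from[OF bD(3,1,5)] inj_fromI[OF bD(3)]])
    fix x x' assume x: "x \<in> Hom C T S" "x' \<in> Hom C T S" "p \<cdot> x = p \<cdot> x'"
    then show "x = x'" using biproduct_pair_unique[OF b] q by simp
  qed
  have "Ident C X \<in> weq" using weq_stable bD(10) unfolding stable_class_def by blast
  then show "i \<in> weq" using weq_right[OF bD(1,3) p] bD(5) by simp
qed

lemma agree_on_T_factor:
  assumes f: "f \<in> Hom C X Y" and g: "g \<in> Hom C X Y" and eq: "\<forall>x \<in> Hom C T X. f \<cdot> x = g \<cdot> x"
  obtains M a b where "M \<in> perp C T" "a \<in> Hom C X M" "b \<in> Hom C M Y" "g \<boxplus> (b \<cdot> a) = f"
proof -
  note d = diff_Hom[OF f g]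
  have "MDiff C f g \<cdot> x = MZero C T Y" if x: "x \<in> Hom C T X" for x
    using diff_Cmp[OF f g x] eq x diff_self[OF Cmp_Hom[OF x g]] by simp
  then have "factors_through C (MDiff C f g) (perp C T)" using factors_through_perp_iff[OF d] by blast
  then obtain M a b where "M \<in> perp C T" "a \<in> Hom C X M" "b \<in> Hom C M Y" "MDiff C f g = b \<cdot> a"
    unfolding factors_through_def Hom_Dom[OF d] Hom_Cod[OF d] by blast
  then show ?thesis using that add_diff(1)[OF f g] by simp
qed

text \<open>The two ends of a cylinder are sections of \<open>w\<close> and \<open>C(T,w)\<close> is bijective, so the ends agree on
  \<open>T\<close>, and with them any two left homotopic morphisms.
  Conversely, if the difference is \<open>b a\<close> through \<open>M \<in> T\<^sup>\<bottom>\<close>, then \<open>X \<oplus> M\<close>, with ends \<open>(1, a)\<close> and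
  \<open>(1, 0)\<close>, is a cylinder object and \<open>[g b]\<close> a homotopy from \<open>g + b a\<close> to \<open>g\<close>.\<close>
lemma left_homotopic_iff:
  assumes f: "f \<in> Hom C X Y" and g: "g \<in> Hom C X Y"
  shows "left_homotopic C weq f g \<longleftrightarrow> (\<forall>x \<in> Hom C T X. f \<cdot> x = g \<cdot> x)"
proof
  assume "left_homotopic C weq f g"
  then obtain P s t i w H where cyl: "cylinder_object C weq X P s t i w"
    and H: "H \<in> Hom C (Cod C i) Y" "H \<cdot> i \<cdot> s = f" "H \<cdot> i \<cdot> t = g"
    unfolding left_homotopic_def Hom_Dom[OF f] Hom_Cod[OF f] by blast
  have st: "s \<in> Hom C X P" "t \<in> Hom C X P" and w: "w \<in> Hom C (Cod C i) X" "w \<in> weq"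
    and wst: "w \<cdot> i \<cdot> s = Ident C X" "w \<cdot> i \<cdot> t = Ident C X" and i': "i \<in> Hom C P (Dom C w)"
    using cyl unfolding cylinder_object_def is_coproduct_def by blast+
  have i: "i \<in> Hom C P (Cod C i)" using i' Hom_Dom[OF w(1)] by simp
  have is_: "i \<cdot> s \<in> Hom C X (Cod C i)" "i \<cdot> t \<in> Hom C X (Cod C i)" using Cmp_Hom st i by blast+
  have wis: "w \<cdot> (i \<cdot> s) = Ident C X" "w \<cdot> (i \<cdot> t) = Ident C X"
    using wst Cmp_assoc[OF st(1) i w(1)] Cmp_assoc[OF st(2) i w(1)] by auto
  show "\<forall>x \<in> Hom C T X. f \<cdot> x = g \<cdot> x"
  proof
    fix x assume x: "x \<in> Hom C T X"
    have "i \<cdot> s \<cdot> x = i \<cdot> t \<cdot> x"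
      using inj_fromD[OF weqD(2)[OF w(2)] w(1) Cmp_Hom[OF x is_(1)] Cmp_Hom[OF x is_(2)]]
        Cmp_assoc[OF x is_(1) w(1)] Cmp_assoc[OF x is_(2) w(1)] wis by simp
    moreover have "f \<cdot> x = H \<cdot> (i \<cdot> s \<cdot> x)"
      using H(2) Cmp_assoc[OF st(1) i H(1)] Cmp_assoc[OF x is_(1) H(1)] by simp
    moreover have "g \<cdot> x = H \<cdot> (i \<cdot> t \<cdot> x)"
      using H(3) Cmp_assoc[OF st(2) i H(1)] Cmp_assoc[OF x is_(2) H(1)] by simp
    ultimately show "f \<cdot> x = g \<cdot> x" by simp
  qed
next
  assume eq: "\<forall>x \<in> Hom C T X. f \<cdot> x = g \<cdot> x"
  obtain M a b where M: "M \<in> perp C T" and a: "a \<in> Hom C X M" and b: "b \<in> Hom C M Y"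
    and fgb: "g \<boxplus> (b \<cdot> a) = f" using agree_on_T_factor[OF f g eq] .
  have X: "X \<in> Obj C" and MO: "M \<in> Obj C" using Hom_Obj[OF a] by auto
  obtain S i j p q where S: "biproduct C X M S i j p q" using ex_biproduct[OF X MO] .
  obtain P s t s' t' where P: "biproduct C X X P s t s' t'" using ex_biproduct[OF X X] .
  note SD = biproductD[OF S] and PD = biproductD[OF P]
  note ja = Cmp_Hom[OF a SD(2)]
  note l = add_Hom[OF SD(1) ja]
  obtain c where c: "c \<in> Hom C P S" "c \<cdot> s = i \<boxplus> (j \<cdot> a)" "c \<cdot> t = i"
    using biproduct_copair[OF P l SD(1)] by blast
  obtain H where H: "H \<in> Hom C S Y" "H \<cdot> i = g" "H \<cdot> j = b" using biproduct_copair[OF S g b] by blast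
  have "p \<cdot> (i \<boxplus> (j \<cdot> a)) = Ident C X"
    using Cmp_add_right[OF SD(1) ja SD(3)] Cmp_assoc[OF a SD(2,3)] SD(5,7) zero_Cmp[OF a X]
      add_zero[OF Ident_Hom[OF X]] by simp
  then have "p \<cdot> c \<cdot> s = Ident C X" using Cmp_assoc[OF PD(1) c(1) SD(3)] c(2) by simp
  moreover have "p \<cdot> c \<cdot> t = Ident C X" using Cmp_assoc[OF PD(2) c(1) SD(3)] c(3) SD(5) by simp
  ultimately have cyl: "cylinder_object C weq X P s t c p"
    unfolding cylinder_object_def Hom_Dom[OF SD(3)] Hom_Cod[OF c(1)]
    using c(1) SD(3) biproduct_perp_weq(2)[OF S M] biproduct_is_coproduct[OF P] by blast
  have "H \<cdot> (i \<boxplus> (j \<cdot> a)) = f"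
    using Cmp_add_right[OF SD(1) ja H(1)] Cmp_assoc[OF a SD(2) H(1)] H fgb by simp
  then have "H \<cdot> c \<cdot> s = f" "H \<cdot> c \<cdot> t = g"
    using Cmp_assoc[OF PD(1) c(1) H(1)] Cmp_assoc[OF PD(2) c(1) H(1)] c H(2) by simp_all
  then show "left_homotopic C weq f g"
    unfolding left_homotopic_def Hom_Dom[OF f] Hom_Cod[OF f]
    using cyl H(1) Hom_Cod[OF c(1)] Hom_Arr[OF f] g by metis
qed

text \<open>Dual to the previous lemma: \<open>Y \<oplus> M\<close> with projections \<open>[1 b]\<close> and \<open>[1 0]\<close> is a path object, and
  \<open>(g, a)\<close> is a homotopy.\<close>
lemma right_homotopic_iff:
  assumes f: "f \<in> Hom C X Y" and g: "g \<in> Hom C X Y"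
  shows "right_homotopic C weq f g \<longleftrightarrow> (\<forall>x \<in> Hom C T X. f \<cdot> x = g \<cdot> x)"
proof
  assume "right_homotopic C weq f g"
  then obtain P s t w p K where path: "path_object C weq Y P s t w p"
    and K: "K \<in> Hom C X (Dom C p)" "s \<cdot> (p \<cdot> K) = f" "t \<cdot> (p \<cdot> K) = g"
    unfolding right_homotopic_def Hom_Dom[OF f] Hom_Cod[OF f] by blast
  have st: "s \<in> Hom C P Y" "t \<in> Hom C P Y" and w: "w \<in> Hom C Y (Dom C p)" "w \<in> weq"
    and stw: "s \<cdot> (p \<cdot> w) = Ident C Y" "t \<cdot> (p \<cdot> w) = Ident C Y" and p': "p \<in> Hom C (Cod C w) P"
    using path unfolding path_object_def is_product_def by blast+
  have p: "p \<in> Hom C (Dom C p) P" using p' Hom_Cod[OF w(1)] by simp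
  show "\<forall>x \<in> Hom C T X. f \<cdot> x = g \<cdot> x"
  proof
    fix x assume x: "x \<in> Hom C T X"
    obtain y where y: "y \<in> Hom C T Y" "w \<cdot> y = K \<cdot> x"
      using surj_fromE[OF weqD(1)[OF w(2)] w(1) Cmp_Hom[OF x K(1)]] .
    have *: "r \<cdot> (p \<cdot> K) \<cdot> x = y" if r: "r \<in> Hom C P Y" "r \<cdot> (p \<cdot> w) = Ident C Y" for r
    proof -
      have "r \<cdot> (p \<cdot> K) \<cdot> x = r \<cdot> (p \<cdot> (w \<cdot> y))"
        using Cmp_assoc[OF x Cmp_Hom[OF K(1) p] r(1)] Cmp_assoc[OF x K(1) p] y(2) by simp
      also have "\<dots> = r \<cdot> (p \<cdot> w) \<cdot> y"
        using Cmp_assoc[OF y(1) w(1) p] Cmp_assoc[OF y(1) Cmp_Hom[OF w(1) p] r(1)] by simp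
      finally show ?thesis using r(2) Ident_left[OF y(1)] by simp
    qed
    show "f \<cdot> x = g \<cdot> x" using *[OF st(1) stw(1)] *[OF st(2) stw(2)] K by simp
  qed
next
  assume eq: "\<forall>x \<in> Hom C T X. f \<cdot> x = g \<cdot> x"
  obtain M a b where M: "M \<in> perp C T" and a: "a \<in> Hom C X M" and b: "b \<in> Hom C M Y"
    and fgb: "g \<boxplus> (b \<cdot> a) = f" using agree_on_T_factor[OF f g eq] .
  have Y: "Y \<in> Obj C" and MO: "M \<in> Obj C" using Hom_Obj[OF b] by auto
  obtain S i j p q where S: "biproduct C Y M S i j p q" using ex_biproduct[OF Y MO] .
  obtain P s' t' s t where P: "biproduct C Y Y P s' t' s t" using ex_biproduct[OF Y Y] .
  note SD = biproductD[OF S] and PD = biproductD[OF P]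
  obtain e where e: "e \<in> Hom C S Y" "e \<cdot> i = Ident C Y" "e \<cdot> j = b"
    using biproduct_copair[OF S Ident_Hom[OF Y] b] by blast
  obtain c where c: "c \<in> Hom C S P" "s \<cdot> c = e" "t \<cdot> c = p" using biproduct_pair[OF P e(1) SD(3)] by blast
  note ig = Cmp_Hom[OF g SD(1)] and ja = Cmp_Hom[OF a SD(2)]
  let ?K = "i \<cdot> g \<boxplus> j \<cdot> a"
  have K: "?K \<in> Hom C X S" using add_Hom[OF ig ja] .
  have "e \<cdot> ?K = f"
    using Cmp_add_right[OF ig ja e(1)] Cmp_assoc[OF g SD(1) e(1)] Cmp_assoc[OF a SD(2) e(1)] e
      Ident_left[OF g] fgb by simp
  then have 1: "s \<cdot> (c \<cdot> ?K) = f" using Cmp_assoc[OF K c(1) PD(3)] c(2) by simp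
  have "p \<cdot> ?K = g"
    using Cmp_add_right[OF ig ja SD(3)] Cmp_assoc[OF g SD(1,3)] Cmp_assoc[OF a SD(2,3)] SD(5,7)
      Ident_left[OF g] zero_Cmp[OF a Y] add_zero[OF g] by simp
  then have 2: "t \<cdot> (c \<cdot> ?K) = g" using Cmp_assoc[OF K c(1) PD(4)] c(3) by simp
  have "s \<cdot> (c \<cdot> i) = Ident C Y" "t \<cdot> (c \<cdot> i) = Ident C Y"
    using Cmp_assoc[OF SD(1) c(1) PD(3)] Cmp_assoc[OF SD(1) c(1) PD(4)] c e(2) SD(5) by simp_all
  then have "path_object C weq Y P s t i c"
    unfolding path_object_def Hom_Dom[OF c(1)] Hom_Cod[OF SD(1)]
    using c(1) SD(1) biproduct_perp_weq(1)[OF S M] biproduct_is_product[OF P] by blast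
  then show "right_homotopic C weq f g"
    unfolding right_homotopic_def Hom_Dom[OF f] Hom_Cod[OF f]
    using K 1 2 Hom_Dom[OF c(1)] Hom_Arr[OF f] g by metis
qed

end

section \<open>Trivial fibrations and the objects of \<open>T \<ast> \<Sigma>T\<close>\<close>

context rigid_object
begin

definition fib :: "'m set" where
  "fib = {f \<in> Arr C. surj_from (SObj C T) f}"

text \<open>Projectivity with respect to the trivial fibrations. This will describe both the cofibrant objects
  and the objects of \<open>T \<ast> \<Sigma>T\<close>.\<close>
definition projective :: "'o \<Rightarrow> bool" where
  "projective A \<longleftrightarrow> A \<in> Obj C \<and> (\<forall>p \<in> weq \<inter> fib. surj_from A p)"

lemma fibI: "\<lbrakk>f \<in> Hom C X Y; surj_from (SObj C T) f\<rbrakk> \<Longrightarrow> f \<in> fib"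
  unfolding fib_def using Hom_Arr by blast

lemma fibD: "f \<in> fib \<Longrightarrow> surj_from (SObj C T) f"
  unfolding fib_def by auto

lemma fib_stable: "stable_class C fib"
proof -
  have "Ident C X \<in> fib" if "X \<in> Obj C" for X
    using fibI[OF Ident_Hom surj_from_Ident] that by blast
  moreover have "g \<cdot> f \<in> fib" if fg: "f \<in> fib" "g \<in> fib" "Cod C f = Dom C g" for f g
  proof -
    have "f \<in> Hom C (Dom C f) (Cod C f)" "g \<in> Hom C (Cod C f) (Cod C g)"
      using fg Arr_Hom[of f] Arr_Hom[of g] unfolding fib_def by auto
    then show ?thesis using fibI[OF Cmp_Hom surj_from_Cmp] fibD fg by blast
  qed
  moreover have "f \<in> fib" if "g \<in> fib" "retract_of C f g" for f g
    using surj_from_retract[OF _ that(2)] that unfolding fib_def retract_of_def by blast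
  ultimately show ?thesis unfolding stable_class_def by blast
qed

lemma fibT_eq:
  assumes E: "zero_object C E"
  shows "fibT C E T = fib"
proof -
  have ST: "SObj C T \<in> Obj C" using SObj_Obj[OF T_Obj] .
  have EO: "E \<in> Obj C" using zero_objectD(3)[OF E ST] .
  note j = zero_Hom[OF EO ST]
  have "lifts C (MZero C E (SObj C T)) f \<longleftrightarrow> surj_from (SObj C T) f" if f: "f \<in> Arr C" for f
  proof -
    have fH: "f \<in> Hom C (Dom C f) (Cod C f)" using Arr_Hom[OF f] .
    then have O: "Dom C f \<in> Obj C" "Cod C f \<in> Obj C" using Hom_Obj by blast+
    have 1: "f \<cdot> MZero C E (Dom C f) = v \<cdot> MZero C E (SObj C T)"
      if "v \<in> Hom C (SObj C T) (Cod C f)" for v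
      using Cmp_zero[OF fH EO] Cmp_zero[OF that EO] by simp
    have 2: "a \<cdot> MZero C E (SObj C T) = MZero C E (Dom C f)" if "a \<in> Hom C (SObj C T) (Dom C f)" for a
      using Cmp_zero[OF that EO] .
    show ?thesis
      unfolding lifts_def surj_from_def Hom_Dom[OF j] Hom_Cod[OF j] zero_objectD(1)[OF E O(1)]
      using 1 2 by auto
  qed
  then show ?thesis unfolding fibT_def genJ_def rlp_def fib_def by auto
qed

lemma cones_addE:
  assumes "A \<in> cones_add C T"
  obtains R S f g h where "R \<in> add_objects C T" "S \<in> add_objects C T" "f \<in> Hom C R S" "g \<in> Hom C S A"
    "h \<in> Hom C A (SObj C R)" "(f, g, h) \<in> Tri C"
proof -
  obtain R S f g h where RS: "R \<in> add_objects C T" "S \<in> add_objects C T" and f: "f \<in> Hom C R S"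
    and t: "(f, g, h) \<in> Tri C" and g: "Cod C g = A" using assms unfolding cones_add_def by blast
  obtain R' S' A' where H: "f \<in> Hom C R' S'" "g \<in> Hom C S' A'" "h \<in> Hom C A' (SObj C R')"
    using TriE[OF t] .
  have "R' = R" "S' = S" "A' = A"
    using Hom_Dom[OF f] Hom_Cod[OF f] Hom_Dom[OF H(1)] Hom_Cod[OF H(1)] Hom_Cod[OF H(2)] g by auto
  then show ?thesis using that RS H t by blast
qed

lemma cones_addI:
  assumes "R \<in> add_objects C T" "S \<in> add_objects C T" "f \<in> Hom C R S" "g \<in> Hom C S A" "(f, g, h) \<in> Tri C"
  shows "A \<in> cones_add C T"
  using assms Hom_Cod[OF assms(4)] Hom_Obj[OF assms(4)] unfolding cones_add_def by blast

text \<open>For \<open>R \<rightarrow>f S \<rightarrow>g A \<rightarrow>h \<Sigma>R\<close> and \<open>v : A \<rightarrow> Y\<close>, a lift of \<open>v g\<close> kills \<open>f\<close> by injectivity of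
  \<open>C(R,p)\<close>, so it extends to \<open>w' : A \<rightarrow> X\<close>. The error \<open>v - p w'\<close> factors through \<open>\<Sigma>R\<close>, and it lifts
  because \<open>C(\<Sigma>R,p)\<close> is surjective.\<close>
lemma cones_projective:
  assumes A: "A \<in> cones_add C T"
  shows "projective A"
proof -
  obtain R S f g h where R: "R \<in> add_objects C T" and S: "S \<in> add_objects C T" and f: "f \<in> Hom C R S"
    and g: "g \<in> Hom C S A" and h: "h \<in> Hom C A (SObj C R)" and t: "(f, g, h) \<in> Tri C"
    using cones_addE[OF A] .
  have "surj_from A p" if p: "p \<in> weq \<inter> fib" for p
  proof -
    define X Y where "X = Dom C p" and "Y = Cod C p"
    have pH: "p \<in> Hom C X Y" using p Arr_Hom unfolding X_def Y_def fib_def by blast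
    show ?thesis
    proof (rule surj_fromI[OF pH])
      fix v assume v: "v \<in> Hom C A Y"
      have RO: "R \<in> Obj C" and Y: "Y \<in> Obj C" using add_objects_Obj[OF R] Hom_Obj[OF v] by auto
      obtain w where w: "w \<in> Hom C S X" "p \<cdot> w = v \<cdot> g"
        using surj_fromE[OF surj_from_add_objects[OF S pH weqD(1)] pH Cmp_Hom[OF g v]] p by blast
      have "p \<cdot> (w \<cdot> f) = MZero C R Y"
        using Cmp_assoc[OF f w(1) pH] w(2) Cmp_assoc[OF f g v] Tri_comp_zero[OF t f g] Cmp_zero[OF v RO]
        by simp
      moreover have "inj_from R p" using inj_from_add_objects[OF R pH weqD(2)] p by blast
      ultimately have "w \<cdot> f = MZero C R X" using inj_from_zeroD[OF _ pH Cmp_Hom[OF f w(1)]] by blast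
      then obtain w' where w': "w' \<in> Hom C A X" "w' \<cdot> g = w" using Tri_extend[OF t f g w(1)] by blast
      note pw' = Cmp_Hom[OF w'(1) pH]
      note d = diff_Hom[OF v pw']
      have "MDiff C v (p \<cdot> w') \<cdot> g = MZero C S Y"
        using diff_Cmp[OF v pw' g] Cmp_assoc[OF g w'(1) pH] w'(2) w(2) diff_self[OF Cmp_Hom[OF g v]]
        by simp
      then obtain z where z: "z \<in> Hom C (SObj C R) Y" "z \<cdot> h = MDiff C v (p \<cdot> w')"
        using Tri_extend[OF Tri_rotateD[OF t] g h d] by blast
      have "surj_from (SObj C R) p"
        using surj_from_add_objects[OF add_objects_SObj[OF R] pH] fibD p by blast
      then obtain z' where z': "z' \<in> Hom C (SObj C R) X" "p \<cdot> z' = z" using surj_fromE pH z(1) by blast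
      note zh = Cmp_Hom[OF h z'(1)]
      have "p \<cdot> (w' \<boxplus> (z' \<cdot> h)) = v"
        using Cmp_add_right[OF w'(1) zh pH] Cmp_assoc[OF h z'(1) pH] z'(2) z(2) add_diff(1)[OF v pw']
        by simp
      then show "\<exists>x \<in> Hom C A X. p \<cdot> x = v" using add_Hom[OF w'(1) zh] by blast
    qed
  qed
  then show ?thesis unfolding projective_def using Hom_Obj[OF g] by blast
qed

text \<open>Approximate \<open>Y\<close> by \<open>p : S \<rightarrow> Y\<close>, then approximate the cocone \<open>U\<close> of \<open>p\<close> by \<open>u : R \<rightarrow> U\<close>. The cone
  of the composite \<open>R \<rightarrow> U \<rightarrow> S\<close> is a presentation of \<open>Y\<close> as far as \<open>C(T,-)\<close> can see.\<close>
lemma weak_replacement: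
  assumes Y: "Y \<in> Obj C"
  obtains A v where "A \<in> cones_add C T" "v \<in> Hom C A Y" "v \<in> weq"
proof -
  obtain S p where S: "S \<in> add_objects C T" and p: "p \<in> Hom C S Y" and sp: "surj_from T p"
    using approximation[OF Y] .
  obtain U k l where k: "k \<in> Hom C U S" and l: "l \<in> Hom C Y (SObj C U)" and t1: "(k, p, l) \<in> Tri C"
    using Tri_ex_second[OF p] .
  have U: "U \<in> Obj C" using Hom_Obj[OF k] by simp
  obtain R u where R: "R \<in> add_objects C T" and u: "u \<in> Hom C R U" and su: "surj_from T u"
    using approximation[OF U] .
  have RO: "R \<in> Obj C" using add_objects_Obj[OF R] .
  note ku = Cmp_Hom[OF u k]
  obtain A c c' where c: "c \<in> Hom C S A" and c': "c' \<in> Hom C A (SObj C R)" and t2: "(k \<cdot> u, c, c') \<in> Tri C"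
    using Tri_ex_first[OF ku] .
  have AO: "A \<in> Obj C" using Hom_Obj[OF c] by simp
  have "p \<cdot> (k \<cdot> u) = MZero C R Y"
    using Cmp_assoc[OF u k p] Tri_comp_zero[OF t1 k p] zero_Cmp[OF u Y] by simp
  then obtain v where v: "v \<in> Hom C A Y" "v \<cdot> c = p" using Tri_extend[OF t2 ku c p] by blast
  have "surj_from T v" using surj_from_left[OF c v(1)] v(2) sp by simp
  moreover have "inj_from T v"
  proof (rule inj_from_zeroI[OF v(1) T_Obj])
    fix x assume x: "x \<in> Hom C T A" and vx: "v \<cdot> x = MZero C T Y"
    have "c' \<cdot> x = MZero C T (SObj C R)" using perp_zero[OF shift_perp[OF R] T_add Cmp_Hom[OF x c']] .
    then obtain y where y: "y \<in> Hom C T S" "c \<cdot> y = x" using Tri_lift[OF Tri_rotateD[OF t2] c c' x] by blast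
    have "p \<cdot> y = MZero C T Y" using Cmp_assoc[OF y(1) c v(1)] v(2) y(2) vx by simp
    then obtain z where z: "z \<in> Hom C T U" "k \<cdot> z = y" using Tri_lift[OF t1 k p y(1)] by blast
    obtain w where w: "w \<in> Hom C T R" "u \<cdot> w = z" using surj_fromE[OF su u z(1)] .
    have "x = c \<cdot> (k \<cdot> u) \<cdot> w"
      using y(2) z(2) w(2) Cmp_assoc[OF w(1) u k] Cmp_assoc[OF w(1) ku c] by simp
    then show "x = MZero C T A" using Tri_comp_zero[OF t2 ku c] zero_Cmp[OF w(1) AO] by simp
  qed
  ultimately have "v \<in> weq" using weqI[OF v(1)] by blast
  moreover have "A \<in> cones_add C T" using cones_addI[OF R S ku c t2] .
  ultimately show ?thesis using that v(1) by blast
qed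

lemma shift_approximation:
  assumes X: "X \<in> Obj C"
  obtains D q where "D \<in> add_objects C T" "q \<in> Hom C (SObj C D) X" "surj_from (SObj C T) q"
proof -
  obtain Z where Z: "Z \<in> Obj C" "isomorphic C (SObj C Z) X" using SObj_ess_surj[OF X] by blast
  obtain d c where d: "d \<in> Hom C (SObj C Z) X" and c: "c \<in> Hom C X (SObj C Z)"
    and "c \<cdot> d = Ident C (SObj C Z)" and dc: "d \<cdot> c = Ident C X" using isomorphicE[OF Z(2)] .
  obtain D p where D: "D \<in> add_objects C T" and p: "p \<in> Hom C D Z" and sp: "surj_from T p"
    using approximation[OF Z(1)] .
  note sp' = SArr_Hom[OF p]
  have "surj_from (SObj C T) (SArr C p)"
  proof (rule surj_fromI[OF sp'])
    fix y assume "y \<in> Hom C (SObj C T) (SObj C Z)"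
    then obtain y' where y': "y' \<in> Hom C T Z" "SArr C y' = y" using SArr_ex T_Obj Z(1) by blast
    obtain x where x: "x \<in> Hom C T D" "p \<cdot> x = y'" using surj_fromE[OF sp p y'(1)] .
    then show "\<exists>x \<in> Hom C (SObj C T) (SObj C D). SArr C p \<cdot> x = y"
      using SArr_Hom[OF x(1)] SArr_Cmp[OF x(1) p] y'(2) by auto
  qed
  then have "surj_from (SObj C T) (d \<cdot> SArr C p)"
    using surj_from_Cmp[OF sp' d _ split_surj_from[OF d c dc]] by blast
  then show ?thesis using that D Cmp_Hom[OF sp' d] by blast
qed

text \<open>Adding a suitable summand \<open>\<Sigma>D\<close> to the source turns any morphism into a fibration, and changes
  the source only by a weak equivalence.\<close>
lemma fibrant_replacement_of_arrow:
  assumes f: "f \<in> Hom C X Y"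
  obtains D S i j p q m where "D \<in> add_objects C T" "biproduct C X (SObj C D) S i j p q"
    "m \<in> Hom C S Y" "m \<cdot> i = f" "m \<in> fib" "i \<in> weq"
proof -
  have X: "X \<in> Obj C" and Y: "Y \<in> Obj C" using Hom_Obj[OF f] by auto
  obtain D d where D: "D \<in> add_objects C T" and d: "d \<in> Hom C (SObj C D) Y"
    and sd: "surj_from (SObj C T) d" using shift_approximation[OF Y] .
  obtain S i j p q where S: "biproduct C X (SObj C D) S i j p q"
    using ex_biproduct[OF X SObj_Obj[OF add_objects_Obj[OF D]]] .
  obtain m where m: "m \<in> Hom C S Y" "m \<cdot> i = f" "m \<cdot> j = d" using biproduct_copair[OF S f d] by blast
  have "surj_from (SObj C T) m" using surj_from_left[OF biproductD(2)[OF S] m(1)] m(3) sd by simp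
  then show ?thesis using that D S m fibI[OF m(1)] biproduct_perp_weq(1)[OF S shift_perp[OF D]] by blast
qed

lemma projective_biproduct:
  assumes b: "biproduct C X Y S i j p q" and X: "projective X" and Y: "projective Y"
  shows "projective S"
proof -
  have "surj_from S g" if g: "g \<in> weq \<inter> fib" for g
  proof -
    define V W where "V = Dom C g" and "W = Cod C g"
    have gH: "g \<in> Hom C V W" using g Arr_Hom unfolding V_def W_def fib_def by blast
    note bD = biproductD[OF b]
    show ?thesis
    proof (rule surj_fromI[OF gH])
      fix y assume y: "y \<in> Hom C S W"
      obtain a where a: "a \<in> Hom C X V" "g \<cdot> a = y \<cdot> i"
        using surj_fromE[OF _ gH Cmp_Hom[OF bD(1) y]] X g unfolding projective_def by blast
      obtain a' where a': "a' \<in> Hom C Y V" "g \<cdot> a' = y \<cdot> j"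
        using surj_fromE[OF _ gH Cmp_Hom[OF bD(2) y]] Y g unfolding projective_def by blast
      obtain m where m: "m \<in> Hom C S V" "m \<cdot> i = a" "m \<cdot> j = a'" using biproduct_copair[OF b a(1) a'(1)] by blast
      have "g \<cdot> m = y"
        using biproduct_copair_unique[OF b Cmp_Hom[OF m(1) gH] y] Cmp_assoc[OF bD(1) m(1) gH]
          Cmp_assoc[OF bD(2) m(1) gH] m a(2) a'(2) by simp
      then show "\<exists>x \<in> Hom C S V. g \<cdot> x = y" using m(1) by blast
    qed
  qed
  then show ?thesis unfolding projective_def using biproductD(12)[OF b] by blast
qed

lemma shift_projective:
  assumes "D \<in> add_objects C T"
  shows "projective (SObj C D)"
proof -
  have "surj_from (SObj C D) p" if "p \<in> weq \<inter> fib" for p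
    using surj_from_add_objects[OF add_objects_SObj[OF assms] Arr_Hom] fibD that
    unfolding fib_def by blast
  then show ?thesis unfolding projective_def using SObj_Obj[OF add_objects_Obj[OF assms]] by blast
qed

lemma add_projective:
  assumes "D \<in> add_objects C T"
  shows "projective D"
proof -
  have "surj_from D p" if "p \<in> weq \<inter> fib" for p
    using surj_from_add_objects[OF assms Arr_Hom] weqD(1) that unfolding fib_def by blast
  then show ?thesis unfolding projective_def using add_objects_Obj[OF assms] by blast
qed

lemma cofibrant_replacement:
  assumes Y: "Y \<in> Obj C"
  obtains B D S i j p q m where "B \<in> cones_add C T" "D \<in> add_objects C T"
    "biproduct C B (SObj C D) S i j p q" "m \<in> Hom C S Y" "m \<in> weq \<inter> fib" "projective S"
proof -
  obtain B v where B: "B \<in> cones_add C T" and v: "v \<in> Hom C B Y" "v \<in> weq" using weak_replacement[OF Y] .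
  obtain D S i j p q m where D: "D \<in> add_objects C T" and S: "biproduct C B (SObj C D) S i j p q"
    and m: "m \<in> Hom C S Y" "m \<cdot> i = v" "m \<in> fib" "i \<in> weq" using fibrant_replacement_of_arrow[OF v(1)] .
  have "m \<in> weq" using weq_left[OF biproductD(1)[OF S] m(1,4)] m(2) v(2) by simp
  moreover have "projective S" using projective_biproduct[OF S cones_projective[OF B] shift_projective[OF D]] .
  ultimately show ?thesis using that B D S m by blast
qed

text \<open>Take an approximation triangle \<open>D \<rightarrow> A \<rightarrow>m M \<rightarrow> \<Sigma>D\<close>; it suffices to show \<open>M \<in> add \<Sigma>T\<close>. A
  cofibrant replacement \<open>n : S \<rightarrow> A\<close> with \<open>S = B \<oplus> \<Sigma>D'\<close> splits. On \<open>B\<close>, the cone of a morphism in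
  \<open>add T\<close>, the composite to \<open>M\<close> factors through a suspension, so \<open>m\<close> itself is a sum of morphisms
  through \<open>\<Sigma>T\<close>. Since \<open>C(D,\<Sigma>T) = 0\<close>, such a sum has the form \<open>k m\<close> with \<open>k : M \<rightarrow> M\<close> again a sum
  through \<open>\<Sigma>T\<close>, and \<open>(1 - k) m = 0\<close>, so \<open>1 - k\<close> factors through \<open>\<Sigma>D\<close>. Hence the identity of \<open>M\<close> is a
  sum through \<open>\<Sigma>T\<close>.\<close>
lemma projective_cones:
  assumes A: "projective A"
  shows "A \<in> cones_add C T"
proof -
  have AO: "A \<in> Obj C" using A unfolding projective_def by blast
  obtain D a M m h where D: "D \<in> add_objects C T" and a: "a \<in> Hom C D A" and m: "m \<in> Hom C A M"
    and h: "h \<in> Hom C M (SObj C D)" and t: "(a, m, h) \<in> Tri C" and M: "M \<in> perp C T"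
    using approximation_triangle[OF AO] .
  obtain B D' S i j p q n where B: "B \<in> cones_add C T" and D': "D' \<in> add_objects C T"
    and S: "biproduct C B (SObj C D') S i j p q" and n: "n \<in> Hom C S A" "n \<in> weq \<inter> fib"
    using cofibrant_replacement[OF AO] .
  have MO: "M \<in> Obj C" using Hom_Obj[OF m] by simp
  note SD = biproductD[OF S]
  obtain s where s: "s \<in> Hom C A S" "n \<cdot> s = Ident C A"
    using surj_fromE[OF _ n(1) Ident_Hom[OF AO]] A n(2) unfolding projective_def by blast
  note mn = Cmp_Hom[OF n(1) m]
  note mni = Cmp_Hom[OF SD(1) mn] and mnj = Cmp_Hom[OF SD(2) mn]
  let ?th = "sum_through C (SObj C T)"
  have "?th B M (m \<cdot> n \<cdot> i)"
  proof -
    obtain R S0 f g b where R: "R \<in> add_objects C T" and S0: "S0 \<in> add_objects C T"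
      and g: "g \<in> Hom C S0 B" and b: "b \<in> Hom C B (SObj C R)" and tB: "(f, g, b) \<in> Tri C"
      using cones_addE[OF B] .
    have "m \<cdot> n \<cdot> i \<cdot> g = MZero C S0 M" using perp_zero[OF M S0 Cmp_Hom[OF g mni]] .
    then obtain k where "k \<in> Hom C (SObj C R) M" "k \<cdot> b = m \<cdot> n \<cdot> i"
      using Tri_extend[OF Tri_rotateD[OF tB] g b mni] by blast
    then show ?thesis using sum_through_via_add_objects[OF add_objects_SObj[OF R] b] by metis
  qed
  then have "?th S M (m \<cdot> n \<cdot> i \<cdot> p)" using sum_through_Cmp[OF _ MO SD(3)] by blast
  moreover have "?th S M (m \<cdot> n \<cdot> j \<cdot> q)"
    using sum_through_via_add_objects[OF add_objects_SObj[OF D'] SD(4) mnj] .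
  ultimately have "?th S M ((m \<cdot> n \<cdot> i \<cdot> p) \<boxplus> (m \<cdot> n \<cdot> j \<cdot> q))"
    using sum_through_add[OF _ _ SD(12) MO] by blast
  moreover have "(m \<cdot> n \<cdot> i \<cdot> p) \<boxplus> (m \<cdot> n \<cdot> j \<cdot> q) = m \<cdot> n"
    using Cmp_add_right[OF Cmp_Hom[OF SD(3,1)] Cmp_Hom[OF SD(4,2)] mn] Cmp_assoc[OF SD(3,1) mn]
      Cmp_assoc[OF SD(4,2) mn] SD(9) Ident_right[OF mn] by simp
  ultimately have "?th A M (m \<cdot> n \<cdot> s)" using sum_through_Cmp[OF _ MO s(1)] by simp
  then have m_th: "?th A M m" using Cmp_assoc[OF s(1) n(1) m] s(2) Ident_right[OF m] by simp
  have "\<exists>k'. ?th M M k' \<and> k' \<cdot> m = k" if "?th A M k" for k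
    using that
  proof induction
    case zero
    show ?case using sum_through.zero[of C "SObj C T" M M] zero_Cmp[OF m MO] by blast
  next
    case (step k a0 b0)
    obtain k' where k': "?th M M k'" "k' \<cdot> m = k" using step.IH by blast
    have "a0 \<cdot> a = MZero C D (SObj C T)"
      using perp_zero[OF shift_perp[OF T_add] D Cmp_Hom[OF a step.hyps(2)]] .
    then obtain a' where a': "a' \<in> Hom C M (SObj C T)" "a' \<cdot> m = a0"
      using Tri_extend[OF t a m step.hyps(2)] by blast
    have "(k' \<boxplus> (b0 \<cdot> a')) \<cdot> m = k \<boxplus> (b0 \<cdot> a0)"
      using Cmp_add_left[OF m sum_through_Hom[OF k'(1) MO MO] Cmp_Hom[OF a'(1) step.hyps(3)]]
        k'(2) Cmp_assoc[OF m a'(1) step.hyps(3)] a'(2) by simp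
    then show ?case using sum_through.step[OF k'(1) a'(1) step.hyps(3)] by blast
  qed
  then obtain k where k: "?th M M k" "k \<cdot> m = m" using m_th by blast
  note kH = sum_through_Hom[OF k(1) MO MO] and I = Ident_Hom[OF MO]
  note d = diff_Hom[OF I kH]
  have "MDiff C (Ident C M) k \<cdot> m = MZero C A M"
    using diff_Cmp[OF I kH m] k(2) Ident_left[OF m] diff_self[OF m] by simp
  then obtain e where e: "e \<in> Hom C (SObj C D) M" "e \<cdot> h = MDiff C (Ident C M) k"
    using Tri_extend[OF Tri_rotateD[OF t] m h d] by blast
  have "?th M M (k \<boxplus> (e \<cdot> h))"
    using sum_through_add[OF k(1) sum_through_via_add_objects[OF add_objects_SObj[OF D] h e(1)] MO MO] .
  then have "?th M M (Ident C M)" using e(2) add_diff(1)[OF I kH] by simp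
  then have M_add: "M \<in> add_objects C (SObj C T)" using MO add_objects_iff by blast
  obtain U where U: "U \<in> Obj C" "isomorphic C (SObj C U) M" using SObj_ess_surj[OF MO] by blast
  obtain y x where yx: "y \<in> Hom C (SObj C U) M" "x \<in> Hom C M (SObj C U)"
    "x \<cdot> y = Ident C (SObj C U)" "y \<cdot> x = Ident C M" using isomorphicE[OF U(2)] .
  have "U \<in> add_objects C T"
    using add_objects_SObj_reflect[OF add_objects_retract[OF M_add yx(1,2,3)] U(1) T_Obj] .
  moreover obtain g where "g \<in> Hom C U D" "(g, a, x \<cdot> m) \<in> Tri C"
    using Tri_unrotate[OF t a m yx(2,1,4,3) U(1)] by blast
  ultimately show ?thesis using cones_addI[OF _ D _ a] by blast
qed

lemma cones_add_iff_projective: "A \<in> cones_add C T \<longleftrightarrow> projective A"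
  using cones_projective projective_cones by blast

text \<open>Any lift of \<open>v\<close> is automatically compatible with \<open>u\<close>, since \<open>C(R,p)\<close> is injective.\<close>
lemma trivial_fibration_lifts:
  assumes p: "p \<in> weq \<inter> fib" and pH: "p \<in> Hom C X Y" and i: "i \<in> Hom C R A"
    and R: "R \<in> add_objects C T" and A: "projective A"
    and u: "u \<in> Hom C R X" and v: "v \<in> Hom C A Y" and eq: "p \<cdot> u = v \<cdot> i"
  shows "\<exists>a \<in> Hom C A X. a \<cdot> i = u \<and> p \<cdot> a = v"
proof -
  obtain a where a: "a \<in> Hom C A X" "p \<cdot> a = v"
    using surj_fromE[OF _ pH v] A p unfolding projective_def by blast
  have "a \<cdot> i = u"
    using inj_fromD[OF inj_from_add_objects[OF R pH] pH Cmp_Hom[OF i a(1)] u] weqD(2) p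
      Cmp_assoc[OF i a(1) pH] a(2) eq by simp
  then show ?thesis using a by blast
qed

text \<open>Lifting against the chosen representatives is lifting against all morphisms from \<open>add T\<close> to
  \<open>T \<ast> \<Sigma>T\<close>: conjugate by isomorphisms with the representatives.\<close>
lemma wfibT_lifts:
  assumes \<R>: "representatives C \<R> (add_objects C T)" and \<K>: "representatives C \<K> (cones_add C T)"
    and p: "p \<in> wfibT C \<R> \<K>" and pH: "p \<in> Hom C X Y" and i: "i \<in> Hom C R A"
    and R: "R \<in> add_objects C T" and A: "A \<in> cones_add C T"
    and u: "u \<in> Hom C R X" and v: "v \<in> Hom C A Y" and eq: "p \<cdot> u = v \<cdot> i"
  shows "\<exists>a \<in> Hom C A X. a \<cdot> i = u \<and> p \<cdot> a = v"
proof -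
  obtain R' where R': "R' \<in> \<R>" "isomorphic C R R'" using \<R> R unfolding representatives_def by blast
  obtain A' where A': "A' \<in> \<K>" "isomorphic C A A'" using \<K> A unfolding representatives_def by blast
  obtain b c where b: "b \<in> Hom C R R'" and c: "c \<in> Hom C R' R" and cb: "c \<cdot> b = Ident C R"
    using isomorphicE[OF R'(2)] by blast
  obtain d e where d: "d \<in> Hom C A A'" and e: "e \<in> Hom C A' A" and ed: "e \<cdot> d = Ident C A"
    using isomorphicE[OF A'(2)] by blast
  note ic = Cmp_Hom[OF c i]
  note dic = Cmp_Hom[OF ic d] and uc = Cmp_Hom[OF c u] and ve = Cmp_Hom[OF e v]
  have "d \<cdot> (i \<cdot> c) \<in> genI C \<R> \<K>" unfolding genI_def using R'(1) A'(1) dic by blast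
  moreover have "p \<cdot> (u \<cdot> c) = v \<cdot> e \<cdot> (d \<cdot> (i \<cdot> c))"
    using Cmp_assoc[OF c u pH] eq Cmp_assoc[OF c i v] Cmp_assoc[OF dic e v] Cmp_assoc[OF ic d e] ed
      Ident_left[OF ic] by simp
  ultimately obtain a where a: "a \<in> Hom C A' X" "a \<cdot> (d \<cdot> (i \<cdot> c)) = u \<cdot> c" "p \<cdot> a = v \<cdot> e"
    using rlpD[OF p[unfolded wfibT_def] _ pH dic uc ve] by blast
  note ad = Cmp_Hom[OF d a(1)]
  have "p \<cdot> (a \<cdot> d) = v"
    using Cmp_assoc[OF d a(1) pH] a(3) Cmp_assoc[OF d e v] ed Ident_right[OF v] by simp
  moreover have "a \<cdot> d \<cdot> i = u"
  proof -
    have "a \<cdot> d \<cdot> i \<cdot> c = u \<cdot> c"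
      using a(2) Cmp_assoc[OF c i ad] Cmp_assoc[OF ic d a(1)] by simp
    then have "a \<cdot> d \<cdot> i \<cdot> c \<cdot> b = u \<cdot> c \<cdot> b" by simp
    then show ?thesis
      using Cmp_assoc[OF b c Cmp_Hom[OF i ad]] Cmp_assoc[OF b c u] cb Ident_right[OF u]
        Ident_right[OF Cmp_Hom[OF i ad]] by simp
  qed
  ultimately show ?thesis using ad by blast
qed

text \<open>For the inclusion of \<open>I\<^sup>\<box>\<close>: the morphisms \<open>0 \<rightarrow> T\<close> and \<open>0 \<rightarrow> \<Sigma>T\<close> give the two surjectivity
  conditions, and \<open>T \<rightarrow> 0\<close> gives injectivity of \<open>C(T,p)\<close>.\<close>
lemma wfibT_eq:
  assumes \<R>: "representatives C \<R> (add_objects C T)" and \<K>: "representatives C \<K> (cones_add C T)"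
  shows "wfibT C \<R> \<K> = weq \<inter> fib"
proof (intro equalityI subsetI)
  fix p assume p: "p \<in> weq \<inter> fib"
  define X Y where "X = Dom C p" and "Y = Cod C p"
  have pH: "p \<in> Hom C X Y" using p Arr_Hom unfolding X_def Y_def fib_def by blast
  have sub: "R \<in> add_objects C T" "projective A" if "R \<in> \<R>" "A \<in> \<K>" for R A
    using \<R> \<K> that cones_projective unfolding representatives_def by blast+
  show "p \<in> wfibT C \<R> \<K>"
    unfolding wfibT_def
  proof (rule rlpI[OF pH])
    show "genI C \<R> \<K> \<subseteq> Arr C" unfolding genI_def using Hom_Arr by blast
    fix i R A u v
    assume i: "i \<in> genI C \<R> \<K>" "i \<in> Hom C R A" and uv: "u \<in> Hom C R X" "v \<in> Hom C A Y" "p \<cdot> u = v \<cdot> i"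
    obtain R' A' where R': "R' \<in> \<R>" "A' \<in> \<K>" "i \<in> Hom C R' A'" using i(1) unfolding genI_def by blast
    then have "R' = R" "A' = A"
      using Hom_Dom[OF i(2)] Hom_Cod[OF i(2)] Hom_Dom[OF R'(3)] Hom_Cod[OF R'(3)] by simp_all
    then show "\<exists>a \<in> Hom C A X. a \<cdot> i = u \<and> p \<cdot> a = v"
      using trivial_fibration_lifts[OF p pH i(2) _ _ uv] sub[OF R'(1,2)] by simp
  qed
next
  fix p assume p: "p \<in> wfibT C \<R> \<K>"
  define X Y where "X = Dom C p" and "Y = Cod C p"
  have pH: "p \<in> Hom C X Y" using p Arr_Hom unfolding X_def Y_def wfibT_def rlp_def by blast
  have X: "X \<in> Obj C" and Y: "Y \<in> Obj C" using Hom_Obj[OF pH] by auto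
  note lift = wfibT_lifts[OF \<R> \<K> p pH]
  obtain E where E: "zero_object C E" using ex_zero_object by blast
  note EO = zero_objectD(3)[OF E X] and E_add = add_objects_zero[OF E, of T]
  have surj: "surj_from A p" if A: "projective A" for A
  proof (rule surj_fromI[OF pH])
    have AO: "A \<in> Obj C" using A unfolding projective_def by blast
    fix v assume v: "v \<in> Hom C A Y"
    have "p \<cdot> MZero C E X = v \<cdot> MZero C E A" using Cmp_zero[OF pH EO] Cmp_zero[OF v EO] by simp
    then show "\<exists>x \<in> Hom C A X. p \<cdot> x = v"
      using lift[OF zero_Hom[OF EO AO] E_add projective_cones[OF A] zero_Hom[OF EO X] v] by blast
  qed
  have "inj_from T p"
  proof (rule inj_from_zeroI[OF pH T_Obj])
    fix u assume u: "u \<in> Hom C T X" "p \<cdot> u = MZero C T Y"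
    note TE = zero_Hom[OF T_Obj EO]
    have "p \<cdot> u = MZero C E Y \<cdot> MZero C T E" using u(2) zero_Cmp[OF TE Y] by simp
    then obtain a where "a \<in> Hom C E X" "a \<cdot> MZero C T E = u"
      using lift[OF TE T_add projective_cones[OF add_projective[OF E_add]] u(1) zero_Hom[OF EO Y]] by blast
    then show "u = MZero C T X" using Cmp_zero T_Obj by metis
  qed
  then show "p \<in> weq \<inter> fib"
    using weqI[OF pH surj[OF add_projective[OF T_add]]] fibI[OF pH surj[OF shift_projective[OF T_add]]]
    by blast
qed

section \<open>The model structure\<close>

abbreviation cof :: "'m set" where
  "cof \<equiv> llp C (weq \<inter> fib)"

lemma tfib_Arr: "weq \<inter> fib \<subseteq> Arr C"
  unfolding fib_def by blast

lemma cofibrant_iff: "cofibrant C cof A \<longleftrightarrow> projective A"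
proof
  assume "cofibrant C cof A"
  then obtain Z f where A: "A \<in> Obj C" and Z: "initial_object C Z" and f: "f \<in> Hom C Z A" "f \<in> cof"
    unfolding cofibrant_def by blast
  have "surj_from A p" if p: "p \<in> weq \<inter> fib" for p
  proof -
    define X Y where "X = Dom C p" and "Y = Cod C p"
    have pH: "p \<in> Hom C X Y" using p Arr_Hom unfolding X_def Y_def fib_def by blast
    show ?thesis
    proof (rule surj_fromI[OF pH])
      fix v assume v: "v \<in> Hom C A Y"
      have XY: "X \<in> Obj C" "Y \<in> Obj C" using Hom_Obj[OF pH] by auto
      obtain u where u: "u \<in> Hom C Z X" using Z XY(1) unfolding initial_object_def by blast
      have "p \<cdot> u = v \<cdot> f"
        using Z XY(2) Cmp_Hom[OF u pH] Cmp_Hom[OF f(1) v] unfolding initial_object_def by blast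
      then show "\<exists>x \<in> Hom C A X. p \<cdot> x = v" using llpD[OF f(2) p f(1) pH u v] by blast
    qed
  qed
  then show "projective A" unfolding projective_def using A by blast
next
  assume A: "projective A"
  then have AO: "A \<in> Obj C" unfolding projective_def by blast
  obtain Z where Z: "zero_object C Z" using ex_zero_object by blast
  have ZO: "Z \<in> Obj C" using zero_objectD(3)[OF Z AO] .
  have "MZero C Z A \<in> cof"
  proof (rule llpI[OF zero_Hom[OF ZO AO] _ tfib_Arr])
    fix p X Y u v
    assume p: "p \<in> weq \<inter> fib" "p \<in> Hom C X Y" and u: "u \<in> Hom C Z X" and v: "v \<in> Hom C A Y"
    obtain a where a: "a \<in> Hom C A X" "p \<cdot> a = v"
      using surj_fromE[OF _ p(2) v] A p(1) unfolding projective_def by blast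
    have X: "X \<in> Obj C" using Hom_Obj[OF p(2)] by simp
    have "a \<cdot> MZero C Z A = u" using Cmp_zero[OF a(1) ZO] u zero_objectD(1)[OF Z X] by auto
    then show "\<exists>a \<in> Hom C A X. a \<cdot> MZero C Z A = u \<and> p \<cdot> a = v" using a by blast
  qed
  then show "cofibrant C cof A"
    unfolding cofibrant_def using AO Z zero_Hom[OF ZO AO] unfolding zero_object_def by blast
qed

lemma all_fibrant:
  assumes X: "X \<in> Obj C"
  shows "fibrant C fib X"
proof -
  obtain Z where Z: "zero_object C Z" using ex_zero_object by blast
  have ZO: "Z \<in> Obj C" using zero_objectD(3)[OF Z X] .
  have ST: "SObj C T \<in> Obj C" using SObj_Obj[OF T_Obj] .
  note f = zero_Hom[OF X ZO]
  have "surj_from (SObj C T) (MZero C X Z)"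
  proof (rule surj_fromI[OF f])
    fix y assume y: "y \<in> Hom C (SObj C T) Z"
    have "MZero C X Z \<cdot> MZero C (SObj C T) X = y"
      using Cmp_zero[OF f ST] y zero_objectD(2)[OF Z ST] by auto
    then show "\<exists>x \<in> Hom C (SObj C T) X. MZero C X Z \<cdot> x = y" using zero_Hom[OF ST X] by blast
  qed
  then show ?thesis
    unfolding fibrant_def using X Z f fibI[OF f] unfolding zero_object_def by blast
qed

text \<open>These inclusions are the basic trivial cofibrations; \<open>0 \<rightarrow> \<Sigma>T\<close> is the generating case.\<close>
lemma shift_summand_lifts:
  assumes b: "biproduct C X (SObj C D) S i j p q" and D: "D \<in> add_objects C T"
  shows "i \<in> llp C fib"
proof (rule llpI[OF biproductD(1)[OF b]])
  note bD = biproductD[OF b]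
  show "fib \<subseteq> Arr C" unfolding fib_def by blast
  fix g V W u v
  assume g: "g \<in> fib" "g \<in> Hom C V W" and u: "u \<in> Hom C X V" and v: "v \<in> Hom C S W"
    and eq: "g \<cdot> u = v \<cdot> i"
  obtain w where w: "w \<in> Hom C (SObj C D) V" "g \<cdot> w = v \<cdot> j"
    using surj_fromE[OF surj_from_add_objects[OF add_objects_SObj[OF D] g(2) fibD[OF g(1)]] g(2)
        Cmp_Hom[OF bD(2) v]] .
  obtain m where m: "m \<in> Hom C S V" "m \<cdot> i = u" "m \<cdot> j = w" using biproduct_copair[OF b u w(1)] by blast
  have "g \<cdot> m = v"
    using biproduct_copair_unique[OF b Cmp_Hom[OF m(1) g(2)] v] Cmp_assoc[OF bD(1) m(1) g(2)]
      Cmp_assoc[OF bD(2) m(1) g(2)] m eq w(2) by simp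
  then show "\<exists>a \<in> Hom C S V. a \<cdot> i = u \<and> g \<cdot> a = v" using m by blast
qed

text \<open>The retract argument: factor \<open>f\<close> as \<open>m i\<close> with \<open>i\<close> the inclusion of \<open>X\<close> into \<open>X \<oplus> \<Sigma>D\<close> and \<open>m\<close> a
  fibration. Then \<open>m\<close> is a trivial fibration, so the cofibration \<open>f\<close> lifts against it and becomes a
  retract of \<open>i\<close>.\<close>
lemma trivial_cofibration_lifts: "weq \<inter> cof \<subseteq> llp C fib"
proof
  fix f assume f: "f \<in> weq \<inter> cof"
  define X Y where "X = Dom C f" and "Y = Cod C f"
  have fH: "f \<in> Hom C X Y" using f Arr_Hom unfolding X_def Y_def weq_def by blast
  have XY: "X \<in> Obj C" "Y \<in> Obj C" using Hom_Obj[OF fH] by auto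
  obtain D S i j p q m where D: "D \<in> add_objects C T" and S: "biproduct C X (SObj C D) S i j p q"
    and m: "m \<in> Hom C S Y" "m \<cdot> i = f" "m \<in> fib" "i \<in> weq" using fibrant_replacement_of_arrow[OF fH] .
  note i = biproductD(1)[OF S]
  have mt: "m \<in> weq \<inter> fib" using weq_left[OF i m(1,4)] m(2,3) f by simp
  have "m \<cdot> i = Ident C Y \<cdot> f" using m(2) Ident_left[OF fH] by simp
  then obtain a where a: "a \<in> Hom C Y S" "a \<cdot> f = i" "m \<cdot> a = Ident C Y"
    using llpD[OF _ mt fH m(1) i Ident_Hom[OF XY(2)]] f by blast
  have "retract_of C f i"
    unfolding retract_of_def Hom_Dom[OF fH] Hom_Cod[OF fH] Hom_Dom[OF i] Hom_Cod[OF i]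
    using Hom_Arr[OF fH] Hom_Arr[OF i] Ident_Hom[OF XY(1)] a m Ident_left[OF Ident_Hom[OF XY(1)]]
      Ident_right[OF i] Ident_right[OF fH] by (metis (no_types))
  then show "f \<in> llp C fib"
    using llp_retract[OF shift_summand_lifts[OF S D]] unfolding fib_def by blast
qed

lemma factor_trivial_cofibration:
  assumes f: "f \<in> Arr C"
  shows "\<exists>i p. i \<in> weq \<inter> cof \<and> p \<in> fib \<and> Cod C i = Dom C p \<and> f = p \<cdot> i"
proof -
  obtain D S i j p q m where D: "D \<in> add_objects C T"
    and S: "biproduct C (Dom C f) (SObj C D) S i j p q"
    and m: "m \<in> Hom C S (Cod C f)" "m \<cdot> i = f" "m \<in> fib" "i \<in> weq"
    using fibrant_replacement_of_arrow[OF Arr_Hom[OF f]] .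
  have "i \<in> cof" using shift_summand_lifts[OF S D] unfolding llp_def by blast
  moreover have "Cod C i = Dom C m" using Hom_Cod[OF biproductD(1)[OF S]] Hom_Dom[OF m(1)] by simp
  ultimately show ?thesis using m(3,4) m(2)[symmetric] by blast
qed

lemma homotopy_cofibration_projective:
  assumes A: "projective A" and j: "j \<in> Hom C A B" "j \<in> homotopy_cofibrations C weq fib"
  shows "projective B"
proof -
  have "surj_from B p" if p: "p \<in> weq \<inter> fib" for p
  proof -
    define X Y where "X = Dom C p" and "Y = Cod C p"
    have pH: "p \<in> Hom C X Y" using p Arr_Hom unfolding X_def Y_def fib_def by blast
    show ?thesis
    proof (rule surj_fromI[OF pH])
      fix v assume v: "v \<in> Hom C B Y"
      obtain u where u: "u \<in> Hom C A X" "p \<cdot> u = v \<cdot> j"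
        using surj_fromE[OF _ pH Cmp_Hom[OF j(1) v]] A p unfolding projective_def by blast
      then show "\<exists>x \<in> Hom C B X. p \<cdot> x = v"
        using j(2) p v unfolding homotopy_cofibrations_def lifts_right_def
          Hom_Dom[OF pH, symmetric] Hom_Cod[OF pH, symmetric] Hom_Dom[OF j(1), symmetric]
          Hom_Cod[OF j(1), symmetric] by blast
    qed
  qed
  then show ?thesis unfolding projective_def using Hom_Obj[OF j(1)] by blast
qed

text \<open>The second component \<open>b : X \<rightarrow> \<Sigma>R\<close> of \<open>j\<close> is taken from a presentation of \<open>X\<close> as a cone, because
  then every morphism out of \<open>X\<close> that vanishes on \<open>add T\<close> factors through \<open>b = q j\<close>, hence through \<open>j\<close>.\<close>
lemma factor_homotopy_cofibration:
  assumes f: "f \<in> Hom C X Y" and X: "projective X"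
  shows "\<exists>j p. j \<in> homotopy_cofibrations C weq fib \<and> p \<in> weq \<inter> fib \<and> Cod C j = Dom C p \<and> f = p \<cdot> j"
proof -
  have XO: "X \<in> Obj C" and Y: "Y \<in> Obj C" using Hom_Obj[OF f] by auto
  obtain R S0 r a b where R: "R \<in> add_objects C T" and S0: "S0 \<in> add_objects C T"
    and r: "r \<in> Hom C R S0" and a: "a \<in> Hom C S0 X" and b: "b \<in> Hom C X (SObj C R)"
    and t: "(r, a, b) \<in> Tri C" using cones_addE[OF projective_cones[OF X]] .
  obtain Q m where m: "m \<in> Hom C Q Y" and mt: "m \<in> weq \<inter> fib" and Q: "projective Q"
    using cofibrant_replacement[OF Y] by metis
  have QO: "Q \<in> Obj C" using Hom_Obj[OF m] by simp
  obtain f' where f': "f' \<in> Hom C X Q" "m \<cdot> f' = f"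
    using surj_fromE[OF _ m f] X mt unfolding projective_def by blast
  obtain S i k p q where S: "biproduct C Q (SObj C R) S i k p q"
    using ex_biproduct[OF QO SObj_Obj[OF add_objects_Obj[OF R]]] .
  note SD = biproductD[OF S]
  obtain j where j: "j \<in> Hom C X S" "p \<cdot> j = f'" "q \<cdot> j = b" using biproduct_pair[OF S f'(1) b] by blast
  have "p \<in> weq" using biproduct_perp_weq(2)[OF S shift_perp[OF R]] .
  then have "m \<cdot> p \<in> weq" using weq_cmp[OF SD(3) m] mt by blast
  moreover have "m \<cdot> p \<in> fib"
    using fibI[OF Cmp_Hom[OF SD(3) m] surj_from_Cmp[OF SD(3) m split_surj_from[OF SD(3,1,5)]]] fibD mt
    by blast
  moreover have "f = m \<cdot> p \<cdot> j" using Cmp_assoc[OF j(1) SD(3) m] j(2) f'(2) by simp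
  moreover have "j \<in> homotopy_cofibrations C weq fib"
  proof -
    have "lifts_right C weq j g \<and> lifts_left C weq j g" if g: "g \<in> weq \<inter> fib" for g
    proof -
      define V W where "V = Dom C g" and "W = Cod C g"
      have gH: "g \<in> Hom C V W" using g Arr_Hom unfolding V_def W_def fib_def by blast
      have both: "\<exists>a1 \<in> Hom C S V. g \<cdot> a1 = v \<and> right_homotopic C weq (a1 \<cdot> j) u"
           "\<exists>a2 \<in> Hom C S V. left_homotopic C weq (g \<cdot> a2) v \<and> a2 \<cdot> j = u"
        if u: "u \<in> Hom C X V" and v: "v \<in> Hom C S W" and eq: "g \<cdot> u = v \<cdot> j" for u v
      proof -
        have SP: "projective S" using projective_biproduct[OF S Q shift_projective[OF R]] .
        \<comment> \<open>Projectivity of \<open>S\<close> gives \<open>e\<close> with \<open>g e = v\<close>; then \<open>e j\<close> and \<open>u\<close> agree on \<open>add T\<close> because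
          \<open>C(-,g)\<close> is injective there.\<close>
        obtain e where e: "e \<in> Hom C S V" "g \<cdot> e = v"
          using surj_fromE[OF _ gH v] SP g unfolding projective_def by blast
        note ej = Cmp_Hom[OF j(1) e(1)]
        have ej_eq: "e \<cdot> j \<cdot> x = u \<cdot> x" if D: "D \<in> add_objects C T" and x: "x \<in> Hom C D X" for x D
          using inj_fromD[OF inj_from_add_objects[OF D gH] gH Cmp_Hom[OF x ej] Cmp_Hom[OF x u]]
            weqD(2) g Cmp_assoc[OF x ej gH] Cmp_assoc[OF j(1) e(1) gH] Cmp_assoc[OF x u gH] e(2) eq
          by simp
        then have "right_homotopic C weq (e \<cdot> j) u" using right_homotopic_iff[OF ej u] T_add by blast
        then show "\<exists>a1 \<in> Hom C S V. g \<cdot> a1 = v \<and> right_homotopic C weq (a1 \<cdot> j) u" using e by blast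
        note d = diff_Hom[OF u ej]
        have "MDiff C u (e \<cdot> j) \<cdot> a = MZero C S0 V"
          using diff_Cmp[OF u ej a] ej_eq[OF S0 a] diff_self[OF Cmp_Hom[OF a u]] by simp
        then obtain z where z: "z \<in> Hom C (SObj C R) V" "z \<cdot> b = MDiff C u (e \<cdot> j)"
          using Tri_extend[OF Tri_rotateD[OF t] a b d] by blast
        note zq = Cmp_Hom[OF SD(4) z(1)]
        \<comment> \<open>Correcting \<open>e\<close> by a morphism through \<open>\<Sigma>R\<close> makes the upper triangle commute strictly and does not
          change the morphism on \<open>T\<close>.\<close>
        let ?e = "e \<boxplus> (z \<cdot> q)"
        have e': "?e \<in> Hom C S V" using add_Hom[OF e(1) zq] .
        have "?e \<cdot> j = u"
          using Cmp_add_left[OF j(1) e(1) zq] Cmp_assoc[OF j(1) SD(4) z(1)] j(3) z(2)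
            add_diff(1)[OF u ej] by simp
        moreover have "g \<cdot> ?e \<cdot> x = v \<cdot> x" if x: "x \<in> Hom C T S" for x
        proof -
          have V: "V \<in> Obj C" using Hom_Obj[OF gH] by simp
          have "q \<cdot> x = MZero C T (SObj C R)" using perp_zero[OF shift_perp[OF R] T_add Cmp_Hom[OF x SD(4)]] .
          then have "?e \<cdot> x = e \<cdot> x"
            using Cmp_add_left[OF x e(1) zq] Cmp_assoc[OF x SD(4) z(1)] Cmp_zero[OF z(1) T_Obj]
              add_zero[OF Cmp_Hom[OF x e(1)]] by simp
          then show ?thesis using Cmp_assoc[OF x e' gH] Cmp_assoc[OF x e(1) gH] e(2) by simp
        qed
        then have "left_homotopic C weq (g \<cdot> ?e) v" using left_homotopic_iff[OF Cmp_Hom[OF e' gH] v] by blast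
        ultimately show "\<exists>a2 \<in> Hom C S V. left_homotopic C weq (g \<cdot> a2) v \<and> a2 \<cdot> j = u" using e' by blast
      qed
      show ?thesis
        unfolding lifts_right_def lifts_left_def Hom_Dom[OF gH] Hom_Cod[OF gH] Hom_Dom[OF j(1)] Hom_Cod[OF j(1)]
        using both by blast
    qed
    then show ?thesis unfolding homotopy_cofibrations_def using Hom_Arr[OF j(1)] by blast
  qed
  moreover have "Cod C j = Dom C (m \<cdot> p)" using Hom_Cod[OF j(1)] Hom_Dom[OF Cmp_Hom[OF SD(3) m]] by simp
  ultimately show ?thesis by blast
qed

text \<open>Since \<open>e\<close> splits, \<open>Z = Y \<oplus> V\<close> and \<open>X \<oplus> V\<close> is the pull-back.\<close>
lemma pullback_along_epi_exists:
  assumes p: "p \<in> Hom C X Y" and e: "epi C e" and eH: "e \<in> Hom C Z Y"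
  shows "\<exists>P p' e'. is_pullback C p e P p' e'"
proof -
  obtain s where s: "s \<in> Hom C Y Z" "e \<cdot> s = Ident C Y" using epi_split[OF e eH] by blast
  obtain V j c where Z: "biproduct C Y V Z s j e c" using retract_biproduct[OF s(1) eH s(2)] by blast
  note ZD = biproductD[OF Z]
  have X: "X \<in> Obj C" using Hom_Obj[OF p] by simp
  obtain P i1 j1 p1 q1 where P: "biproduct C X V P i1 j1 p1 q1" using ex_biproduct[OF X ZD(11)] .
  note PD = biproductD[OF P]
  obtain p' where p': "p' \<in> Hom C P Z" "e \<cdot> p' = p \<cdot> p1" "c \<cdot> p' = q1"
    using biproduct_pair[OF Z Cmp_Hom[OF PD(3) p] PD(4)] by blast
  have univ: "\<exists>!u. u \<in> Hom C Q P \<and> p1 \<cdot> u = a \<and> p' \<cdot> u = b"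
    if a: "a \<in> Hom C Q X" and b: "b \<in> Hom C Q Z" and eq: "p \<cdot> a = e \<cdot> b" for Q a b
  proof -
    obtain u where u: "u \<in> Hom C Q P" "p1 \<cdot> u = a" "q1 \<cdot> u = c \<cdot> b"
      using biproduct_pair[OF P a Cmp_Hom[OF b ZD(4)]] by blast
    have "p' \<cdot> u = b"
      using biproduct_pair_unique[OF Z Cmp_Hom[OF u(1) p'(1)] b] Cmp_assoc[OF u(1) p'(1) eH]
        Cmp_assoc[OF u(1) p'(1) ZD(4)] Cmp_assoc[OF u(1) PD(3) p] p' u eq by simp
    moreover have "w = u" if w: "w \<in> Hom C Q P" "p1 \<cdot> w = a" "p' \<cdot> w = b" for w
      using biproduct_pair_unique[OF P w(1) u(1)] w u Cmp_assoc[OF w(1) p'(1) ZD(4)] p'(3) by simp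
    ultimately show ?thesis using u by blast
  qed
  have "is_pullback C p e P p' p1"
    unfolding is_pullback_def Hom_Dom[OF p] Hom_Cod[OF p] Hom_Dom[OF eH] Hom_Cod[OF eH]
    using PD(12) Hom_Arr[OF p] Hom_Arr[OF eH] p' PD(3) univ by simp
  then show ?thesis by blast
qed

lemma inclusion_cofibration:
  assumes B: "projective B" and P: "is_coproduct C A B P s t \<or> is_coproduct C B A P t s"
  shows "s \<in> cof"
proof -
  have s: "s \<in> Hom C A P" and t: "t \<in> Hom C B P" using P unfolding is_coproduct_def by blast+
  have ex: "\<exists>!m. m \<in> Hom C P V \<and> m \<cdot> s = u \<and> m \<cdot> t = w" if "u \<in> Hom C A V" "w \<in> Hom C B V" for u w V
    using P
  proof
    assume "is_coproduct C A B P s t"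
    then show ?thesis using that unfolding is_coproduct_def by blast
  next
    assume "is_coproduct C B A P t s"
    then have "\<exists>!m. m \<in> Hom C P V \<and> m \<cdot> t = w \<and> m \<cdot> s = u"
      using that unfolding is_coproduct_def by blast
    then show ?thesis by (simp add: conj_commute)
  qed
  show ?thesis
  proof (rule llpI[OF s _ tfib_Arr])
    fix p X Y u v
    assume p: "p \<in> weq \<inter> fib" "p \<in> Hom C X Y" and u: "u \<in> Hom C A X" and v: "v \<in> Hom C P Y"
      and eq: "p \<cdot> u = v \<cdot> s"
    obtain w where w: "w \<in> Hom C B X" "p \<cdot> w = v \<cdot> t"
      using surj_fromE[OF _ p(2) Cmp_Hom[OF t v]] B p(1) unfolding projective_def by blast
    obtain m where m: "m \<in> Hom C P X" "m \<cdot> s = u" "m \<cdot> t = w" using ex[OF u w(1)] by blast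
    have "p \<cdot> m \<cdot> s = v \<cdot> s" "p \<cdot> m \<cdot> t = v \<cdot> t"
      using Cmp_assoc[OF s m(1) p(2)] Cmp_assoc[OF t m(1) p(2)] m(2,3) eq w(2) by simp_all
    then have "p \<cdot> m = v"
      using ex[OF Cmp_Hom[OF s v] Cmp_Hom[OF t v]] Cmp_Hom[OF m(1) p(2)] v by blast
    then show "\<exists>a \<in> Hom C P X. a \<cdot> s = u \<and> p \<cdot> a = v" using m by blast
  qed
qed

text \<open>Both conditions say that the difference is killed by \<open>C(T,-)\<close>: if it is, it vanishes on \<open>S\<close> in a
  presentation \<open>R \<rightarrow> S \<rightarrow> X \<rightarrow> \<Sigma>R\<close>, and so factors through \<open>\<Sigma>R\<close>.\<close>
lemma homotopic_iff:
  assumes X: "projective X" and f: "f \<in> Hom C X Y" and g: "g \<in> Hom C X Y"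
  shows "homotopic C weq f g \<longleftrightarrow> factors_through C (MDiff C f g) (add_objects C (SObj C T))"
proof -
  note d = diff_Hom[OF f g]
  obtain R S r a b where R: "R \<in> add_objects C T" and S: "S \<in> add_objects C T"
    and a: "a \<in> Hom C S X" and b: "b \<in> Hom C X (SObj C R)"
    and t: "(r, a, b) \<in> Tri C" using cones_addE[OF projective_cones[OF X]] .
  have "homotopic C weq f g \<longleftrightarrow> (\<forall>x \<in> Hom C T X. f \<cdot> x = g \<cdot> x)"
    unfolding homotopic_def left_homotopic_iff[OF f g] right_homotopic_iff[OF f g] by blast
  also have "\<dots> \<longleftrightarrow> (\<forall>x \<in> Hom C T X. MDiff C f g \<cdot> x = MZero C T Y)"
    using diff_Cmp[OF f g] diff_zero_iff[OF Cmp_Hom[OF _ f] Cmp_Hom[OF _ g]] by auto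
  also have "\<dots> \<longleftrightarrow> factors_through C (MDiff C f g) (add_objects C (SObj C T))" (is "?L \<longleftrightarrow> ?R")
  proof
    assume L: ?L
    have "MDiff C f g \<cdot> a = MZero C S Y"
    proof (rule add_objects_epi[OF S Cmp_Hom[OF a d]])
      fix x assume x: "x \<in> Hom C T S"
      show "MDiff C f g \<cdot> a \<cdot> x = MZero C T Y" using L Cmp_Hom[OF x a] Cmp_assoc[OF x a d] by simp
    qed
    then obtain z where z: "z \<in> Hom C (SObj C R) Y" "z \<cdot> b = MDiff C f g"
      using Tri_extend[OF Tri_rotateD[OF t] a b d] by blast
    then show ?R
      unfolding factors_through_def Hom_Dom[OF d] Hom_Cod[OF d]
      using add_objects_SObj[OF R] b Hom_Arr[OF d] z(2)[symmetric] by blast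
  next
    assume ?R
    then obtain P k l where P: "P \<in> add_objects C (SObj C T)" "k \<in> Hom C X P" "l \<in> Hom C P Y"
      "MDiff C f g = l \<cdot> k" unfolding factors_through_def Hom_Dom[OF d] Hom_Cod[OF d] by blast
    have "P \<in> perp C T" using add_objects_perp[OF shift_perp[OF T_add] P(1) T_Obj] .
    then have "factors_through C (MDiff C f g) (perp C T)"
      unfolding factors_through_def Hom_Dom[OF d] Hom_Cod[OF d] using P Hom_Arr[OF d] by blast
    then show ?L using factors_through_perp_iff[OF d] by blast
  qed
  finally show ?thesis .
qed

lemma model_structure: "left_weak_model_category C weq cof fib"
proof (unfold_locales)
  show "weq \<subseteq> Arr C" "fib \<subseteq> Arr C" "cof \<subseteq> Arr C" unfolding weq_def fib_def llp_def by blast+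
  show "has_finite_products C" "has_finite_coproducts C" using finite_products finite_coproducts .
  fix p e assume p: "p \<in> weq \<inter> fib" and e: "epi C e" "Cod C e = Cod C p"
  have pH: "p \<in> Hom C (Dom C p) (Cod C p)" using p Arr_Hom unfolding fib_def by blast
  have "e \<in> Hom C (Dom C e) (Cod C p)" using e Arr_Hom[of e] unfolding epi_def by simp
  then show "\<exists>P p' e'. is_pullback C p e P p' e'" using pullback_along_epi_exists[OF pH e(1)] by blast
next
  fix p e P p' e' assume p: "p \<in> weq \<inter> fib" and pb: "is_pullback C p e P p' e'"
  have pH: "p \<in> Hom C (Dom C p) (Cod C p)" using p Arr_Hom unfolding fib_def by blast
  have "p' \<in> Arr C" using pb Hom_Arr unfolding is_pullback_def by blast
  then show "p' \<in> weq \<inter> fib"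
    using pullback_surj_from[OF pb pH] pullback_inj_from[OF pb pH] p unfolding weq_def fib_def by blast
next
  show "cofibrant C cof B" if "cofibrant C cof A" "j \<in> Hom C A B" "j \<in> homotopy_cofibrations C weq fib" for A j B
    using homotopy_cofibration_projective that unfolding cofibrant_iff by blast
  show "s \<in> cof" if "cofibrant C cof B" "A \<in> Obj C" "is_coproduct C A B P s t" for A B P s t
    using inclusion_cofibration[of B A P s t] that unfolding cofibrant_iff by blast
  show "t \<in> cof" if "cofibrant C cof B" "A \<in> Obj C" "is_coproduct C B A P s t" for A B P s t
    using inclusion_cofibration[of B A P t s] that unfolding cofibrant_iff by blast
  show "g \<cdot> f \<in> weq" if "f \<in> Hom C X Y" "g \<in> Hom C Y Z" "f \<in> weq" "g \<in> weq" for f g X Y Z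
    using weq_cmp that .
  show "g \<in> weq" if "f \<in> Hom C X Y" "g \<in> Hom C Y Z" "f \<in> weq" "g \<cdot> f \<in> weq" for f g X Y Z
    using weq_left that .
  show "f \<in> weq" if "f \<in> Hom C X Y" "g \<in> Hom C Y Z" "g \<in> weq" "g \<cdot> f \<in> weq" for f g X Y Z
    using weq_right that .
  show "stable_class C weq" "stable_class C fib" using weq_stable fib_stable .
  show "stable_class C cof" using llp_stable[OF tfib_Arr] .
  show "weq \<inter> cof \<subseteq> llp C fib" using trivial_cofibration_lifts .
  show "cof \<subseteq> llp C (fib \<inter> weq)" by (simp add: Int_commute)
  show "\<exists>i p. i \<in> weq \<inter> cof \<and> p \<in> fib \<and> Cod C i = Dom C p \<and> f = p \<cdot> i" if "f \<in> Arr C" for f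
    using factor_trivial_cofibration[OF that] .
  show "\<exists>j p. j \<in> homotopy_cofibrations C weq fib \<and> p \<in> weq \<inter> fib \<and> Cod C j = Dom C p \<and> f = p \<cdot> j"
    if "f \<in> Arr C" "cofibrant C cof (Dom C f)" for f
    using factor_homotopy_cofibration[OF Arr_Hom[OF that(1)]] that(2) unfolding cofibrant_iff .
qed

end

theorem theorem0p7:
  fixes C :: "('o, 'm) triangulated_category"
    and T E :: 'o
    and \<R> \<K> :: "'o set"
  assumes "triangulated_category C"
    and "T \<in> Obj C"
    and "rigid C T"
    and "contravariantly_finite C T"
    and "zero_object C E"
    and "representatives C \<R> (add_objects C T)"
    and "representatives C \<K> (cones_add C T)"
  shows "left_weak_model_category C (weqT C T) (cofT C \<R> \<K>) (fibT C E T)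
    \<and> (\<forall>X \<in> Obj C. fibrant C (fibT C E T) X)
    \<and> (\<forall>X \<in> Obj C. cofibrant C (cofT C \<R> \<K>) X \<longleftrightarrow> X \<in> cones_add C T)
    \<and> (\<forall>X \<in> Obj C. \<forall>Y \<in> Obj C.
         fibrant C (fibT C E T) X \<and> cofibrant C (cofT C \<R> \<K>) X \<and>
         fibrant C (fibT C E T) Y \<and> cofibrant C (cofT C \<R> \<K>) Y \<longrightarrow>
         (\<forall>f \<in> Hom C X Y. \<forall>g \<in> Hom C X Y.
            homotopic C (weqT C T) f g \<longleftrightarrow>
            factors_through C (MDiff C f g) (add_objects C (SObj C T))))"
proof -
  interpret triangulated_category C by fact
  interpret rigid_object C T by unfold_locales fact+
  note fib = fibT_eq[OF assms(5)]
  have cof: "cofT C \<R> \<K> = cof" unfolding cofT_def wfibT_eq[OF assms(6,7)] ..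
  show ?thesis
    unfolding weqT_eq fib cof cofibrant_iff cones_add_iff_projective
    using model_structure all_fibrant homotopic_iff by blast
qed

end
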